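(* With the setting and notation of the context (in particular the polynomials $b_n(E)=\pi^{-n}E\,Q_n(E^{q+1})$, $Q_n\in\mathfrak o_K[x]$, $n\ge 0$), the following hold. (1) Suppose $x\in\mathbb C_p$ satisfies $|x-1|\le|\pi|$. Then $|\pi^{-n}Q_n(x)|\le|\pi|^{-\frac{2}{q}n}$ for all $n\ge 0$. Hence, for $\alpha\in\mathfrak o_{K_2}^*$, $|\alpha-1|\le|\pi|$ implies $\left|b_n\left(\frac{\bar\alpha}{\alpha}\right)\right|\le|\pi|^{-\frac{2}{q}n}$ for all $n\ge 0$. (2) Suppose $|\pi|^{\frac{q}{q+1}}\le r<1$ and $x\in\mathbb C_p$ satisfies $|x-1|\le r$. Then $|Q_n(x)|\le r^{\frac{n(q-1)}{q}}$ for all $n\ge 0$. In particular, the action of the group $$\left\{\begin{pmatrix}\alpha&0\\0&\bar\alpha\end{pmatrix}\;\Big|\;\alpha\in 1+\pi\mathfrak o_{K_2}\right\}\subset\mathfrak o_D^*=G$$ on the disc $\Delta_0=\{u\in X : |u|\le|\pi|^{\frac1{q+1}}\}$ extends to a rigid-analytic action of the rigid-analytic group $\mathbb T_0^\circ$ on $\Delta_0$.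
   Context: Let $K$ be a finite extension of $\mathbb Q_p$ with ring of integers $\mathfrak o_K$, uniformizer $\pi$ and residue field $\mathbb F_q$; $|\cdot|$ denotes the absolute value on $\mathbb C_p\supset K$. Let $K_2/K$ be the unramified quadratic extension with ring of integers $\mathfrak o_{K_2}$ and let $\alpha\mapsto\bar\alpha$ be the non-trivial element of $\mathrm{Gal}(K_2/K)$. Let $\bar F$ be a formal $\mathfrak o_K$-module of $K$-height 2 over $\overline{\mathbb F}_p$ and $G=\mathrm{Aut}(\bar F)$, identified with $\mathfrak o_D^*$, where $\mathfrak o_D$ is the maximal compact subring of the quaternion division algebra $D=\left\{\begin{pmatrix}\alpha&\pi\bar\beta\\ \beta&\bar\alpha\end{pmatrix}: \alpha,\beta\in K_2\right\}\subset M_2(K_2)$. The deformation space of $\bar F$ is $\mathrm{Spf}(\hat{\mathfrak o}^{nr}[[u]])$, with $\hat{\mathfrak o}^{nr}$ the completion of the maximal unramified extension of $\mathfrak o_K$; $G$ acts naturally on it, hence on its rigid-analytic generic fibre $X=\{u:|u|<1\}$. Here $u$ is the Gross–Hopkins coordinate, for which the period map $\Phi:X\to(\mathbb P^1)^{\rm rig}$, $u\mapsto[\phi_0(u):\phi_1(u)]$, is $G$-equivariant for the action $\begin{pmatrix}\alpha&\pi\bar\beta\\ \beta&\bar\alpha\end{pmatrix}\cdot[x_0:x_1]=[\alpha x_0+\beta x_1:\pi\bar\beta x_0+\bar\alpha x_1]$, and $\phi_0(u)=\sum_{n\ge0}c_nu^n$, $\phi_1(u)=\sum_{n\ge1}d_nu^n$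 with: $c_0=1$; $c_n=\pi^{-(k+1)/2}$ if $n=q^{2a_0}+q^{2a_1+1}+\dots+q^{2a_k+k}$ with integers $0\le a_0\le\dots\le a_k$ for some odd $k$, and $c_n=0$ for all other $n\geq 1$; $d_n=\pi^{-k/2}$ if $n=q^{2a_0}+q^{2a_1+1}+\dots+q^{2a_k+k}$ with $0\le a_0\le\dots\le a_k$ for some even $k\ge0$, and $d_n=0$ otherwise. For $g=\mathrm{diag}(\alpha,\bar\alpha)$, $\alpha\in\mathfrak o_{K_2}^*$, the action of $g$ on $X$ is given by a power series $g\cdot u=\sum_{n\ge0}a_n(g)u^n$. By equivariance of $\Phi$, $a_n(g)=a_n(E)$ is a polynomial in $E=\bar\alpha/\alpha$; these polynomials are determined by $a_0=0$ and the formal identity $E\,\phi_1(u)\,\phi_0(A(u))=\phi_0(u)\,\phi_1(A(u))$, $A(u)=\sum_{n}a_n(E)u^n$. One has $a_n=0$ unless $q+1\mid n-1$. Put $b_k(E)=a_{1+k(q+1)}(E)$, $k\ge0$. Then $b_k(E)=\pi^{-k}E\,Q_k(E^{q+1})$ for a unique polynomial $Q_k\in\mathfrak o_K[x]$. Fix $\zeta\in\mathfrak o_{K_2}^*$ with $\bar\zeta=-\zeta$. Let $\mathbb T=\mathrm{Spec}\left(\mathfrak o_K[a_1,a_2]\left[\frac1{a_1^2-\zeta^2a_2^2}\right]\right)$ be the group scheme corresponding to the torus $\mathfrak o_{K_2}^*\subset\mathfrak o_D^*$ via $\alpha=a_1+\zeta a_2$, $\bar\alpha=a_1-\zeta a_2$.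 $\mathbb T_0^\circ$ is the rigid-analytic subgroup $\{(a_1,a_2): |a_1-1|<1,\ |a_2|<1\}$ of $(\mathbb T_K)^{\rm rig}$.
   Formalization: For p=2 the group of α in 1+πo_{K_2} is not contained in T_0° (K=Q_2, ζ=√−3, α=2+√−3 gives (a_1,a_2)=(2,1)), so there the rigid action is only claimed to agree with the given one for those α whose point lies in T_0°; for odd p the claim is complete. *)

theory Defs
  imports
    "HOL-Analysis.Analysis"
    "HOL-Algebra.Embedded_Algebras"
    "HOL-Algebra.Algebraic_Closure_Type"
begin

section \<open>The field of p-adic complex numbers and its subfields\<close>

text \<open>
  There is no type of p-adic complex numbers, so the field is a type \<open>'c\<close> with an absolute
  value \<open>av\<close>, and subfields are subsets of \<open>'c\<close>.  All limits are taken in the topology of \<open>av\<close>.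
\<close>

abbreviation field_rec :: "'c::field ring"
  where "field_rec \<equiv> ring_of_type_algebra"

definition av_topology :: "('c::field \<Rightarrow> real) \<Rightarrow> 'c topology"
  where "av_topology av = Metric_space.mtopology UNIV (\<lambda>x y. av (x - y))"

definition av_has_sum :: "('c::field \<Rightarrow> real) \<Rightarrow> ('i \<Rightarrow> 'c) \<Rightarrow> 'c \<Rightarrow> bool"
  where "av_has_sum av f s \<longleftrightarrow> limitin (av_topology av) (sum f) s (finite_subsets_at_top UNIV)"

definition av_sum :: "('c::field \<Rightarrow> real) \<Rightarrow> ('i \<Rightarrow> 'c) \<Rightarrow> 'c"
  where "av_sum av f = (THE s. av_has_sum av f s)"

definition rat_closure :: "('c::field_char_0 \<Rightarrow> real) \<Rightarrow> 'c set"
  where "rat_closure av = av_topology av closure_of (range of_rat)"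

text \<open>
  These axioms determine the completed algebraic closure of the p-adic numbers up to isomorphism.
  The normalisation of \<open>av\<close> (the value of \<open>av (of_nat p)\<close>) is left open.
  \<open>rat_closure av\<close> is the copy of the p-adic numbers.
\<close>

locale padic_complex =
  fixes p :: nat and av :: "'c::{alg_closed_field, field_char_0} \<Rightarrow> real"
  assumes prime_p: "Factorial_Ring.prime p"
    and av_nonneg: "av x \<ge> 0"
    and av_eq_0_iff: "av x = 0 \<longleftrightarrow> x = 0"
    and av_mult: "av (x * y) = av x * av y"
    and av_add: "av (x + y) \<le> max (av x) (av y)"
    and av_p: "av (of_nat p) < 1"
    and complete: "Metric_space.mcomplete UNIV (\<lambda>x y. av (x - y))"
    and algebraic_dense:
      "av_topology av closure_of
         {x. \<exists>P. P \<noteq> 0 \<and> set (coeffs P) \<subseteq> rat_closure av \<and> poly P x = 0} = UNIV"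

definition int_ring :: "('c::field \<Rightarrow> real) \<Rightarrow> 'c set \<Rightarrow> 'c set"
  where "int_ring av L = {x \<in> L. av x \<le> 1}"

definition finite_extension :: "'c::field set \<Rightarrow> 'c set \<Rightarrow> bool"
  where "finite_extension K L \<longleftrightarrow>
    subfield K field_rec \<and> subfield L field_rec \<and> K \<subseteq> L \<and> ring.finite_dimension field_rec K L"

text \<open>
  Ramification index 1.  Separability of the residue extension is automatic, as residue fields of
  local fields are finite.
\<close>

definition unramified_extension :: "('c::field \<Rightarrow> real) \<Rightarrow> 'c set \<Rightarrow> 'c set \<Rightarrow> bool"
  where "unramified_extension av K L \<longleftrightarrow> finite_extension K L \<and> av ` L = av ` K"

definition completed_nr :: "('c::field \<Rightarrow> real) \<Rightarrow> 'c set \<Rightarrow> 'c set"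
  where "completed_nr av K = av_topology av closure_of \<Union>{L. unramified_extension av K L}"

definition residue_card :: "('c::field \<Rightarrow> real) \<Rightarrow> 'c set \<Rightarrow> nat"
  where "residue_card av K =
    card (int_ring av K // {(x, y). x \<in> int_ring av K \<and> y \<in> int_ring av K \<and> av (x - y) < 1})"

locale local_field_setting = padic_complex p av
  for p :: nat and av :: "'c::{alg_closed_field, field_char_0} \<Rightarrow> real" +
  fixes K :: "'c set" and \<pi> :: 'c and q :: nat
    and K2 :: "'c set" and \<sigma> :: "'c \<Rightarrow> 'c" and \<zeta> :: 'c
  assumes K_finite: "finite_extension (rat_closure av) K"
    and uniformizer: "\<pi> \<in> K" "\<pi> \<noteq> 0" "av \<pi> < 1" "\<And>x. x \<in> K \<Longrightarrow> av x < 1 \<Longrightarrow> av x \<le> av \<pi>"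
    and q_eq: "q = residue_card av K"
    and K2_unramified: "unramified_extension av K K2"
    and K2_quadratic: "ring.dimension field_rec 2 K K2"
    and sigma_closed: "\<And>x. x \<in> K2 \<Longrightarrow> \<sigma> x \<in> K2"
    and sigma_add: "\<And>x y. x \<in> K2 \<Longrightarrow> y \<in> K2 \<Longrightarrow> \<sigma> (x + y) = \<sigma> x + \<sigma> y"
    and sigma_mult: "\<And>x y. x \<in> K2 \<Longrightarrow> y \<in> K2 \<Longrightarrow> \<sigma> (x * y) = \<sigma> x * \<sigma> y"
    and sigma_fixes: "\<And>x. x \<in> K \<Longrightarrow> \<sigma> x = x"
    and sigma_nontrivial: "\<exists>x\<in>K2. \<sigma> x \<noteq> x"
    and zeta: "\<zeta> \<in> K2" "av \<zeta> = 1" "\<sigma> \<zeta> = - \<zeta>"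


section \<open>The Gross--Hopkins period map\<close>

definition gh_rep :: "nat \<Rightarrow> nat \<Rightarrow> nat \<Rightarrow> bool"
  where "gh_rep q k n \<longleftrightarrow>
    (\<exists>a :: nat \<Rightarrow> nat. (\<forall>i<k. a i \<le> a (Suc i)) \<and> n = (\<Sum>i\<le>k. q ^ (2 * a i + i)))"

text \<open>
  The exponents \<open>2 * a i + i\<close> are strictly increasing, so they are read off from the base-q
  digits of \<open>n\<close>, and \<open>k\<close> is determined by \<open>n\<close>.
\<close>

definition gh_c :: "'c::field \<Rightarrow> nat \<Rightarrow> nat \<Rightarrow> 'c"
  where "gh_c \<pi> q n =
    (if n = 0 then 1
     else if \<exists>k. odd k \<and> gh_rep q k n
       then inverse \<pi> ^ (((THE k. odd k \<and> gh_rep q k n) + 1) div 2)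
     else 0)"

definition gh_d :: "'c::field \<Rightarrow> nat \<Rightarrow> nat \<Rightarrow> 'c"
  where "gh_d \<pi> q n =
    (if \<exists>k. even k \<and> gh_rep q k n
       then inverse \<pi> ^ ((THE k. even k \<and> gh_rep q k n) div 2)
     else 0)"

text \<open>Homogeneous coordinates of the period map at a point of the open unit disc.\<close>

definition gh_period :: "('c::field \<Rightarrow> real) \<Rightarrow> 'c \<Rightarrow> nat \<Rightarrow> 'c \<Rightarrow> 'c ^ 2"
  where "gh_period av \<pi> q u =
    vector [av_sum av (\<lambda>n. gh_c \<pi> q n * u ^ n), av_sum av (\<lambda>n. gh_d \<pi> q n * u ^ n)]"

definition open_disc :: "('c::field \<Rightarrow> real) \<Rightarrow> 'c set"
  where "open_disc av = {u. av u < 1}"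


section \<open>The group G and its action on the deformation space\<close>

definition quat :: "'c::field \<Rightarrow> ('c \<Rightarrow> 'c) \<Rightarrow> 'c \<Rightarrow> 'c \<Rightarrow> 'c ^ 2 ^ 2"
  where "quat \<pi> \<sigma> \<alpha> \<beta> = vector [vector [\<alpha>, \<pi> * \<sigma> \<beta>], vector [\<beta>, \<sigma> \<alpha>]]"

definition quat_order :: "('c::field \<Rightarrow> real) \<Rightarrow> 'c set \<Rightarrow> 'c \<Rightarrow> ('c \<Rightarrow> 'c) \<Rightarrow> ('c ^ 2 ^ 2) set"
  where "quat_order av K2 \<pi> \<sigma> =
    {quat \<pi> \<sigma> \<alpha> \<beta> | \<alpha> \<beta>. \<alpha> \<in> int_ring av K2 \<and> \<beta> \<in> int_ring av K2}"

definition quat_units :: "('c::field \<Rightarrow> real) \<Rightarrow> 'c set \<Rightarrow> 'c \<Rightarrow> ('c \<Rightarrow> 'c) \<Rightarrow> ('c ^ 2 ^ 2) set"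
  where "quat_units av K2 \<pi> \<sigma> =
    {g \<in> quat_order av K2 \<pi> \<sigma>. \<exists>h\<in>quat_order av K2 \<pi> \<sigma>. g ** h = mat 1 \<and> h ** g = mat 1}"

text \<open>
  \<open>act\<close> is the action of G, the automorphism group of the formal module, on the generic fibre of
  its deformation space, in terms of the Gross--Hopkins coordinate.  Formal modules are not
  constructed; what is used of them is that each element of G acts by a substitution in the ring
  of power series over the ring of integers of the completed maximal unramified extension of
  \<open>K\<close>, that the period map is equivariant, and that the diagonal torus fixes the origin.

  The formula \<open>[\<alpha> * x0 + \<beta> * x1 : \<pi> * \<sigma> \<beta> * x0 + \<sigma> \<alpha> * x1]\<close> for the action on the projective
  line is multiplication of the row vector \<open>(x0, x1)\<close> by the matrix from the right.  Hence the
  composition law compatible with it is the one in \<open>act_mult\<close>; the opposite law would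
  contradict equivariance.  On the commutative diagonal torus the two laws agree.
\<close>

locale gross_hopkins_action = local_field_setting p av K \<pi> q K2 \<sigma> \<zeta>
  for p :: nat and av :: "'c::{alg_closed_field, field_char_0} \<Rightarrow> real"
    and K :: "'c set" and \<pi> :: 'c and q :: nat
    and K2 :: "'c set" and \<sigma> :: "'c \<Rightarrow> 'c" and \<zeta> :: 'c +
  fixes act :: "'c ^ 2 ^ 2 \<Rightarrow> 'c \<Rightarrow> 'c"
  assumes act_closed: "\<And>g u. g \<in> quat_units av K2 \<pi> \<sigma> \<Longrightarrow> u \<in> open_disc av \<Longrightarrow>
      act g u \<in> open_disc av"
    and act_one: "\<And>u. u \<in> open_disc av \<Longrightarrow> act (mat 1) u = u"
    and act_mult: "\<And>g h u. g \<in> quat_units av K2 \<pi> \<sigma> \<Longrightarrow> h \<in> quat_units av K2 \<pi> \<sigma> \<Longrightarrow>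
      u \<in> open_disc av \<Longrightarrow> act (g ** h) u = act h (act g u)"
    and act_series: "\<And>g. g \<in> quat_units av K2 \<pi> \<sigma> \<Longrightarrow>
      \<exists>s :: nat \<Rightarrow> 'c. range s \<subseteq> int_ring av (completed_nr av K) \<and> av (s 0) < 1 \<and>
        (\<forall>u\<in>open_disc av. av_has_sum av (\<lambda>n. s n * u ^ n) (act g u))"
    and period_equivariant: "\<And>g u. g \<in> quat_units av K2 \<pi> \<sigma> \<Longrightarrow> u \<in> open_disc av \<Longrightarrow>
      \<exists>c. c \<noteq> 0 \<and> gh_period av \<pi> q (act g u) = c *s (gh_period av \<pi> q u v* g)"
    and act_torus_zero: "\<And>\<alpha>. \<alpha> \<in> K2 \<Longrightarrow> av \<alpha> = 1 \<Longrightarrow> act (quat \<pi> \<sigma> \<alpha> 0) 0 = 0"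


section \<open>The power series of the torus action\<close>

text \<open>
  The coefficients are polynomials in \<open>E\<close>, so the identity takes place in \<open>'c[E][[u]]\<close>;
  \<open>[:0, 1:]\<close> is the variable \<open>E\<close>.
\<close>

definition torus_coeffs :: "'c::field \<Rightarrow> nat \<Rightarrow> (nat \<Rightarrow> 'c poly) \<Rightarrow> bool"
  where "torus_coeffs \<pi> q a \<longleftrightarrow>
    a 0 = 0 \<and>
    (let \<phi>0 = Abs_fps (\<lambda>n. [:gh_c \<pi> q n:]); \<phi>1 = Abs_fps (\<lambda>n. [:gh_d \<pi> q n:]); A = Abs_fps a
     in fps_const [:0, 1:] * \<phi>1 * (\<phi>0 oo A) = \<phi>0 * (\<phi>1 oo A))"

definition torus_b :: "nat \<Rightarrow> (nat \<Rightarrow> 'c::field poly) \<Rightarrow> nat \<Rightarrow> 'c poly"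
  where "torus_b q a k = a (1 + k * (q + 1))"

definition torus_Q :: "('c::field \<Rightarrow> real) \<Rightarrow> 'c set \<Rightarrow> 'c \<Rightarrow> nat \<Rightarrow> (nat \<Rightarrow> 'c poly) \<Rightarrow>
    (nat \<Rightarrow> 'c poly) \<Rightarrow> bool"
  where "torus_Q av K \<pi> q a Q \<longleftrightarrow>
    (\<forall>k. set (coeffs (Q k)) \<subseteq> int_ring av K \<and>
         torus_b q a k = Polynomial.smult (inverse \<pi> ^ k)
           ([:0, 1:] * pcompose (Q k) (Polynomial.monom 1 (q + 1))))"


section \<open>Rigid-analytic actions of the torus\<close>

definition torus_disc :: "('c::field \<Rightarrow> real) \<Rightarrow> ('c \<times> 'c) set"
  where "torus_disc av = {(a1, a2). av (a1 - 1) < 1 \<and> av a2 < 1}"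

definition torus_mult :: "'c::field \<Rightarrow> 'c \<times> 'c \<Rightarrow> 'c \<times> 'c \<Rightarrow> 'c \<times> 'c"
  where "torus_mult \<zeta> = (\<lambda>(a1, a2) (b1, b2). (a1 * b1 + \<zeta>\<^sup>2 * a2 * b2, a1 * b2 + a2 * b1))"

text \<open>
  The solution of \<open>\<alpha> = a1 + \<zeta> * a2\<close>, \<open>\<sigma> \<alpha> = a1 - \<zeta> * a2\<close>.  In residue characteristic 2 it need
  not lie in \<open>torus_disc\<close> even if \<open>\<alpha>\<close> is congruent to 1 modulo the uniformizer: for \<open>K\<close> the 2-adic
  numbers, \<open>\<alpha> = 2 + sqrt (-3)\<close> and \<open>\<zeta> = sqrt (-3)\<close> it is \<open>(2, 1)\<close>.
\<close>

definition torus_point :: "('c::field \<Rightarrow> 'c) \<Rightarrow> 'c \<Rightarrow> 'c \<Rightarrow> 'c \<times> 'c"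
  where "torus_point \<sigma> \<zeta> \<alpha> = ((\<alpha> + \<sigma> \<alpha>) / 2, (\<alpha> - \<sigma> \<alpha>) / (2 * \<zeta>))"

definition closed_disc :: "('c::field \<Rightarrow> real) \<Rightarrow> real \<Rightarrow> 'c set"
  where "closed_disc av \<rho> = {u. av u \<le> \<rho>}"

text \<open>
  The product of \<open>torus_disc av\<close> with the disc of radius \<open>\<rho>\<close> is the increasing union, over
  \<open>s < 1\<close>, of the closed polydiscs \<open>av (a1 - 1) \<le> s\<close>, \<open>av a2 \<le> s\<close>, \<open>av u \<le> \<rho>\<close>.  A
  rigid-analytic function on it over \<open>L\<close> is a power series in \<open>a1 - 1\<close>, \<open>a2\<close>, \<open>u\<close> with
  coefficients in \<open>L\<close> that lies in the Tate algebra of each of these polydiscs.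
\<close>

definition rigid_function :: "('c::field \<Rightarrow> real) \<Rightarrow> 'c set \<Rightarrow> real \<Rightarrow> ('c \<times> 'c \<Rightarrow> 'c \<Rightarrow> 'c) \<Rightarrow> bool"
  where "rigid_function av L \<rho> f \<longleftrightarrow>
    (\<exists>F :: nat \<times> nat \<times> nat \<Rightarrow> 'c. range F \<subseteq> L \<and>
      (\<forall>s \<epsilon>. 0 < s \<and> s < 1 \<and> \<epsilon> > 0 \<longrightarrow>
         finite {(i, j, n). av (F (i, j, n)) * s ^ (i + j) * \<rho> ^ n \<ge> \<epsilon>}) \<and>
      (\<forall>(a1, a2) \<in> torus_disc av. \<forall>u \<in> closed_disc av \<rho>.
         av_has_sum av (\<lambda>(i, j, n). F (i, j, n) * (a1 - 1) ^ i * a2 ^ j * u ^ n) (f (a1, a2) u)))"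

text \<open>
  A morphism to the closed disc of radius \<open>\<rho>\<close> is a rigid-analytic function bounded by \<open>\<rho>\<close>.
\<close>

definition rigid_torus_action ::
    "('c::field \<Rightarrow> real) \<Rightarrow> 'c set \<Rightarrow> real \<Rightarrow> 'c \<Rightarrow> ('c \<times> 'c \<Rightarrow> 'c \<Rightarrow> 'c) \<Rightarrow> bool"
  where "rigid_torus_action av L \<rho> \<zeta> f \<longleftrightarrow>
    rigid_function av L \<rho> f \<and>
    (\<forall>t \<in> torus_disc av. \<forall>u \<in> closed_disc av \<rho>. f t u \<in> closed_disc av \<rho>) \<and>
    (\<forall>u \<in> closed_disc av \<rho>. f (1, 0) u = u) \<and>
    (\<forall>s \<in> torus_disc av. \<forall>t \<in> torus_disc av. \<forall>u \<in> closed_disc av \<rho>.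
       f (torus_mult \<zeta> s t) u = f s (f t u))"

end

theory Submission
  imports Defs "HOL-Number_Theory.Cong" "HOL-Algebra.Sylow"
begin

text \<open>
  The series \<open>A(u) = \<Sum>n. a n * u ^ n\<close> is the unique solution without constant term of
  \<open>E \<phi>1(u) \<phi>0(A) = \<phi>0(u) \<phi>1(A)\<close>.  Write \<open>A = u (E + h)\<close>.  Comparing coefficients expresses
  \<open>h\<close> through the terms \<open>d m * c l * u ^ (m + l - 1) * (E (E + h) ^ l - (E + h) ^ m)\<close> with
  \<open>(m, l) \<noteq> (1, 0)\<close>.  In the Gauss norm with \<open>\<bar>u\<bar> = \<rho>\<close>, \<open>\<rho> ^ (q + 1) * t ^ (q - 1) = \<bar>\<pi>\<bar>\<close> and
  \<open>\<bar>E ^ (q + 1) - 1\<bar> \<le> t ^ q = r\<close>, these have norm at most \<open>t\<close> as soon as \<open>h\<close> has: the brackets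
  are at most \<open>t\<close>, the weights at most 1, except for \<open>(m, l) = (1, q + 1)\<close>, where the weight
  \<open>t ^ - (q - 1)\<close> is compensated by the congruence \<open>(E + h) ^ q = E ^ q + h ^ q\<close> modulo \<open>p\<close>.
  Hence \<open>\<bar>h\<bar> \<le> t\<close>, which bounds all coefficients of \<open>A\<close>.

  The argument works for every ultrametric seminorm on polynomials in \<open>E\<close>.  Evaluation at \<open>E\<close> with
  \<open>E ^ (q + 1) = x\<close> gives the estimates for \<open>Q n\<close>; the Gauss norm in \<open>E - 1\<close> gives the convergence
  of the action in the torus variables.  The group law and the agreement with the given action
  follow from the uniqueness of \<open>A\<close>.
\<close>

text \<open>The radius \<open>\<rho>\<close> is dictated by the one bad pair (m, l) = (1, q + 1):
  its weight is at most \<rho>^(q+1) / |\<pi>|, its bracket at most t^q, and \<rho>^(q+1) t^(q-1) =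
  |\<pi>| is exactly the balance that returns t. The remaining pairs are controlled because t is at
  least \<omega> = |\<pi>|^(1/(q+1)), that is r \<ge> |\<pi>|^(q/(q+1)), which forces \<rho>^(q+1)
  \<le> \<omega>^2. At degree n(q+1) of A/u the bound \<rho>^(-n(q+1)) = (t^(q-1) / |\<pi>|)^n
  splits into the denominator \<pi>^(-n) and the claimed bound for \<open>Q n\<close>; the first
  estimate is the case of the smallest r. Since t < 1, \<rho> exceeds \<omega> strictly, and this is
  what gives convergence on the closed disc of radius \<omega>. Two facts about the fields are
  hidden in the axioms and have to be derived from local compactness of K: q is a power of p, and
  conjugation preserves the absolute value. The given action is tied to the period map only
  pointwise and up to scalars, so it is compared with A at the points \<pi>^k, which accumulate at
  0.\<close>

no_notation vec_nth (infixl "$" 90)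

section \<open>Sums in a complete ultrametric field\<close>

context padic_complex
begin

lemma av_0 [simp]: "av 0 = 0"
  by (simp add: av_eq_0_iff)

lemma av_1 [simp]: "av 1 = 1"
proof -
  have "av 1 * av 1 = av 1 * 1" using av_mult[of 1 1] by simp
  moreover have "av 1 \<noteq> 0" by (simp add: av_eq_0_iff)
  ultimately show ?thesis by (simp only: mult_cancel_left) simp
qed

lemma av_minus [simp]: "av (- x) = av x"
proof -
  have "av (-1) * av (-1) = 1" using av_mult[of "-1" "-1"] by simp
  hence "av (-1) = 1" using av_nonneg[of "-1"]
    by (metis abs_of_nonneg power2_eq_square real_sqrt_abs real_sqrt_one)
  thus ?thesis using av_mult[of "-1" x] by simp
qed

lemma av_pos_iff: "av x > 0 \<longleftrightarrow> x \<noteq> 0"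
  using av_nonneg[of x] av_eq_0_iff[of x] by linarith

lemma av_diff_commute: "av (x - y) = av (y - x)"
  using av_minus[of "x - y"] by simp

lemma av_diff: "av (x - y) \<le> max (av x) (av y)"
  using av_add[of x "- y"] by simp

lemma av_triangle: "av (x - z) \<le> max (av (x - y)) (av (y - z))"
  using av_add[of "x - y" "y - z"] by simp

lemma av_power: "av (x ^ n) = av x ^ n"
  by (induction n) (simp_all add: av_mult)

lemma av_inverse: "av (inverse x) = inverse (av x)"
proof (cases "x = 0")
  case False
  hence "av x * av (inverse x) = 1" by (simp flip: av_mult)
  thus ?thesis by (metis inverse_unique)
qed simp

lemma av_divide: "av (x / y) = av x / av y"
  by (simp add: divide_inverse av_mult av_inverse)

lemma av_add_eq: "av y < av x \<Longrightarrow> av (x + y) = av x"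
  using av_add[of x y] av_diff[of "x + y" y] by auto

lemma av_sum_le:
  assumes "\<And>i. i \<in> A \<Longrightarrow> av (f i) \<le> c" "0 \<le> c"
  shows "av (sum f A) \<le> c"
  using assms
proof (induction A rule: infinite_finite_induct)
  case (insert x F)
  have "av (f x) \<le> c" using insert.prems by simp
  moreover have "av (sum f F) \<le> c" using insert.prems by (intro insert.IH) simp_all
  ultimately show ?case using insert(1,2) av_add[of "f x" "sum f F"] by simp
qed auto

lemma av_of_nat_le: "av (of_nat n) \<le> 1"
proof (induction n)
  case (Suc n)
  then show ?case using av_add[of 1 "of_nat n"] by simp
qed simp

lemma av_of_int_le: "av (of_int n) \<le> 1"
  by (cases n rule: int_cases2) (simp_all add: av_of_nat_le)

lemma Metric_space_av: "Metric_space UNIV (\<lambda>x y. av (x - y))"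
proof
  fix x y z
  show "av (x - z) \<le> av (x - y) + av (y - z)"
    using av_triangle[of x z y] av_nonneg[of "x - y"] av_nonneg[of "y - z"] by linarith
qed (simp_all add: av_nonneg av_eq_0_iff av_diff_commute)

lemma av_has_sum_iff:
  "av_has_sum av f s \<longleftrightarrow>
    (\<forall>\<epsilon>>0. \<exists>F. finite F \<and> (\<forall>G. finite G \<and> F \<subseteq> G \<longrightarrow> av (sum f G - s) < \<epsilon>))"
  unfolding av_has_sum_def av_topology_def
  by (simp add: Metric_space.limitin_metric[OF Metric_space_av] eventually_finite_subsets_at_top)

lemma av_has_sumD:
  assumes "av_has_sum av f s" "\<epsilon> > 0"
  obtains F where "finite F" "\<And>G. finite G \<Longrightarrow> F \<subseteq> G \<Longrightarrow> av (sum f G - s) < \<epsilon>"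
  by (meson assms av_has_sum_iff)

lemma av_has_sum_null:
  assumes "av_has_sum av f s" "\<epsilon> > 0"
  shows "finite {i. \<epsilon> \<le> av (f i)}"
proof -
  obtain F where F: "finite F" "\<And>G. finite G \<Longrightarrow> F \<subseteq> G \<Longrightarrow> av (sum f G - s) < \<epsilon>"
    using assms by (rule av_has_sumD) blast
  have "av (f i) < \<epsilon>" if "i \<notin> F" for i
  proof -
    have "av (sum f (insert i F) - s) < \<epsilon>" "av (sum f F - s) < \<epsilon>"
      using F by (auto simp: subset_insertI)
    moreover have "f i = (sum f (insert i F) - s) - (sum f F - s)"
      using that F(1) by simp
    ultimately show ?thesis
      using av_diff[of "sum f (insert i F) - s" "sum f F - s"] by (metis le_less_trans max_less_iff_conj)
  qed
  hence "{i. \<epsilon> \<le> av (f i)} \<subseteq> F" by force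
  thus ?thesis using F(1) finite_subset by blast
qed

text \<open>The ultrametric inequality bounds every finite piece of the tail by its largest term.
  With the finite set of terms of size at least \<epsilon> as S, this is how most limits below are
  controlled.\<close>

lemma av_has_sum_tail:
  assumes "av_has_sum av f s" "finite S" "\<And>i. i \<notin> S \<Longrightarrow> av (f i) \<le> \<epsilon>" "0 \<le> \<epsilon>"
  shows "av (s - sum f S) \<le> \<epsilon>"
proof (rule field_le_epsilon)
  fix e :: real assume e: "e > 0"
  obtain F where F: "finite F" "\<And>G. finite G \<Longrightarrow> F \<subseteq> G \<Longrightarrow> av (sum f G - s) < e"
    using assms(1) e by (rule av_has_sumD) blast
  have "av (sum f (F \<union> S) - s) < e" using F assms(2) by auto
  hence 1: "av (s - sum f (F \<union> S)) < e" by (simp add: av_diff_commute)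
  have "sum f (F \<union> S) - sum f S = sum f (F \<union> S - S)"
    using F(1) assms(2) by (subst sum_diff) auto
  moreover have "av (sum f (F \<union> S - S)) \<le> \<epsilon>" using assms(3,4) by (intro av_sum_le) auto
  ultimately have "av (s - sum f S) \<le> max e \<epsilon>"
    using av_triangle[of s "sum f S" "sum f (F \<union> S)"] 1 by simp
  thus "av (s - sum f S) \<le> \<epsilon> + e" using e assms(4) by linarith
qed

lemma av_has_sum_bound:
  assumes "av_has_sum av f s" "\<And>i. av (f i) \<le> c" "0 \<le> c"
  shows "av s \<le> c"
  using av_has_sum_tail[OF assms(1), of "{}" c] assms(2,3) by simp

lemma av_has_sum_unique:
  assumes "av_has_sum av f s" "av_has_sum av f t"
  shows "s = t"
proof -
  have "av (s - t) \<le> 0"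
  proof (rule field_le_epsilon)
    fix e :: real assume e: "e > 0"
    let ?S = "{i. e \<le> av (f i)}"
    have "finite ?S" using assms(1) e by (rule av_has_sum_null)
    then have "av (s - sum f ?S) \<le> e" "av (t - sum f ?S) \<le> e"
      using e by (auto intro!: av_has_sum_tail assms)
    then show "av (s - t) \<le> 0 + e"
      using av_triangle[of s t "sum f ?S"] by (simp add: av_diff_commute)
  qed
  thus ?thesis using av_nonneg[of "s - t"] by (simp add: av_eq_0_iff)
qed

lemma av_sum_eq: "av_has_sum av f s \<Longrightarrow> av_sum av f = s"
  unfolding av_sum_def by (rule the_equality) (auto intro: av_has_sum_unique)

text \<open>Converse of the tail estimate: one finite set per \<epsilon> suffices, since small terms
  outside it cannot accumulate.\<close>

lemma av_has_sumI:
  assumes "\<And>\<epsilon>. \<epsilon> > 0 \<Longrightarrow> \<exists>S. finite S \<and> (\<forall>i. i \<notin> S \<longrightarrow> av (f i) \<le> \<epsilon>) \<and> av (s - sum f S) \<le> \<epsilon>"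
  shows "av_has_sum av f s"
  unfolding av_has_sum_iff
proof (intro allI impI)
  fix \<epsilon> :: real assume "\<epsilon> > 0"
  then obtain S where S: "finite S" "\<forall>i. i \<notin> S \<longrightarrow> av (f i) \<le> \<epsilon>/2" "av (s - sum f S) \<le> \<epsilon>/2"
    using assms[of "\<epsilon>/2"] by auto
  have "av (sum f G - s) < \<epsilon>" if G: "finite G" "S \<subseteq> G" for G
  proof -
    have "sum f G - sum f S = sum f (G - S)" using G by (simp add: sum_diff)
    moreover have "av (sum f (G - S)) \<le> \<epsilon>/2" using S(2) \<open>\<epsilon> > 0\<close> by (intro av_sum_le) auto
    ultimately show ?thesis
      using av_triangle[of "sum f G" s "sum f S"] S(3) \<open>\<epsilon> > 0\<close> by (simp add: av_diff_commute)
  qed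
  thus "\<exists>F. finite F \<and> (\<forall>G. finite G \<and> F \<subseteq> G \<longrightarrow> av (sum f G - s) < \<epsilon>)"
    using S(1) by blast
qed

lemma av_Cauchy_convergent:
  fixes x :: "nat \<Rightarrow> 'c"
  assumes "\<And>\<epsilon>. \<epsilon> > 0 \<Longrightarrow> \<exists>N. \<forall>m\<ge>N. \<forall>n\<ge>N. av (x m - x n) < \<epsilon>"
  obtains l where "\<forall>\<epsilon>>0. \<exists>N. \<forall>n\<ge>N. av (x n - l) < \<epsilon>"
proof -
  interpret Metric_space UNIV "\<lambda>x y. av (x - y)" by (rule Metric_space_av)
  have "MCauchy x" unfolding MCauchy_def using assms by simp
  then obtain l where "limitin mtopology x l sequentially"
    using complete unfolding mcomplete_def by blast
  thus ?thesis using that by (auto simp: limit_metric_sequentially)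
qed

text \<open>In a complete ultrametric field, terms tending to zero already give summability: the
  sums over the finite sets of terms of size at least 1/(n+1) form a Cauchy sequence.\<close>

lemma av_null_has_sum:
  assumes "\<And>\<epsilon>. \<epsilon> > 0 \<Longrightarrow> finite {i. \<epsilon> \<le> av (f i)}"
  obtains s where "av_has_sum av f s"
proof -
  define S where "S n = {i. 1 / real (Suc n) \<le> av (f i)}" for n
  have fin: "finite (S n)" for n unfolding S_def by (rule assms) simp
  have mono: "S m \<subseteq> S n" if "m \<le> n" for m n
  proof -
    have "1 / real (Suc n) \<le> 1 / real (Suc m)" using that by (simp add: field_simps)
    thus ?thesis unfolding S_def using order_trans by blast
  qed
  have diff: "av (sum f (S n) - sum f (S m)) \<le> 1 / real (Suc m)" if "m \<le> n" for m n
  proof -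
    have "sum f (S n) - sum f (S m) = sum f (S n - S m)" using mono[OF that] fin by (simp add: sum_diff)
    also have "av \<dots> \<le> 1 / real (Suc m)" by (intro av_sum_le) (auto simp: S_def)
    finally show ?thesis .
  qed
  have C: "\<exists>N. \<forall>m\<ge>N. \<forall>n\<ge>N. av (sum f (S m) - sum f (S n)) < \<epsilon>" if e: "\<epsilon> > 0" for \<epsilon>
  proof -
    obtain N where N: "1 / real (Suc N) < \<epsilon>" using reals_Archimedean[OF e] by (auto simp: inverse_eq_divide)
    have "av (sum f (S m) - sum f (S n)) < \<epsilon>" if "m \<ge> N" "n \<ge> N" for m n
    proof -
      have "av (sum f (S m) - sum f (S N)) \<le> 1 / real (Suc N)" "av (sum f (S n) - sum f (S N)) \<le> 1 / real (Suc N)"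
        using that diff by blast+
      thus ?thesis using av_triangle[of "sum f (S m)" "sum f (S n)" "sum f (S N)"] N
        by (simp add: av_diff_commute)
    qed
    thus ?thesis by blast
  qed
  then obtain s where s: "\<forall>\<epsilon>>0. \<exists>N. \<forall>n\<ge>N. av (sum f (S n) - s) < \<epsilon>"
    by (rule av_Cauchy_convergent)
  have "av_has_sum av f s"
  proof (rule av_has_sumI)
    fix \<epsilon> :: real assume e: "\<epsilon> > 0"
    obtain N where N: "1 / real (Suc N) < \<epsilon>" using reals_Archimedean[OF e] by (auto simp: inverse_eq_divide)
    obtain M where M: "\<forall>n\<ge>M. av (sum f (S n) - s) < \<epsilon>" using s e by blast
    let ?n = "max M N"
    have "1 / real (Suc ?n) \<le> 1 / real (Suc N)" by (simp add: field_simps)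
    hence "av (f i) \<le> \<epsilon>" if "i \<notin> S ?n" for i using that N unfolding S_def by auto
    moreover have "av (s - sum f (S ?n)) \<le> \<epsilon>" using M by (simp add: av_diff_commute less_imp_le)
    ultimately show "\<exists>S. finite S \<and> (\<forall>i. i \<notin> S \<longrightarrow> av (f i) \<le> \<epsilon>) \<and> av (s - sum f S) \<le> \<epsilon>"
      using fin by blast
  qed
  thus ?thesis using that by blast
qed

lemma av_has_sum_cmult:
  assumes "av_has_sum av f s"
  shows "av_has_sum av (\<lambda>i. c * f i) (c * s)"
proof (cases "c = 0")
  case True
  thus ?thesis by (auto simp: av_has_sum_iff)
next
  case False
  show ?thesis
  proof (rule av_has_sumI)
    fix \<epsilon> :: real assume "\<epsilon> > 0"
    define \<delta> where "\<delta> = \<epsilon> / av c"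
    have d: "\<delta> > 0" "\<epsilon> = av c * \<delta>" using False \<open>\<epsilon> > 0\<close> by (auto simp: \<delta>_def av_pos_iff av_eq_0_iff)
    let ?S = "{i. \<delta> \<le> av (f i)}"
    have fin: "finite ?S" using assms d(1) by (rule av_has_sum_null)
    have "av (s - sum f ?S) \<le> \<delta>" using d(1) by (intro av_has_sum_tail[OF assms fin]) auto
    hence "av (c * s - (\<Sum>i\<in>?S. c * f i)) \<le> \<epsilon>" unfolding d(2)
      by (simp add: av_nonneg mult_left_mono av_mult flip: sum_distrib_left right_diff_distrib)
    moreover have "av (c * f i) \<le> \<epsilon>" if "i \<notin> ?S" for i
      using that unfolding d(2) by (auto simp: av_mult av_nonneg intro!: mult_left_mono)
    ultimately show "\<exists>S. finite S \<and> (\<forall>i. i \<notin> S \<longrightarrow> av (c * f i) \<le> \<epsilon>) \<and> av (c * s - (\<Sum>i\<in>S. c * f i)) \<le> \<epsilon>"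
      using fin by blast
  qed
qed

lemma av_has_sum_add:
  assumes "av_has_sum av f s" "av_has_sum av g t"
  shows "av_has_sum av (\<lambda>i. f i + g i) (s + t)"
proof (rule av_has_sumI)
  fix \<epsilon> :: real assume e: "\<epsilon> > 0"
  let ?S = "{i. \<epsilon> \<le> av (f i)} \<union> {i. \<epsilon> \<le> av (g i)}"
  have fin: "finite ?S" using av_has_sum_null assms e by blast
  have "av (s - sum f ?S) \<le> \<epsilon>" "av (t - sum g ?S) \<le> \<epsilon>"
    using e by (auto intro!: av_has_sum_tail assms fin)
  hence "av (s + t - (\<Sum>i\<in>?S. f i + g i)) \<le> \<epsilon>"
    using av_add[of "s - sum f ?S" "t - sum g ?S"] by (simp add: sum.distrib algebra_simps)
  moreover have "av (f i + g i) \<le> \<epsilon>" if "i \<notin> ?S" for i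
    using that av_add[of "f i" "g i"] by auto
  ultimately show "\<exists>S. finite S \<and> (\<forall>i. i \<notin> S \<longrightarrow> av (f i + g i) \<le> \<epsilon>) \<and> av (s + t - (\<Sum>i\<in>S. f i + g i)) \<le> \<epsilon>"
    using fin by blast
qed

lemma av_has_sum_zero: "av_has_sum av (\<lambda>_. 0) 0"
  by (auto simp: av_has_sum_iff)

lemma av_has_sum_sum:
  assumes "\<And>k. k \<in> A \<Longrightarrow> av_has_sum av (f k) (s k)"
  shows "av_has_sum av (\<lambda>i. \<Sum>k\<in>A. f k i) (\<Sum>k\<in>A. s k)"
  using assms
  by (induction A rule: infinite_finite_induct) (auto intro: av_has_sum_add av_has_sum_zero)

lemma av_has_sum_finite:
  assumes "finite S" "\<And>i. i \<notin> S \<Longrightarrow> f i = 0"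
  shows "av_has_sum av f (sum f S)"
  by (rule av_has_sumI, rule exI[of _ S]) (use assms in auto)

text \<open>Reindexing and Fubini are special cases.\<close>

lemma av_has_sum_fibres:
  fixes h :: "'i \<Rightarrow> 'j"
  assumes f: "av_has_sum av f s"
    and g: "\<And>j. av_has_sum av (\<lambda>i. if h i = j then f i else 0) (g j)"
  shows "av_has_sum av g s"
proof (rule av_has_sumI)
  fix \<epsilon> :: real assume e: "\<epsilon> > 0"
  let ?S = "{i. \<epsilon> \<le> av (f i)}"
  have fin: "finite ?S" using f e by (rule av_has_sum_null)
  \<comment> \<open>The same finite set works for every fibre, and the errors of several fibres do
    not add up.\<close>
  have fib: "av (g j - (\<Sum>i\<in>?S. if h i = j then f i else 0)) \<le> \<epsilon>" for j
    using e by (intro av_has_sum_tail[OF g fin]) auto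
  have "sum f ?S = (\<Sum>j\<in>h ` ?S. \<Sum>i\<in>{i\<in>?S. h i = j}. f i)"
    using fin by (rule sum.image_gen)
  also have "\<dots> = (\<Sum>j\<in>h ` ?S. \<Sum>i\<in>?S. if h i = j then f i else 0)"
    using fin by (intro sum.cong refl sum.mono_neutral_cong_left) auto
  finally have "sum g (h ` ?S) - sum f ?S = (\<Sum>j\<in>h ` ?S. g j - (\<Sum>i\<in>?S. if h i = j then f i else 0))"
    by (simp add: sum_subtractf)
  hence "av (sum g (h ` ?S) - sum f ?S) \<le> \<epsilon>"
    using av_sum_le[of "h ` ?S" "\<lambda>j. g j - (\<Sum>i\<in>?S. if h i = j then f i else 0)" \<epsilon>] fib e by simp
  moreover have "av (s - sum f ?S) \<le> \<epsilon>" using e by (intro av_has_sum_tail[OF f fin]) auto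
  ultimately have "av (s - sum g (h ` ?S)) \<le> \<epsilon>"
    using av_triangle[of s "sum g (h ` ?S)" "sum f ?S"] by (simp add: av_diff_commute)
  moreover have "av (g j) \<le> \<epsilon>" if "j \<notin> h ` ?S" for j
  proof -
    have "(\<Sum>i\<in>?S. if h i = j then f i else 0) = 0" using that by (intro sum.neutral) auto
    thus ?thesis using fib[of j] by simp
  qed
  ultimately show "\<exists>S. finite S \<and> (\<forall>j. j \<notin> S \<longrightarrow> av (g j) \<le> \<epsilon>) \<and> av (s - sum g S) \<le> \<epsilon>"
    using fin by blast
qed

lemma av_has_sum_finite_fibres:
  fixes h :: "'i \<Rightarrow> 'j"
  assumes "av_has_sum av f s" "\<And>j. finite {i. h i = j}"
  shows "av_has_sum av (\<lambda>j. \<Sum>i | h i = j. f i) s"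
proof (rule av_has_sum_fibres[OF assms(1)])
  fix j
  have "av_has_sum av (\<lambda>i. if h i = j then f i else 0) (\<Sum>i | h i = j. if h i = j then f i else 0)"
    using assms(2) by (rule av_has_sum_finite) auto
  thus "av_has_sum av (\<lambda>i. if h i = j then f i else 0) (\<Sum>i | h i = j. f i)" by simp
qed

text \<open>Nullity of the double family gives the unordered sum; grouping it by rows yields the sum
  of the row sums.\<close>

lemma av_has_sum_iterated:
  fixes f :: "'i \<Rightarrow> 'j \<Rightarrow> 'c"
  assumes null: "\<And>\<epsilon>. \<epsilon> > 0 \<Longrightarrow> finite {(i, j). \<epsilon> \<le> av (f i j)}"
    and inner: "\<And>i. av_has_sum av (f i) (g i)"
  obtains s where "av_has_sum av (\<lambda>(i, j). f i j) s" "av_has_sum av g s"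
proof -
  obtain s where s: "av_has_sum av (\<lambda>(i, j). f i j) s"
    using av_null_has_sum[of "\<lambda>(i, j). f i j"] null by (auto simp: case_prod_unfold)
  have "av_has_sum av g s"
  proof (rule av_has_sum_fibres[OF s, of fst])
    fix i :: 'i
    \<comment> \<open>A pair lies over at most one j, so viewing row i as a family on all pairs,
      zero off the row, is a reindexing with finite fibres.\<close>
    have fib: "{j. (i, j) = p} = (if fst p = i then {snd p} else {})" for p :: "'i \<times> 'j"
      by (cases p) auto
    have "av_has_sum av (\<lambda>p. \<Sum>j | (i, j) = p. f i j) (g i)"
      by (rule av_has_sum_finite_fibres[OF inner]) (simp add: fib)
    also have "(\<lambda>p. \<Sum>j | (i, j) = p. f i j) =
        (\<lambda>p. if fst p = i then (case p of (i, j) \<Rightarrow> f i j) else 0)"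
    proof
      fix p :: "'i \<times> 'j"
      show "(\<Sum>j | (i, j) = p. f i j) = (if fst p = i then (case p of (i, j) \<Rightarrow> f i j) else 0)"
        unfolding fib by (cases p) simp
    qed
    finally show "av_has_sum av (\<lambda>p. if fst p = i then (case p of (i, j) \<Rightarrow> f i j) else 0) (g i)" .
  qed
  thus ?thesis using s that by blast
qed

lemma av_has_sum_mult:
  fixes f :: "'i \<Rightarrow> 'c" and g :: "'j \<Rightarrow> 'c"
  assumes f: "av_has_sum av f s" and g: "av_has_sum av g t"
  shows "av_has_sum av (\<lambda>(i, j). f i * g j) (s * t)"
proof -
  \<comment> \<open>Only finitely many terms are at least 1. Boundedness of both factors makes the
    family of products null.\<close>
  have bounded: "\<exists>M>0. \<forall>i. av (h i) \<le> M" if "av_has_sum av h r" for h :: "'k \<Rightarrow> 'c" and r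
  proof -
    have fin: "finite {i. 1 \<le> av (h i)}" using av_has_sum_null[OF that, of 1] by simp
    let ?M = "Max (insert 1 ((\<lambda>i. av (h i)) ` {i. 1 \<le> av (h i)}))"
    have "av (h i) \<le> ?M" for i
    proof (cases "1 \<le> av (h i)")
      case True
      then show ?thesis using fin by (intro Max_ge) auto
    next
      case False
      have "1 \<le> ?M" using fin by (intro Max_ge) auto
      then show ?thesis using False by linarith
    qed
    moreover have "0 < ?M" using fin by (intro less_le_trans[OF zero_less_one Max_ge]) auto
    ultimately show ?thesis by blast
  qed
  obtain M where M: "M > 0" "\<And>i. av (f i) \<le> M" using bounded[OF f] by blast
  obtain N where N: "N > 0" "\<And>i. av (g i) \<le> N" using bounded[OF g] by blast
  have null: "finite {(i, j). \<epsilon> \<le> av (f i * g j)}" if "\<epsilon> > 0" for \<epsilon>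
  proof (rule finite_subset)
    show "{(i, j). \<epsilon> \<le> av (f i * g j)} \<subseteq> {i. \<epsilon> / N \<le> av (f i)} \<times> {j. \<epsilon> / M \<le> av (g j)}"
    proof clarify
      fix i j assume A: "\<epsilon> \<le> av (f i * g j)"
      have "av (f i * g j) \<le> av (f i) * N" "av (f i * g j) \<le> M * av (g j)"
        using M N by (auto simp: av_mult av_nonneg mult_left_mono mult_right_mono)
      thus "i \<in> {i. \<epsilon> / N \<le> av (f i)} \<and> j \<in> {j. \<epsilon> / M \<le> av (g j)}"
        using A M(1) N(1) by (simp add: field_simps)
    qed
    show "finite ({i. \<epsilon> / N \<le> av (f i)} \<times> {j. \<epsilon> / M \<le> av (g j)})"
      using that M N by (intro finite_cartesian_product av_has_sum_null[OF f] av_has_sum_null[OF g]) auto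
  qed
  obtain r where r: "av_has_sum av (\<lambda>(i, j). f i * g j) r" "av_has_sum av (\<lambda>i. f i * t) r"
    using av_has_sum_iterated[of "\<lambda>i j. f i * g j" "\<lambda>i. f i * t", OF null av_has_sum_cmult[OF g]] by blast
  have "av_has_sum av (\<lambda>i. t * f i) (t * s)" using f by (rule av_has_sum_cmult)
  hence "r = s * t" using r(2) av_has_sum_unique by (simp add: mult.commute)
  thus ?thesis using r(1) by simp
qed

end

section \<open>Finite-dimensional spaces over closed subfields\<close>

lemma subfield_field_rec:
  assumes "subfield K (field_rec :: 'c::field ring)"
  shows subfield_0: "0 \<in> K" and subfield_1: "1 \<in> K"
    and subfield_add: "\<And>x y. x \<in> K \<Longrightarrow> y \<in> K \<Longrightarrow> x + y \<in> K"
    and subfield_mult: "\<And>x y. x \<in> K \<Longrightarrow> y \<in> K \<Longrightarrow> x * y \<in> K"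
    and subfield_minus: "\<And>x. x \<in> K \<Longrightarrow> - x \<in> K"
    and subfield_diff: "\<And>x y. x \<in> K \<Longrightarrow> y \<in> K \<Longrightarrow> x - y \<in> K"
    and subfield_inverse: "\<And>x. x \<in> K \<Longrightarrow> inverse x \<in> K"
    and subfield_power: "\<And>x n. x \<in> K \<Longrightarrow> x ^ n \<in> K"
    and subfield_of_nat: "\<And>n. of_nat n \<in> K"
    and subfield_sum: "\<And>A f. (\<And>i. i \<in> A \<Longrightarrow> f i \<in> K) \<Longrightarrow> sum f A \<in> K"
proof -
  interpret R: field "field_rec :: 'c ring" by (rule field_from_type_algebra)
  note defs = ring_of_type_algebra_def[where 'a = 'c]
  note props = subringE[OF subfieldE(1)[OF assms]]
  show 0: "0 \<in> K" and 1: "1 \<in> K" using props(2,3) by (simp_all add: defs)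
  show add: "x + y \<in> K" if "x \<in> K" "y \<in> K" for x y
    using props(7)[OF that] by (simp add: defs)
  show mult: "x * y \<in> K" if "x \<in> K" "y \<in> K" for x y
    using props(6)[OF that] by (simp add: defs)
  show minus: "- x \<in> K" if "x \<in> K" for x
  proof -
    have "a_inv field_rec x = - x"
      by (rule R.minus_equality) (simp_all add: defs)
    thus ?thesis using props(5)[OF that] by simp
  qed
  show "x - y \<in> K" if "x \<in> K" "y \<in> K" for x y
    using add[OF that(1) minus[OF that(2)]] by simp
  show inverse: "inverse x \<in> K" if "x \<in> K" for x
  proof (cases "x = 0")
    case False
    have "x \<in> K - {\<zero>\<^bsub>field_rec\<^esub>}" using that False by (simp add: defs)
    from R.subfield_m_inv[OF assms this]
    have "m_inv field_rec x \<in> K" "x * m_inv field_rec x = 1" by (simp_all add: defs)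
    thus ?thesis by (metis inverse_unique)
  qed (use 0 in simp)
  show "x ^ n \<in> K" if "x \<in> K" for x n
    by (induction n) (auto intro: 1 mult that)
  show "of_nat n \<in> K" for n
    by (induction n) (auto intro: 0 1 add)
  show "sum f A \<in> K" if "\<And>i. i \<in> A \<Longrightarrow> f i \<in> K" for A and f :: "'z \<Rightarrow> 'c"
    using that by (induction A rule: infinite_finite_induct) (auto intro: 0 add)
qed

text \<open>Taking n-th roots removes the constant: if y < x, the powers of x / y outgrow M.\<close>

lemma power_dominated_imp_le:
  fixes x y M :: real
  assumes "0 \<le> x" "0 \<le> y" "\<And>n. x ^ n \<le> M * y ^ n"
  shows "x \<le> y"
proof (rule ccontr)
  assume "\<not> x \<le> y"
  hence xy: "y < x" by simp
  show False
  proof (cases "y = 0")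
    case True
    then show ?thesis using assms(3)[of 1] xy by simp
  next
    case False
    hence y: "y > 0" using assms(2) by simp
    obtain n where "M < (x / y) ^ n" using real_arch_pow[of "x / y" M] xy y by auto
    hence "M * y ^ n < x ^ n" using y by (simp add: power_divide field_simps)
    thus ?thesis using assms(3)[of n] by simp
  qed
qed

context padic_complex
begin

definition av_closed :: "'c set \<Rightarrow> bool"
  where "av_closed V \<longleftrightarrow> (\<forall>x. (\<forall>\<epsilon>>0. \<exists>v\<in>V. av (x - v) < \<epsilon>) \<longrightarrow> x \<in> V)"

text \<open>The form of local compactness that yields a finite residue field. The approximating
  points need not lie in V, so nets for several coordinates combine freely.\<close>

definition boundedly_precompact :: "'c set \<Rightarrow> bool"
  where "boundedly_precompact V \<longleftrightarrow>
    (\<forall>R. \<forall>\<epsilon>>0. \<exists>S. finite S \<and> (\<forall>v\<in>V. av v \<le> R \<longrightarrow> (\<exists>s\<in>S. av (v - s) < \<epsilon>)))"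

lemma av_closure_iff: "x \<in> av_topology av closure_of S \<longleftrightarrow> (\<forall>\<epsilon>>0. \<exists>y\<in>S. av (x - y) < \<epsilon>)"
  unfolding av_topology_def
  by (auto simp: Metric_space.metric_closure_of[OF Metric_space_av] Metric_space.in_mball[OF Metric_space_av])

lemma av_less_triangle: "av (x - y) < \<epsilon> \<Longrightarrow> av (y - z) < \<epsilon> \<Longrightarrow> av (x - z) < \<epsilon>"
  by (rule le_less_trans[OF av_triangle[of x z y]]) simp

lemma av_closed_rat_closure: "av_closed (rat_closure av)"
  unfolding av_closed_def
proof (intro allI impI)
  fix x assume x: "\<forall>\<epsilon>>0. \<exists>v\<in>rat_closure av. av (x - v) < \<epsilon>"
  have "\<exists>y\<in>range of_rat. av (x - y) < \<epsilon>" if e: "\<epsilon> > 0" for \<epsilon>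
  proof -
    obtain v where v: "v \<in> rat_closure av" "av (x - v) < \<epsilon>" using x e by blast
    then obtain y where "y \<in> range of_rat" "av (v - y) < \<epsilon>"
      using e unfolding rat_closure_def av_closure_iff by blast
    thus ?thesis using v(2) av_less_triangle by blast
  qed
  thus "x \<in> rat_closure av" unfolding rat_closure_def av_closure_iff by blast
qed

lemma av_p_pos: "av (of_nat p) > 0"
  using prime_p by (auto simp: av_pos_iff)

text \<open>In a Bezout relation n u + p v = 1 the second summand has absolute value below 1, so the
  first one must reach 1.\<close>

lemma av_of_int_coprime:
  assumes "coprime n (int p)"
  shows "av (of_int n) = 1"
proof -
  obtain u v where "n * u + int p * v = 1"
    using assms by (metis bezout_int coprime_imp_gcd_eq_1 mult.commute)
  hence "of_int n * of_int u + of_nat p * of_int v = (1 :: 'c)"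
    by (metis of_int_1 of_int_add of_int_mult of_int_of_nat_eq)
  hence "1 \<le> max (av (of_int n * of_int u)) (av (of_nat p * of_int v))"
    using av_add by (metis av_1)
  moreover have "av (of_nat p * of_int v) < 1"
    using av_p av_of_int_le[of v] av_nonneg[of "of_int v"] av_p_pos
    by (simp add: av_mult) (meson le_less_trans less_imp_le mult_left_le)
  moreover have "av (of_int n * of_int u) \<le> av (of_int n)"
    using av_of_int_le[of u] by (simp add: av_mult av_nonneg mult_left_le)
  ultimately show ?thesis using av_of_int_le[of n] by simp
qed

text \<open>Density of the integers in the p-adic integers: the reduced denominator b is prime to p,
  so a / b is close to a u, where u inverts b modulo p^N.\<close>

lemma of_rat_approx_nat:
  assumes "av (of_rat y) \<le> 1"
  obtains i where "i < p ^ N" "av (of_rat y - of_nat i) \<le> av (of_nat p) ^ N"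
proof -
  obtain a b where ab: "quotient_of y = (a, b)" by force
  hence b: "b > 0" "coprime a b" "y = of_int a / of_int b"
    by (auto intro: quotient_of_denom_pos quotient_of_coprime quotient_of_div)
  have y: "of_rat y = (of_int a / of_int b :: 'c)" using b by (simp add: of_rat_divide)
  have "\<not> int p dvd b"
  proof
    assume pb: "int p dvd b"
    hence "coprime a (int p)" using b(2) by (meson coprime_divisors dvd_refl)
    hence "av (of_int a) = 1" by (rule av_of_int_coprime)
    moreover have "av (of_int b) < 1"
    proof -
      obtain c where c: "b = int p * c" using pb by blast
      have "av (of_int b) = av (of_nat p) * av (of_int c)" unfolding c by (simp add: av_mult)
      also have "\<dots> \<le> av (of_nat p)" using av_of_int_le[of c] av_p_pos by (simp add: mult_left_le)
      finally show ?thesis using av_p by simp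
    qed
    moreover have "av (of_int b) > 0" using b(1) by (simp add: av_pos_iff)
    ultimately show False using assms unfolding y av_divide by (simp add: field_simps)
  qed
  hence cop: "coprime b (int p)"
    using prime_p prime_imp_coprime[of "int p" b] by (simp add: coprime_commute)
  hence "coprime b (int p ^ N)" by simp
  then obtain u where u: "[b * u = 1] (mod (int p ^ N))" using cong_solve_coprime_int by blast
  define j where "j = (a * u) mod (int p ^ N)"
  have pN: "int p ^ N > 0" using prime_p by (simp add: prime_gt_0_nat)
  have "[b * j = b * (a * u)] (mod (int p ^ N))" unfolding j_def by (simp add: cong_def mod_mult_right_eq)
  also have "b * (a * u) = a * (b * u)" by simp
  also have "[a * (b * u) = a * 1] (mod (int p ^ N))" using u by (intro cong_mult cong_refl)
  finally have "int p ^ N dvd a - b * j" by (simp add: cong_iff_dvd_diff dvd_diff_commute)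
  then obtain c where c: "a - b * j = int p ^ N * c" by blast
  have "of_rat y - of_int j = (of_int (a - b * j) / of_int b :: 'c)"
    unfolding y using b(1) by (simp add: field_simps)
  hence "av (of_rat y - of_int j) = av (of_nat p) ^ N * av (of_int c)"
    unfolding c by (simp add: av_divide av_mult av_power av_of_int_coprime[OF cop])
  also have "\<dots> \<le> av (of_nat p) ^ N" using av_of_int_le[of c] av_p_pos by (simp add: mult_left_le)
  finally have "av (of_rat y - of_int j) \<le> av (of_nat p) ^ N" .
  moreover have "0 \<le> j" "j < int p ^ N" using pN by (auto simp: j_def)
  ultimately show ?thesis using that[of "nat j"]
    by (metis nat_less_iff of_int_of_nat_eq of_nat_power int_nat_eq)
qed

lemma boundedly_precompact_rat_closure: "boundedly_precompact (rat_closure av)"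
  unfolding boundedly_precompact_def
proof (intro allI impI)
  fix R \<epsilon> :: real assume e: "\<epsilon> > 0"
  have p1: "1 / av (of_nat p) > 1" using av_p av_p_pos by simp
  \<comment> \<open>Multiplication by p^m brings the ball of radius R into the unit ball, and N
    below is the precision left after undoing this scaling. The 1 in the maximum accounts for the
    rational approximation, taken within distance 1.\<close>
  obtain m where m: "max R 1 < (1 / av (of_nat p)) ^ m" using real_arch_pow[OF p1] by blast
  hence "max R 1 < 1 / av (of_nat p) ^ m" by (simp only: power_divide power_one)
  hence m: "max R 1 * av (of_nat p) ^ m < 1" using av_p_pos by (simp only: pos_less_divide_eq zero_less_power)
  have "\<epsilon> * av (of_nat p) ^ m > 0" using e av_p_pos by simp
  then obtain N where N: "av (of_nat p) ^ N < \<epsilon> * av (of_nat p) ^ m"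
    using real_arch_pow_inv[of _ "av (of_nat p)"] av_p by blast
  let ?S = "(\<lambda>i. of_nat i / of_nat p ^ m) ` {..<p ^ N}"
  have "\<exists>s\<in>?S. av (x - s) < \<epsilon>" if x: "x \<in> rat_closure av" "av x \<le> R" for x
  proof -
    obtain r where r: "av (x - of_rat r) < min \<epsilon> 1"
      using x(1) e unfolding rat_closure_def av_closure_iff by (metis imageE min_less_iff_conj zero_less_one)
    have "av (of_rat r) \<le> max R 1"
      using av_triangle[of "of_rat r" 0 x] r x(2) by (simp add: av_diff_commute) linarith
    hence "av (of_rat r) * av (of_nat p) ^ m \<le> max R 1 * av (of_nat p) ^ m"
      by (rule mult_right_mono) (simp add: av_nonneg)
    hence "av (of_rat (r * of_nat p ^ m)) \<le> 1"
      using m by (simp add: of_rat_mult of_rat_power av_mult av_power)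
    then obtain i where i: "i < p ^ N"
      "av (of_rat (r * of_nat p ^ m) - of_nat i) \<le> av (of_nat p) ^ N"
      by (rule of_rat_approx_nat)
    have pm: "of_nat p ^ m \<noteq> (0::'c)" using prime_p by auto
    have "of_rat r - of_nat i / of_nat p ^ m =
        (of_rat (r * of_nat p ^ m) - of_nat i) / (of_nat p ^ m :: 'c)"
      using pm by (simp add: of_rat_mult of_rat_power field_simps)
    hence "av (of_rat r - of_nat i / of_nat p ^ m) \<le> av (of_nat p) ^ N / av (of_nat p) ^ m"
      using i(2) av_p_pos by (simp add: av_divide av_power divide_right_mono)
    also have "\<dots> < \<epsilon>" using N av_p_pos by (simp add: field_simps)
    finally have "av (of_rat r - of_nat i / of_nat p ^ m) < \<epsilon>" .
    moreover have "av (x - of_rat r) < \<epsilon>" using r by simp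
    ultimately have "av (x - of_nat i / of_nat p ^ m) < \<epsilon>"
      by (rule av_less_triangle[rotated])
    thus ?thesis using i(1) by blast
  qed
  thus "\<exists>S. finite S \<and> (\<forall>v\<in>rat_closure av. av v \<le> R \<longrightarrow> (\<exists>s\<in>S. av (v - s) < \<epsilon>))"
    by (intro exI[of _ ?S]) auto
qed

text \<open>The properties are bundled for an induction on the dimension: closedness of one space
  yields all of them for the next. Linear maps take values in the whole field, so that the
  conjugation of K2 is among them.\<close>

definition tame_space :: "'c set \<Rightarrow> 'c set \<Rightarrow> bool"
  where "tame_space F V \<longleftrightarrow>
    0 \<in> V \<and> (\<forall>x\<in>V. \<forall>y\<in>V. x - y \<in> V) \<and> (\<forall>k\<in>F. \<forall>x\<in>V. k * x \<in> V) \<and>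
    av_closed V \<and> boundedly_precompact V \<and>
    (\<forall>\<phi>. (\<forall>x\<in>V. \<forall>y\<in>V. \<phi> (x + y) = \<phi> x + \<phi> y) \<and> (\<forall>k\<in>F. \<forall>x\<in>V. \<phi> (k * x) = k * \<phi> x) \<longrightarrow>
      (\<exists>M. \<forall>x\<in>V. av (\<phi> x) \<le> M * av x))"

text \<open>A vector v outside the closed space E has a distance \<delta> > 0 from E, hence |k|
  \<delta> \<le> |k v + w|. Both coordinates k and w are therefore bounded by a multiple of |k v +
  w|, and everything reduces to F and E.\<close>

lemma tame_space_line_extension:
  assumes F: "subfield F field_rec" "av_closed F" "boundedly_precompact F"
    and E: "tame_space F E" and v: "v \<notin> E"
  shows "tame_space F {k * v + w | k w. k \<in> F \<and> w \<in> E}"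
proof -
  let ?V = "{k * v + w | k w. k \<in> F \<and> w \<in> E}"
  note Fc = subfield_field_rec[OF F(1)]
  from E have E0: "0 \<in> E" and Ed: "\<And>x y. x \<in> E \<Longrightarrow> y \<in> E \<Longrightarrow> x - y \<in> E"
    and Es: "\<And>k x. k \<in> F \<Longrightarrow> x \<in> E \<Longrightarrow> k * x \<in> E"
    and Ecl: "av_closed E" and Ebc: "boundedly_precompact E"
    and Eb: "\<And>\<phi>. \<lbrakk>\<forall>x\<in>E. \<forall>y\<in>E. \<phi> (x + y) = \<phi> x + \<phi> y; \<forall>k\<in>F. \<forall>x\<in>E. \<phi> (k * x) = k * \<phi> x\<rbrakk>
      \<Longrightarrow> \<exists>M. \<forall>x\<in>E. av (\<phi> x) \<le> M * av x"
    unfolding tame_space_def by blast+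
  obtain \<delta> where d: "\<delta> > 0" "\<And>w. w \<in> E \<Longrightarrow> \<delta> \<le> av (v - w)"
    using Ecl v unfolding av_closed_def by (meson not_le)
  have k_le: "av k * \<delta> \<le> av (k * v + w)" if "k \<in> F" "w \<in> E" for k w
  proof (cases "k = 0")
    case False
    have "- inverse k * w \<in> E" using that Fc by (intro Es) auto
    hence "\<delta> \<le> av (v - (- inverse k * w))" by (rule d(2))
    hence "av k * \<delta> \<le> av (k * (v - (- inverse k * w)))"
      by (simp only: av_mult) (simp add: av_nonneg mult_left_mono)
    moreover have "k * (v - (- inverse k * w)) = k * v + w" using False by (simp add: field_simps)
    ultimately show ?thesis by (simp only:)
  qed (simp add: av_nonneg)
  \<comment> \<open>For w = (k v + w) - k v: the 1 covers the first term, |v| / \<delta> the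
    second.\<close>
  define C where "C = max 1 (av v / \<delta>)"
  have C: "C \<ge> 1" by (simp add: C_def)
  have w_le: "av w \<le> C * av (k * v + w)" if "k \<in> F" "w \<in> E" for k w
  proof -
    have "av k * av v \<le> (av (k * v + w) / \<delta>) * av v"
      using k_le[OF that] d(1) by (intro mult_right_mono) (auto simp: field_simps av_nonneg)
    also have "\<dots> = av v / \<delta> * av (k * v + w)" by simp
    also have "\<dots> \<le> C * av (k * v + w)" by (intro mult_right_mono) (auto simp: C_def av_nonneg)
    finally have "av (k * v) \<le> C * av (k * v + w)" by (simp add: av_mult)
    moreover have "av (k * v + w) \<le> C * av (k * v + w)"
      using mult_right_mono[OF C av_nonneg[of "k * v + w"]] by simp
    ultimately show ?thesis using av_diff[of "k * v + w" "k * v"] by simp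
  qed
  have "0 \<in> ?V" using Fc(1) E0 by force
  moreover have Vd: "x - y \<in> ?V" if xy: "x \<in> ?V" "y \<in> ?V" for x y
  proof -
    obtain k w l z where *: "k \<in> F" "w \<in> E" "x = k * v + w" "l \<in> F" "z \<in> E" "y = l * v + z"
      using xy by blast
    have "x - y = (k - l) * v + (w - z)" unfolding * by (simp add: algebra_simps)
    thus ?thesis using * Fc(6) Ed by blast
  qed
  moreover have "l * x \<in> ?V" if l: "l \<in> F" and x: "x \<in> ?V" for l x
  proof -
    obtain k w where *: "k \<in> F" "w \<in> E" "x = k * v + w" using x by blast
    have "l * x = (l * k) * v + l * w" unfolding * by (simp add: algebra_simps)
    thus ?thesis using * Fc(4) Es l by blast
  qed
  moreover have "av_closed ?V"
    unfolding av_closed_def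
  proof (intro allI impI)
    fix x assume x: "\<forall>\<epsilon>>0. \<exists>u\<in>?V. av (x - u) < \<epsilon>"
    have "\<exists>k w. k \<in> F \<and> w \<in> E \<and> av (x - (k * v + w)) < 1 / real (Suc n)" for n
    proof -
      have "1 / real (Suc n) > 0" by simp
      with x obtain u where "u \<in> ?V" "av (x - u) < 1 / real (Suc n)" by blast
      thus ?thesis by blast
    qed
    then obtain k w where kw: "\<And>n. k n \<in> F" "\<And>n. w n \<in> E"
      "\<And>n. av (x - (k n * v + w n)) < 1 / real (Suc n)" by metis
    have small: "\<exists>N. \<forall>n\<ge>N. av (x - (k n * v + w n)) < \<epsilon>" if e: "\<epsilon> > 0" for \<epsilon>
    proof -
      obtain N where N: "1 / real (Suc N) < \<epsilon>" using reals_Archimedean[OF e] by (auto simp: inverse_eq_divide)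
      have "av (x - (k n * v + w n)) < \<epsilon>" if "n \<ge> N" for n
      proof -
        have "1 / real (Suc n) \<le> 1 / real (Suc N)" using that by (simp add: field_simps)
        thus ?thesis using kw(3)[of n] N by linarith
      qed
      thus ?thesis by blast
    qed
    \<comment> \<open>By \<open>k_le\<close> the coordinates along v of an approximating sequence
      are Cauchy. Their limit l lies in the closed set F, and x - l v is then a limit of points of
      E.\<close>
    have "\<exists>N. \<forall>m\<ge>N. \<forall>n\<ge>N. av (k m - k n) < \<epsilon>" if e: "\<epsilon> > 0" for \<epsilon>
    proof -
      obtain N where N: "\<forall>n\<ge>N. av (x - (k n * v + w n)) < \<epsilon> * \<delta>"
        using small[of "\<epsilon> * \<delta>"] e d(1) by auto
      have "av (k m - k n) < \<epsilon>" if mn: "m \<ge> N" "n \<ge> N" for m n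
      proof -
        have "av (k m - k n) * \<delta> \<le> av ((k m - k n) * v + (w m - w n))"
          using kw Fc(6) Ed by (intro k_le) auto
        also have "(k m - k n) * v + (w m - w n) = (x - (k n * v + w n)) - (x - (k m * v + w m))"
          by (simp add: algebra_simps)
        also have "av \<dots> \<le> max (av (x - (k n * v + w n))) (av (x - (k m * v + w m)))" by (rule av_diff)
        also have "\<dots> < \<epsilon> * \<delta>" using N mn by simp
        finally show ?thesis using d(1) by simp
      qed
      thus ?thesis by blast
    qed
    then obtain l where l: "\<forall>\<epsilon>>0. \<exists>N. \<forall>n\<ge>N. av (k n - l) < \<epsilon>"
      by (rule av_Cauchy_convergent)
    have "l \<in> F"
    proof -
      have "\<exists>y\<in>F. av (l - y) < \<epsilon>" if "\<epsilon> > 0" for \<epsilon>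
        using l that kw(1) by (metis av_diff_commute order_refl)
      thus ?thesis using F(2) unfolding av_closed_def by blast
    qed
    moreover have "x - l * v \<in> E"
    proof -
      have "\<exists>y\<in>E. av (x - l * v - y) < \<epsilon>" if e: "\<epsilon> > 0" for \<epsilon>
      proof -
        have e': "\<epsilon> / (av v + 1) > 0" using e av_nonneg[of v] by (simp add: add_nonneg_pos)
        obtain N1 where N1: "\<forall>n\<ge>N1. av (k n - l) < \<epsilon> / (av v + 1)" using l e' by blast
        obtain N2 where N2: "\<forall>n\<ge>N2. av (x - (k n * v + w n)) < \<epsilon>" using small[OF e] by blast
        let ?n = "max N1 N2"
        have "av ((k ?n - l) * v) \<le> \<epsilon> / (av v + 1) * av v"
          unfolding av_mult using N1 by (intro mult_right_mono) (auto simp: av_nonneg less_imp_le)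
        also have "\<dots> < \<epsilon>" using e av_nonneg[of v] by (simp add: field_simps add_nonneg_pos)
        finally have 1: "av ((k ?n - l) * v) < \<epsilon>" .
        have 2: "av (x - (k ?n * v + w ?n)) < \<epsilon>" using N2 by simp
        have "x - l * v - w ?n = (x - (k ?n * v + w ?n)) + (k ?n - l) * v" by (simp add: algebra_simps)
        hence "av (x - l * v - w ?n) < \<epsilon>"
          using le_less_trans[OF av_add[of "x - (k ?n * v + w ?n)" "(k ?n - l) * v"]] 1 2
          by (simp only: max_less_iff_conj)
        thus ?thesis using kw(2) by blast
      qed
      thus ?thesis using Ecl unfolding av_closed_def by blast
    qed
    ultimately show "x \<in> ?V" by (intro CollectI exI[of _ l] exI[of _ "x - l * v"]) simp
  qed
  moreover have "boundedly_precompact ?V"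
    unfolding boundedly_precompact_def
  proof (intro allI impI)
    fix R \<epsilon> :: real assume e: "\<epsilon> > 0"
    have e': "\<epsilon> / (av v + 1) > 0" using e av_nonneg[of v] by (simp add: add_nonneg_pos)
    obtain S where S: "finite S" "\<And>k. k \<in> F \<Longrightarrow> av k \<le> R / \<delta> \<Longrightarrow> \<exists>s\<in>S. av (k - s) < \<epsilon> / (av v + 1)"
      using F(3) e' unfolding boundedly_precompact_def by meson
    obtain T where T: "finite T" "\<And>w. w \<in> E \<Longrightarrow> av w \<le> C * R \<Longrightarrow> \<exists>t\<in>T. av (w - t) < \<epsilon>"
      using Ebc e unfolding boundedly_precompact_def by meson
    let ?S = "(\<lambda>(s, t). s * v + t) ` (S \<times> T)"
    have "\<exists>s\<in>?S. av (x - s) < \<epsilon>" if x: "x \<in> ?V" "av x \<le> R" for x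
    proof -
      obtain k w where *: "k \<in> F" "w \<in> E" "x = k * v + w" using x by blast
      have "av k \<le> R / \<delta>" using k_le[OF *(1,2)] d(1) x(2) *(3) by (simp add: field_simps)
      then obtain s where s: "s \<in> S" "av (k - s) < \<epsilon> / (av v + 1)" using S(2) *(1) by blast
      have "av w \<le> C * R"
        using w_le[OF *(1,2)] order_trans[OF zero_le_one C] mult_left_mono[OF x(2), of C]
        unfolding *(3) by linarith
      then obtain t where t: "t \<in> T" "av (w - t) < \<epsilon>" using T(2) *(2) by blast
      have "av ((k - s) * v) \<le> \<epsilon> / (av v + 1) * av v"
        unfolding av_mult using s by (intro mult_right_mono) (auto simp: av_nonneg less_imp_le)
      also have "\<dots> < \<epsilon>" using e av_nonneg[of v] by (simp add: field_simps add_nonneg_pos)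
      finally have "av ((k - s) * v + (w - t)) < \<epsilon>"
        using av_add[of "(k - s) * v" "w - t"] t(2) by simp
      hence "av (x - (s * v + t)) < \<epsilon>" unfolding * by (simp add: algebra_simps)
      thus ?thesis using s(1) t(1) by (intro bexI[of _ "s * v + t"]) auto
    qed
    thus "\<exists>S. finite S \<and> (\<forall>x\<in>?V. av x \<le> R \<longrightarrow> (\<exists>s\<in>S. av (x - s) < \<epsilon>))"
      using S(1) T(1) by (intro exI[of _ ?S]) auto
  qed
  moreover have "\<exists>M. \<forall>x\<in>?V. av (\<phi> x) \<le> M * av x"
    if phi: "\<forall>x\<in>?V. \<forall>y\<in>?V. \<phi> (x + y) = \<phi> x + \<phi> y" "\<forall>k\<in>F. \<forall>x\<in>?V. \<phi> (k * x) = k * \<phi> x" for \<phi>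
  proof -
    have inE: "w \<in> ?V" if "w \<in> E" for w
      using that Fc(1) by (intro CollectI exI[of _ 0] exI[of _ w]) simp
    have vV: "v \<in> ?V" using Fc(2) E0 by (intro CollectI exI[of _ 1] exI[of _ 0]) simp
    have kvV: "k * v \<in> ?V" if "k \<in> F" for k
      using that E0 by (intro CollectI exI[of _ k] exI[of _ 0]) simp
    obtain M where M: "\<And>w. w \<in> E \<Longrightarrow> av (\<phi> w) \<le> M * av w"
    proof -
      have "\<forall>x\<in>E. \<forall>y\<in>E. \<phi> (x + y) = \<phi> x + \<phi> y"
        using phi(1)[rule_format, OF inE inE] by blast
      moreover have "\<forall>k\<in>F. \<forall>x\<in>E. \<phi> (k * x) = k * \<phi> x"
        using phi(2)[rule_format, OF _ inE] by blast
      ultimately show ?thesis using Eb that by blast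
    qed
    define M' where "M' = max (av (\<phi> v) / \<delta>) (\<bar>M\<bar> * C)"
    have "av (\<phi> x) \<le> M' * av x" if x: "x \<in> ?V" for x
    proof -
      obtain k w where *: "k \<in> F" "w \<in> E" "x = k * v + w" using x by blast
      have "\<phi> x = k * \<phi> v + \<phi> w"
        using phi(1)[rule_format, OF kvV[OF *(1)] inE[OF *(2)]] phi(2)[rule_format, OF *(1) vV] *(3)
        by (simp only:)
      moreover have "av (k * \<phi> v) \<le> M' * av x"
      proof -
        have "av k \<le> av x / \<delta>" using k_le[OF *(1,2)] d(1) *(3) by (simp add: field_simps)
        hence "av (k * \<phi> v) \<le> av x / \<delta> * av (\<phi> v)" unfolding av_mult
          by (intro mult_right_mono) (auto simp: av_nonneg)
        also have "\<dots> = av (\<phi> v) / \<delta> * av x" by simp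
        also have "\<dots> \<le> M' * av x" by (intro mult_right_mono) (auto simp: M'_def av_nonneg)
        finally show ?thesis .
      qed
      moreover have "av (\<phi> w) \<le> M' * av x"
      proof -
        have "av (\<phi> w) \<le> \<bar>M\<bar> * av w" using M[OF *(2)] mult_right_mono[OF abs_ge_self[of M] av_nonneg[of w]] by linarith
        also have "\<dots> \<le> \<bar>M\<bar> * (C * av x)" using w_le[OF *(1,2)] *(3) by (intro mult_left_mono) auto
        also have "\<dots> = \<bar>M\<bar> * C * av x" by simp
        also have "\<dots> \<le> M' * av x" by (intro mult_right_mono) (auto simp: M'_def av_nonneg)
        finally show ?thesis .
      qed
      ultimately show ?thesis using av_add[of "k * \<phi> v" "\<phi> w"] by simp
    qed
    thus ?thesis by blast
  qed
  ultimately show ?thesis unfolding tame_space_def by blast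
qed

lemma tame_space_dimension:
  assumes F: "subfield F field_rec" "av_closed F" "boundedly_precompact F"
    and dim: "ring.dimension field_rec n F V"
  shows "tame_space F V"
proof -
  interpret R: field "field_rec :: 'c ring" by (rule field_from_type_algebra)
  note defs = ring_of_type_algebra_def[where 'a = 'c]
  from dim F show ?thesis
  proof (induction n F V rule: R.dimension.induct)
    case (zero_dim F)
    have "x = 0" if "\<forall>\<epsilon>>0. av x < \<epsilon>" for x
      using that av_nonneg[of x] av_pos_iff[of x] by (metis less_irrefl)
    hence "av_closed {0}" unfolding av_closed_def by simp
    moreover have "\<phi> 0 = 0" if "\<phi> (0 + 0) = \<phi> 0 + \<phi> 0" for \<phi> :: "'c \<Rightarrow> 'c" using that by simp
    moreover have "boundedly_precompact {0}" unfolding boundedly_precompact_def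
      by (intro allI impI exI[of _ "{0}"]) simp
    ultimately show ?case unfolding tame_space_def by (auto simp: defs)
  next
    case (Suc_dim v E n F)
    have "R.line_extension F v E = {k * v + w | k w. k \<in> F \<and> w \<in> E}"
      by (auto simp: R.line_extension_mem_iff) (auto simp: defs)
    thus ?case using tame_space_line_extension[of F E v] Suc_dim by simp
  qed
qed

lemma tame_space_finite_extension:
  assumes "finite_extension F L" "av_closed F" "boundedly_precompact F"
  shows "tame_space F L"
proof -
  interpret R: field "field_rec :: 'c ring" by (rule field_from_type_algebra)
  show ?thesis
    using assms tame_space_dimension unfolding finite_extension_def R.finite_dimension_def by blast
qed

end

section \<open>The fields K and K2, conjugation, and the residue field\<close>

context local_field_setting
begin

lemma subfield_K: "subfield K field_rec"
  and subfield_K2: "subfield K2 field_rec"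
  and K_subset_K2: "K \<subseteq> K2"
  using K_finite K2_unramified by (auto simp: finite_extension_def unramified_extension_def)

lemmas K_simps = subfield_field_rec[OF subfield_K]
lemmas K2_simps = subfield_field_rec[OF subfield_K2]

lemma av_closed_K: "av_closed K" and boundedly_precompact_K: "boundedly_precompact K"
  using tame_space_finite_extension[OF K_finite av_closed_rat_closure boundedly_precompact_rat_closure]
  by (auto simp: tame_space_def)

lemma av_pi_pos: "av \<pi> > 0"
  using uniformizer(2) by (simp add: av_pos_iff)

lemma av_p_le: "av (of_nat p) \<le> av \<pi>"
  by (rule uniformizer(4)) (auto simp: K_simps av_p)

lemma sigma_1: "\<sigma> 1 = 1"
  by (rule sigma_fixes) (rule K_simps)

lemma sigma_0: "\<sigma> 0 = 0"
  by (rule sigma_fixes) (rule K_simps)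

lemma sigma_power: "x \<in> K2 \<Longrightarrow> \<sigma> (x ^ n) = \<sigma> x ^ n"
  by (induction n) (simp_all add: sigma_1 sigma_mult K2_simps)

text \<open>\<open>\<sigma>\<close> is bounded because \<open>K2\<close> is finite-dimensional over the complete field \<open>K\<close>;
  boundedness on all powers of \<open>x\<close> forces the constant to be 1.\<close>

lemma av_sigma:
  assumes "x \<in> K2"
  shows "av (\<sigma> x) = av x"
proof -
  have "tame_space K K2"
    using K2_unramified av_closed_K boundedly_precompact_K
    by (intro tame_space_finite_extension) (simp_all add: unramified_extension_def)
  moreover have "\<forall>x\<in>K2. \<forall>y\<in>K2. \<sigma> (x + y) = \<sigma> x + \<sigma> y" by (simp add: sigma_add)
  moreover have "\<forall>k\<in>K. \<forall>x\<in>K2. \<sigma> (k * x) = k * \<sigma> x"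
    using K_subset_K2 by (auto simp: sigma_mult sigma_fixes)
  ultimately obtain M where M: "\<And>x. x \<in> K2 \<Longrightarrow> av (\<sigma> x) \<le> M * av x"
    unfolding tame_space_def by blast
  have le: "av (\<sigma> x) \<le> av x" if "x \<in> K2" for x
  proof (rule power_dominated_imp_le)
    fix n show "av (\<sigma> x) ^ n \<le> M * av x ^ n"
      using M[of "x ^ n"] that by (simp add: sigma_power K2_simps av_power)
  qed (simp_all add: av_nonneg)
  show ?thesis
  proof (cases "x = 0")
    case False
    have "\<sigma> x * \<sigma> (inverse x) = 1"
      using assms False by (simp add: K2_simps sigma_1 flip: sigma_mult)
    hence "av (\<sigma> x) * av (\<sigma> (inverse x)) = 1" by (simp flip: av_mult)
    moreover have "av (\<sigma> (inverse x)) \<le> inverse (av x)"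
      using le[of "inverse x"] assms by (simp add: K2_simps av_inverse)
    ultimately have "1 \<le> av (\<sigma> x) * inverse (av x)"
      using mult_left_mono[OF _ av_nonneg[of "\<sigma> x"]] by metis
    hence "av x \<le> av (\<sigma> x)" using False av_pos_iff[of x] by (simp add: field_simps)
    thus ?thesis using le[OF assms] by simp
  qed (simp add: sigma_0)
qed

text \<open>The additive group of integers modulo the maximal ideal is finite by precompactness and
  killed by p. If a prime l divides its order, a Sylow subgroup of order l consists of elements
  whose order divides both l and p, so l = p.\<close>

lemma residue_card_prime_power: obtains f where "q = p ^ f" "f > 0"
proof -
  define G where "G = \<lparr>carrier = int_ring av K, monoid.mult = (+), one = (0 :: 'c)\<rparr>"
  define H where "H = {x \<in> K. av x < 1}"
  define r where "r = {(x, y). x \<in> int_ring av K \<and> y \<in> int_ring av K \<and> av (x - y) < 1}"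
  note Gs = G_def int_ring_def
  interpret G: comm_group G
  proof (rule comm_groupI)
    fix x assume "x \<in> carrier G"
    thus "\<exists>y\<in>carrier G. y \<otimes>\<^bsub>G\<^esub> x = \<one>\<^bsub>G\<^esub>"
      by (intro bexI[of _ "- x"]) (auto simp: Gs K_simps)
  next
    fix x y assume "x \<in> carrier G" "y \<in> carrier G"
    thus "x \<otimes>\<^bsub>G\<^esub> y \<in> carrier G"
      using av_add[of x y] by (auto simp: Gs K_simps)
  qed (auto simp: Gs K_simps)
  have inv: "m_inv G x = - x" if "x \<in> carrier G" for x
    using that by (intro G.inv_equality) (auto simp: Gs K_simps)
  have "subgroup H G"
  proof (rule G.subgroupI)
    fix x y assume "x \<in> H" "y \<in> H"
    thus "x \<otimes>\<^bsub>G\<^esub> y \<in> H"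
      using av_add[of x y] by (auto simp: Gs H_def K_simps)
  next
    fix x assume "x \<in> H"
    moreover from this have "x \<in> carrier G" by (auto simp: Gs H_def)
    ultimately show "m_inv G x \<in> H" by (auto simp: inv H_def K_simps)
  next
    have "0 \<in> H" by (simp add: H_def K_simps)
    thus "H \<noteq> {}" by blast
  qed (auto simp: Gs H_def)
  then interpret H: normal H G by (rule G.subgroup_imp_normal)
  let ?Q = "G Mod H"
  interpret Q: group ?Q by (rule H.factorgroup_is_group)
  \<comment> \<open>Identifies the cosets with the classes counted by \<open>residue_card\<close>,
    so that q becomes the order of a group.\<close>
  have coset: "H #>\<^bsub>G\<^esub> x = r `` {x}" if "x \<in> carrier G" for x
  proof (intro equalityI subsetI)
    fix y assume "y \<in> H #>\<^bsub>G\<^esub> x"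
    then obtain h where "h \<in> H" "y = h + x" by (auto simp: r_coset_def Gs)
    thus "y \<in> r `` {x}" using that av_add[of h x] av_diff_commute[of x "h + x"]
      by (auto simp: r_def Gs H_def K_simps)
  next
    fix y assume "y \<in> r `` {x}"
    hence "y - x \<in> H" by (auto simp: r_def H_def int_ring_def K_simps av_diff_commute)
    thus "y \<in> H #>\<^bsub>G\<^esub> x" unfolding r_coset_def Gs by (auto intro!: bexI[of _ "y - x"])
  qed
  have carrier_coset: "carrier ?Q = (\<Union>x\<in>carrier G. {H #>\<^bsub>G\<^esub> x})"
    by (simp add: FactGroup_def RCOSETS_def)
  have carrier: "carrier ?Q = int_ring av K // r"
  proof -
    note carrier_coset
    also have "\<dots> = (\<Union>x\<in>carrier G. {r `` {x}})" using coset by simp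
    finally show ?thesis by (simp add: quotient_def Gs)
  qed
  have q: "q = order ?Q" unfolding order_def carrier q_eq residue_card_def r_def ..
  \<comment> \<open>Each class is the trace of an open ball of radius 1 and is determined by any
    point of S in that ball, even one outside K.\<close>
  have "finite (carrier ?Q)"
  proof -
    obtain S where S: "finite S" "\<forall>v\<in>K. av v \<le> 1 \<longrightarrow> (\<exists>s\<in>S. av (v - s) < 1)"
      using boundedly_precompact_K unfolding boundedly_precompact_def by (meson zero_less_one)
    have "carrier ?Q \<subseteq> (\<lambda>s. {y \<in> int_ring av K. av (y - s) < 1}) ` S"
    proof
      fix c assume "c \<in> carrier ?Q"
      then obtain x where x: "x \<in> int_ring av K" "c = r `` {x}"
        unfolding carrier quotient_def by blast
      then obtain s where s: "s \<in> S" "av (x - s) < 1" using S(2) by (auto simp: int_ring_def)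
      have "av (y - s) < 1 \<longleftrightarrow> av (x - y) < 1" for y
      proof
        assume "av (y - s) < 1"
        hence "av (s - y) < 1" by (simp add: av_diff_commute)
        with s(2) show "av (x - y) < 1" by (rule av_less_triangle)
      next
        assume "av (x - y) < 1"
        hence "av (y - x) < 1" by (simp add: av_diff_commute)
        thus "av (y - s) < 1" using s(2) by (rule av_less_triangle)
      qed
      hence "c = {y \<in> int_ring av K. av (y - s) < 1}" using x by (auto simp: r_def)
      thus "c \<in> (\<lambda>s. {y \<in> int_ring av K. av (y - s) < 1}) ` S" using s(1) by blast
    qed
    thus ?thesis using S(1) finite_surj by blast
  qed
  hence q0: "q > 0" unfolding q using Q.order_gt_0_iff_finite by blast
  have pow: "x [^]\<^bsub>?Q\<^esub> p = \<one>\<^bsub>?Q\<^esub>" if x: "x \<in> carrier ?Q" for x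
  proof -
    obtain y where y: "y \<in> carrier G" "x = H #>\<^bsub>G\<^esub> y"
      using x unfolding carrier_coset by blast
    have Gpow: "y [^]\<^bsub>G\<^esub> n = of_nat n * y" for n :: nat
      by (induction n) (auto simp: Gs algebra_simps)
    have "x [^]\<^bsub>?Q\<^esub> p = H #>\<^bsub>G\<^esub> (y [^]\<^bsub>G\<^esub> p)"
      unfolding y(2) using H.FactGroup_pow[OF y(1)] by simp
    moreover have "y [^]\<^bsub>G\<^esub> p \<in> H"
    proof -
      have "av (of_nat p * y) \<le> av (of_nat p)"
        using y(1) av_p_pos by (simp add: Gs av_mult mult_left_le)
      hence "of_nat p * y \<in> H" using y(1) av_p by (simp add: H_def Gs K_simps)
      thus ?thesis unfolding Gpow .
    qed
    moreover from this have "H #>\<^bsub>G\<^esub> (y [^]\<^bsub>G\<^esub> p) = H"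
      using H.subset by (intro G.coset_join2[OF _ H.subgroup_axioms]) auto
    ultimately show ?thesis by (simp add: FactGroup_def)
  qed
  have only_p: "l = p" if l: "Factorial_Ring.prime l" "l dvd q" for l
  proof (rule ccontr)
    assume "l \<noteq> p"
    obtain m where "order ?Q = l ^ 1 * m" using l(2) q by auto
    then obtain S where S: "subgroup S ?Q" "card S = l ^ 1"
      using sylow_thm[OF l(1) Q.group_axioms _ \<open>finite (carrier ?Q)\<close>] by blast
    have "x = \<one>\<^bsub>?Q\<^esub>" if x: "x \<in> S" for x
    proof -
      have xc: "x \<in> carrier ?Q" using S(1) x subgroup.subset by blast
      interpret S: group "?Q\<lparr>carrier := S\<rparr>" using S(1) Q.subgroup_imp_group by blast
      have "x [^]\<^bsub>?Q\<lparr>carrier := S\<rparr>\<^esub> order (?Q\<lparr>carrier := S\<rparr>) = \<one>\<^bsub>?Q\<lparr>carrier := S\<rparr>\<^esub>"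
        using x by (intro S.pow_order_eq_1) simp
      hence "x [^]\<^bsub>?Q\<^esub> l = \<one>\<^bsub>?Q\<^esub>"
        using S(2) by (simp add: order_def Q.nat_pow_consistent[of x l S])
      hence "Q.ord x dvd l" "Q.ord x dvd p" using pow[OF xc] Q.pow_eq_id[OF xc] by auto
      moreover have "coprime l p" using l(1) prime_p \<open>l \<noteq> p\<close> by (simp add: primes_coprime)
      ultimately have "Q.ord x = 1" by (metis coprime_common_divisor_nat)
      thus ?thesis using Q.ord_eq_1[OF xc] by simp
    qed
    hence "S \<subseteq> {\<one>\<^bsub>?Q\<^esub>}" by blast
    hence "card S \<le> 1" using card_mono[of "{\<one>\<^bsub>?Q\<^esub>}" S] by simp
    thus False using S(2) prime_gt_1_nat[OF l(1)] by simp
  qed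
  have "q = (\<Prod>l\<in>prime_factors q. l ^ multiplicity l q)"
    using q0 by (simp add: prime_factorization_nat)
  moreover have "prime_factors q \<subseteq> {p}" using only_p by (auto simp: prime_factors_dvd)
  ultimately have qp: "q = p ^ (if p \<in> prime_factors q then multiplicity p q else 0)"
    by (cases "p \<in> prime_factors q") (auto simp: subset_singleton_iff)
  have "q \<noteq> 1"
  proof
    assume "q = 1"
    then obtain c where c: "int_ring av K // r = {c}" unfolding q order_def carrier by (rule card_1_singletonE)
    have 01: "0 \<in> int_ring av K" "1 \<in> int_ring av K" by (auto simp: int_ring_def K_simps)
    have "r `` {0} \<in> {c}" "r `` {1} \<in> {c}" using 01 unfolding c[symmetric] by (auto intro: quotientI)
    hence "r `` {0} = r `` {1}" by simp
    moreover have "1 \<in> r `` {1}" using 01 by (simp add: r_def)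
    ultimately have "1 \<in> r `` {0}" by simp
    thus False by (simp add: r_def)
  qed
  with qp that show ?thesis by (metis gr0I power_0)
qed

lemma q_ge_2: "q \<ge> 2"
proof -
  obtain f where f: "q = p ^ f" "f > 0" by (rule residue_card_prime_power)
  have "p ^ 1 \<le> p ^ f" using f(2) prime_gt_0_nat[OF prime_p] by (intro power_increasing) auto
  thus ?thesis using f(1) prime_ge_2_nat[OF prime_p] by simp
qed

text \<open>From i (q choose i) = q (q - 1 choose i - 1): if p did not divide the binomial
  coefficient, all of q = p^f would divide i < q.\<close>

lemma av_binomial_le:
  assumes "0 < i" "i < q"
  shows "av (of_nat (q choose i)) \<le> av \<pi>"
proof -
  obtain f where f: "q = p ^ f" by (rule residue_card_prime_power)
  have "p dvd q choose i"
  proof (rule ccontr)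
    assume np: "\<not> p dvd q choose i"
    have "i * (q choose i) = q * (q - 1 choose (i - 1))"
      using times_binomial_minus1_eq[of i q] assms by simp
    hence "p ^ f dvd i * (q choose i)" using f by simp
    moreover have "coprime (p ^ f) (q choose i)"
      using np prime_p by (simp add: prime_imp_coprime)
    ultimately have "p ^ f dvd i" by (simp add: coprime_dvd_mult_left_iff)
    thus False using assms f dvd_imp_le by fastforce
  qed
  then obtain c where c: "q choose i = p * c" by blast
  have "av (of_nat (q choose i)) = av (of_nat p) * av (of_nat c)" unfolding c by (simp add: av_mult)
  also have "\<dots> \<le> av (of_nat p)" using av_of_nat_le[of c] av_p_pos by (simp add: mult_left_le)
  also have "\<dots> \<le> av \<pi>" by (rule av_p_le)
  finally show ?thesis .
qed

end

section \<open>The coefficients of the period map\<close>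

text \<open>The lowest exponent is visible from divisibility: all further terms are divisible by
  q^(e 0 + 1), whereas q^(e 0) is not. Strip it off and induct; k is the number of terms.\<close>

lemma base_expansion_length_unique:
  fixes q k k' :: nat and e e' :: "nat \<Rightarrow> nat"
  assumes "q \<ge> 2"
    and "\<forall>i j. i < j \<and> j < k \<longrightarrow> e i < e j" "\<forall>i j. i < j \<and> j < k' \<longrightarrow> e' i < e' j"
    and "(\<Sum>i<k. q ^ e i) = (\<Sum>i<k'. q ^ e' i)"
  shows "k = k'"
  using assms(2-)
proof (induction k arbitrary: k' e e')
  case 0
  then show ?case using \<open>q \<ge> 2\<close> by (cases k') auto
next
  case (Suc k)
  have q0: "q > 0" using \<open>q \<ge> 2\<close> by simp
  have "k' \<noteq> 0" using Suc.prems(3) q0 by (intro notI) (auto simp: sum.lessThan_Suc)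
  then obtain l where k': "k' = Suc l" using not0_implies_Suc by blast
  define A where "A = (\<Sum>i<k. q ^ e (Suc i))"
  define A' where "A' = (\<Sum>i<l. q ^ e' (Suc i))"
  have eq: "q ^ e 0 + A = q ^ e' 0 + A'"
    using Suc.prems(3) unfolding k' A_def A'_def by (simp add: sum.lessThan_Suc_shift del: sum.lessThan_Suc)
  have A: "q ^ Suc (e 0) dvd A" unfolding A_def
    using Suc.prems(1) by (intro dvd_sum le_imp_power_dvd) (simp add: Suc_le_eq)
  have A': "q ^ Suc (e' 0) dvd A'" unfolding A'_def
    using Suc.prems(2) by (intro dvd_sum le_imp_power_dvd) (simp add: Suc_le_eq k')
  have aux: "\<not> x < y" if "q ^ x + B = q ^ y + B'" "q ^ Suc x dvd B" "q ^ Suc y dvd B'" for x y B B'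
  proof
    assume "x < y"
    hence "q ^ Suc x dvd q ^ y" "q ^ Suc x dvd q ^ Suc y"
      by (auto intro!: le_imp_power_dvd simp del: power_Suc)
    moreover from this(2) that(3) have "q ^ Suc x dvd B'" by (rule dvd_trans)
    ultimately have "q ^ Suc x dvd q ^ y" "q ^ Suc x dvd B'" by blast+
    hence "q ^ Suc x dvd q ^ x + B" unfolding that(1) by (rule dvd_add)
    hence "q ^ Suc x dvd q ^ x" using that(2) by (simp only: dvd_add_left_iff)
    hence "q ^ Suc x \<le> q ^ x" using q0 by (intro dvd_imp_le) auto
    thus False using \<open>q \<ge> 2\<close> q0 by simp
  qed
  have "e 0 = e' 0" using aux[OF eq A A'] aux[OF eq[symmetric] A' A] by simp
  hence "A = A'" using eq by simp
  hence "k = l" unfolding A_def A'_def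
    by (intro Suc.IH[of "\<lambda>i. e (Suc i)" l "\<lambda>i. e' (Suc i)"]) (auto simp: k' Suc.prems)
  thus ?case using k' by simp
qed

lemma gh_rep_unique:
  assumes "q \<ge> 2" "gh_rep q k n" "gh_rep q k' n"
  shows "k = k'"
proof -
  have mono: "2 * a i + i < 2 * a j + j" if "\<forall>i<k. a i \<le> a (Suc i)" "i < j" "j < Suc k"
    for a :: "nat \<Rightarrow> nat" and i j k
  proof -
    have "a i \<le> a j" using that(2,3)
    proof (induction j)
      case (Suc j)
      then show ?case using that(1) by (cases "i = j") (auto intro: order_trans)
    qed simp
    thus ?thesis using that(2) by simp
  qed
  obtain a where a: "\<forall>i<k. a i \<le> a (Suc i)" "n = (\<Sum>i\<le>k. q ^ (2 * a i + i))"
    using assms(2) by (auto simp: gh_rep_def)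
  obtain b where b: "\<forall>i<k'. b i \<le> b (Suc i)" "n = (\<Sum>i\<le>k'. q ^ (2 * b i + i))"
    using assms(3) by (auto simp: gh_rep_def)
  \<comment> \<open>In \<open>gh_rep\<close> the index k stands for k + 1 summands.\<close>
  have "Suc k = Suc k'"
    by (rule base_expansion_length_unique[OF assms(1), of _ "\<lambda>i. 2 * a i + i" _ "\<lambda>i. 2 * b i + i"])
      (use mono[OF a(1)] mono[OF b(1)] a(2) b(2) in \<open>simp_all add: lessThan_Suc_atMost\<close>)
  thus ?thesis by simp
qed

lemma gh_rep_ge:
  assumes "q \<ge> 2" "gh_rep q k n"
  shows "(\<Sum>i\<le>k. q ^ i) \<le> n"
proof -
  obtain a where a: "n = (\<Sum>i\<le>k. q ^ (2 * a i + i))" using assms(2) by (auto simp: gh_rep_def)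
  show ?thesis unfolding a using assms(1) by (intro sum_mono power_increasing) auto
qed

lemma gh_rep_gt: "q \<ge> 2 \<Longrightarrow> gh_rep q k n \<Longrightarrow> k < n"
proof -
  assume A: "q \<ge> 2" "gh_rep q k n"
  have "(\<Sum>i\<le>k. 1) \<le> (\<Sum>i\<le>k. q ^ i)" using A(1) by (intro sum_mono) (simp add: Suc_leI)
  thus "k < n" using gh_rep_ge[OF A] by simp
qed

text \<open>Since q is -1 modulo q + 1, the i-th summand is (-1)^i, and the alternating sum depends
  only on the parity of k. This is the source of all congruences modulo q + 1 below.\<close>

lemma gh_rep_dvd:
  assumes "gh_rep q k n"
  shows "int (q + 1) dvd int n - (if even k then 1 else 0)"
proof -
  obtain a where a: "n = (\<Sum>i\<le>k. q ^ (2 * a i + i))" using assms by (auto simp: gh_rep_def)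
  have dvd: "int (q + 1) dvd int q ^ j - (-1) ^ j" for j
  proof (induction j)
    case (Suc j)
    have "int q ^ Suc j - (-1) ^ Suc j = int q * (int q ^ j - (-1) ^ j) + int (q + 1) * (-1) ^ j"
      by (simp add: algebra_simps)
    thus ?case using Suc by (metis dvd_add dvd_mult dvd_triv_left)
  qed simp
  have alt: "(\<Sum>i\<le>k. (-1 :: int) ^ i) = (if even k then 1 else 0)"
    by (induction k) auto
  have "int n - (\<Sum>i\<le>k. (-1) ^ i) = (\<Sum>i\<le>k. int q ^ (2 * a i + i) - (-1) ^ (2 * a i + i))"
    unfolding a by (simp add: sum_subtractf power_add power_mult)
  also have "int (q + 1) dvd \<dots>" by (intro dvd_sum dvd)
  finally show ?thesis unfolding alt .
qed

lemma gh_c_cases: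
  assumes "q \<ge> 2" "gh_c \<pi> q n \<noteq> 0" "n \<noteq> 0"
  obtains k where "odd k" "gh_rep q k n" "gh_c \<pi> q n = inverse \<pi> ^ ((k + 1) div 2)"
proof -
  obtain k where k: "odd k" "gh_rep q k n" using assms(2,3) by (auto simp: gh_c_def split: if_splits)
  hence "(THE k. odd k \<and> gh_rep q k n) = k" using gh_rep_unique[OF assms(1)] by blast
  hence "gh_c \<pi> q n = inverse \<pi> ^ ((k + 1) div 2)" using k assms(3) by (auto simp: gh_c_def)
  thus ?thesis using k that by blast
qed

lemma gh_d_cases:
  assumes "q \<ge> 2" "gh_d \<pi> q n \<noteq> 0"
  obtains k where "even k" "gh_rep q k n" "gh_d \<pi> q n = inverse \<pi> ^ (k div 2)"
proof -
  obtain k where k: "even k" "gh_rep q k n" using assms(2) by (auto simp: gh_d_def split: if_splits)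
  hence "(THE k. even k \<and> gh_rep q k n) = k" using gh_rep_unique[OF assms(1)] by blast
  hence "gh_d \<pi> q n = inverse \<pi> ^ (k div 2)" using k by (auto simp: gh_d_def)
  thus ?thesis using k that by blast
qed

lemma gh_c_0 [simp]: "gh_c \<pi> q 0 = 1"
  by (simp add: gh_c_def)

lemma gh_d_0 [simp]: "q \<ge> 2 \<Longrightarrow> gh_d \<pi> q 0 = 0"
  using gh_rep_gt[of q _ 0] by (auto simp: gh_d_def)

lemma gh_d_1:
  assumes "q \<ge> 2"
  shows "gh_d \<pi> q (Suc 0) = 1"
proof -
  have "gh_rep q 0 (Suc 0)" unfolding gh_rep_def by (intro exI[of _ "\<lambda>_. 0"]) simp
  hence "(THE k. even k \<and> gh_rep q k (Suc 0)) = 0" "\<exists>k. even k \<and> gh_rep q k (Suc 0)"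
    using gh_rep_unique[OF assms] by (auto intro!: exI[of _ 0])
  thus ?thesis by (simp add: gh_d_def)
qed

lemma gh_c_cong:
  assumes "q \<ge> 2" "gh_c \<pi> q n \<noteq> 0"
  shows "q + 1 dvd n"
proof (cases "n = 0")
  case False
  obtain k where k: "odd k" "gh_rep q k n" using assms False by (rule gh_c_cases)
  hence "int (q + 1) dvd int n" using gh_rep_dvd[OF k(2)] by simp
  thus ?thesis by (simp only: int_dvd_int_iff)
qed simp

lemma gh_d_cong:
  assumes "q \<ge> 2" "gh_d \<pi> q n \<noteq> 0"
  shows "q + 1 dvd n - 1" "n > 0"
proof -
  obtain k where k: "even k" "gh_rep q k n" using assms by (rule gh_d_cases)
  show n: "n > 0" using gh_rep_gt[OF assms(1) k(2)] by simp
  have "int (q + 1) dvd int n - 1" using gh_rep_dvd[OF k(2)] k(1) by simp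
  also have "int n - 1 = int (n - 1)" using n by simp
  finally show "q + 1 dvd n - 1" by (simp only: int_dvd_int_iff)
qed

text \<open>Raising the power of 1/\<pi> by one adds two powers of q, each at least q^2, to the
  lower bound for n; these pay for the additional (q + 1)^2.\<close>

lemma square_Suc_le:
  fixes q b c :: nat
  assumes "q \<ge> 2" "q ^ 2 \<le> b" "q ^ 2 \<le> c"
  shows "(q + 1) ^ 2 \<le> 2 * (b + c)"
proof -
  define s where "s = q ^ 2"
  have "2 * q \<le> s" using mult_le_mono1[OF assms(1), of q] by (simp add: s_def power2_eq_square)
  moreover have "(q + 1) ^ 2 = s + 2 * q + 1" by (simp add: s_def power2_eq_square)
  moreover have "s \<le> b" "s \<le> c" using assms by (simp_all add: s_def)
  ultimately show ?thesis using assms(1) by simp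
qed

lemma double_step_le:
  fixes x :: nat
  assumes "x \<le> 2 * s" "y \<le> 2 * (b + c)" "x' = x + y" "s' = s + b + c"
  shows "x' \<le> 2 * s'"
  using assms by simp

text \<open>With \<rho>^(q+1) \<le> |\<pi>|^(2/(q+1)), the inequality says that \<pi>^(-j) u^n has
  norm at most 1. It fails for n = q + 1, where j = 1 and (q + 1)^2 exceeds 2 (q + 1).\<close>

lemma gh_c_estimate:
  assumes "q \<ge> 2" "gh_c \<pi> q n \<noteq> 0" "n \<noteq> 0" "n \<noteq> q + 1"
  obtains j where "gh_c \<pi> q n = inverse \<pi> ^ j" "(q + 1) ^ 2 * j \<le> 2 * n"
proof -
  obtain k where k: "odd k" "gh_rep q k n" "gh_c \<pi> q n = inverse \<pi> ^ ((k + 1) div 2)"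
    using assms(1-3) by (rule gh_c_cases)
  obtain i where i: "k = 2 * i + 1" using k(1) by (rule oddE)
  have "(q + 1) ^ 2 * (i + 1) \<le> 2 * n"
  \<comment> \<open>For k = 1 the lower bound n \<ge> 1 + q is too weak. Excluding n = q + 1 forces
    a 1 \<ge> 1, hence n \<ge> 1 + q^3.\<close>
  proof (cases "i = 0")
    case True
    obtain a where a': "\<forall>j<k. a j \<le> a (Suc j)" "n = (\<Sum>j\<le>k. q ^ (2 * a j + j))"
      using k(2) unfolding gh_rep_def by blast
    have a: "a 0 \<le> a 1" "n = q ^ (2 * a 0) + q ^ (2 * a 1 + 1)"
      using a' unfolding i True by simp_all
    have "a 1 \<noteq> 0" using a assms(4) by (intro notI) simp
    hence "q ^ 3 \<le> q ^ (2 * a 1 + 1)" using assms(1) by (intro power_increasing) auto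
    moreover have "1 \<le> q ^ (2 * a 0)" using assms(1) by (simp add: Suc_leI)
    ultimately have "1 + q ^ 3 \<le> n" unfolding a by simp
    moreover have "(q + 1) ^ 2 \<le> 2 * (1 + q ^ 3)"
    proof -
      have "2 * (q * q) \<le> q * (q * q)" "2 * q \<le> q * q" "1 \<le> q * q"
        using mult_le_mono1[OF assms(1), of "q * q"] mult_le_mono1[OF assms(1), of q] assms(1) by auto
      moreover have "(q + 1) ^ 2 = q * q + 2 * q + 1" "q ^ 3 = q * (q * q)"
        by (simp_all add: power2_eq_square power3_eq_cube)
      moreover define s t where "s = q * q" "t = q * s"
      ultimately have "2 * s \<le> t" "2 * q \<le> s" "1 \<le> s" "(q + 1) ^ 2 = s + 2 * q + 1" "q ^ 3 = t"
        by simp_all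
      thus ?thesis by simp
    qed
    ultimately show ?thesis using True by simp
  next
    case False
    have "(q + 1) ^ 2 * (i + 1) \<le> 2 * (\<Sum>i\<le>2 * i + 1. q ^ i)" if "i \<ge> 1" for i
      using that
    proof (induction i rule: dec_induct)
      case base
      have "{..2 * 1 + 1 :: nat} = {0, 1, 2, 3}" by auto
      hence "2 * (\<Sum>i\<le>2 * 1 + 1. q ^ i) = 2 + 2 * q + 2 * q ^ 2 + 2 * q ^ 3" by simp
      moreover have "2 * (q * q) \<le> q * (q * q)" "2 * q \<le> q * q"
        using mult_le_mono1[OF assms(1), of "q * q"] mult_le_mono1[OF assms(1), of q] by auto
      moreover have "(q + 1) ^ 2 * (1 + 1) = 2 * (q * q) + 4 * q + 2" "q ^ 2 = q * q" "q ^ 3 = q * (q * q)"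
        by (simp_all add: power2_eq_square power3_eq_cube)
      moreover define s t where "s = q * q" "t = q * s"
      ultimately have "2 * s \<le> t" "2 * q \<le> s" "(q + 1) ^ 2 * (1 + 1) = 2 * s + 4 * q + 2"
        "2 * (\<Sum>i\<le>2 * 1 + 1. q ^ i) = 2 + 2 * q + 2 * s + 2 * t"
        by (simp_all only:)
      thus ?case by linarith
    next
      case (step i)
      have "q ^ 2 \<le> q ^ (2 * i + 2)" "q ^ 2 \<le> q ^ (2 * i + 3)"
        by (rule power_increasing; use assms(1) in simp)+
      then have "(q + 1) ^ 2 \<le> 2 * (q ^ (2 * i + 2) + q ^ (2 * i + 3))"
        by (rule square_Suc_le[OF assms(1)])
      from step.IH this have "(q + 1) ^ 2 * (Suc i + 1) \<le> 2 * (\<Sum>j\<le>2 * Suc i + 1. q ^ j)"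
        by (rule double_step_le) (simp_all add: numeral_eq_Suc)
      thus ?case .
    qed
    hence "(q + 1) ^ 2 * (i + 1) \<le> 2 * (\<Sum>j\<le>k. q ^ j)" using False i by simp
    thus ?thesis using gh_rep_ge[OF assms(1) k(2)] by linarith
  qed
  thus ?thesis using that[of "i + 1"] k(3) i by simp
qed

text \<open>The surplus q^2 - 1 = (q + 1)(q - 1) becomes a factor \<omega>^(q-1) \<le> t^(q-1),
  which later absorbs the large weight of the coefficient of index q + 1 in \<phi>0. The shift to n
  - 1 comes from dividing A by u.\<close>

lemma gh_d_estimate:
  assumes "q \<ge> 2" "gh_d \<pi> q n \<noteq> 0" "n \<noteq> 1"
  obtains j where "gh_d \<pi> q n = inverse \<pi> ^ j" "(q + 1) ^ 2 * j + (q ^ 2 - 1) \<le> 2 * (n - 1)"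
proof -
  obtain k where k: "even k" "gh_rep q k n" "gh_d \<pi> q n = inverse \<pi> ^ (k div 2)"
    using assms(1,2) by (rule gh_d_cases)
  obtain i where i: "k = 2 * i" using k(1) by (rule evenE)
  have "(q + 1) ^ 2 * i + (q ^ 2 - 1) \<le> 2 * (n - 1)"
  proof (cases "i = 0")
    case True
    obtain a :: "nat \<Rightarrow> nat" where a: "n = q ^ (2 * a 0)"
      using k(2) unfolding i True gh_rep_def by auto
    have "a 0 \<noteq> 0" using a assms(3) by (intro notI) simp
    hence "q ^ 2 \<le> n" unfolding a using assms(1) by (intro power_increasing) auto
    thus ?thesis using True by simp
  next
    case False
    \<comment> \<open>Written additively; the + 1 is what the two truncated subtractions in the
      claim require. For i = 1 this is an equality.\<close>
    have "(q + 1) ^ 2 * i + q ^ 2 + 1 \<le> 2 * (\<Sum>i\<le>2 * i. q ^ i)" if "i \<ge> 1" for i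
      using that
    proof (induction i rule: dec_induct)
      case base
      have "{..2 * 1 :: nat} = {0, 1, 2}" by auto
      hence "2 * (\<Sum>i\<le>2 * 1. q ^ i) = 2 + 2 * q + 2 * q ^ 2" by simp
      thus ?case by (simp add: power2_eq_square algebra_simps)
    next
      case (step i)
      have "q ^ 2 \<le> q ^ (2 * i + 1)" "q ^ 2 \<le> q ^ (2 * i + 2)"
        by (rule power_increasing; use assms(1) step.hyps in simp)+
      then have "(q + 1) ^ 2 \<le> 2 * (q ^ (2 * i + 1) + q ^ (2 * i + 2))"
        by (rule square_Suc_le[OF assms(1)])
      from step.IH this have "(q + 1) ^ 2 * Suc i + q ^ 2 + 1 \<le> 2 * (\<Sum>j\<le>2 * Suc i. q ^ j)"
        by (rule double_step_le) (simp_all add: numeral_eq_Suc)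
      thus ?case .
    qed
    hence "(q + 1) ^ 2 * i + q ^ 2 + 1 \<le> 2 * (\<Sum>j\<le>k. q ^ j)" using False i by simp
    moreover have "1 \<le> q ^ 2" using assms(1) by simp
    moreover have "x + (s - 1) \<le> 2 * (n - 1)" if "x + s + 1 \<le> 2 * t" "1 \<le> s" "t \<le> n" for x s t :: nat
      using that by linarith
    ultimately show ?thesis using gh_rep_ge[OF assms(1) k(2)] by blast
  qed
  thus ?thesis using that[of i] k(3) i by simp
qed

section \<open>Estimates for the coefficients of the torus action\<close>

text \<open>A common summation bound for all coefficients up to n lets the later double sums run
  over a fixed square.\<close>

lemma fps_compose_nth_le:
  fixes f A :: "'a::comm_ring_1 fps"
  assumes "A $ 0 = 0" "i \<le> n"
  shows "(f oo A) $ i = (\<Sum>l\<le>n. f $ l * (A ^ l) $ i)"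
proof -
  have "(f oo A) $ i = (\<Sum>l\<le>i. f $ l * (A ^ l) $ i)"
    by (simp add: fps_compose_nth atLeast0AtMost)
  also have "\<dots> = (\<Sum>l\<le>n. f $ l * (A ^ l) $ i)"
    using assms by (intro sum.mono_neutral_left) (auto simp: startsby_zero_power_prefix)
  finally show ?thesis .
qed

lemma fps_mult_compose_nth:
  fixes F f A :: "'a::comm_ring_1 fps"
  assumes "A $ 0 = 0"
  shows "(F * (f oo A)) $ n = (\<Sum>m\<le>n. \<Sum>l\<le>n. F $ m * f $ l * (fps_X ^ m * A ^ l) $ n)"
proof -
  have "(F * (f oo A)) $ n = (\<Sum>m\<le>n. F $ m * (f oo A) $ (n - m))"
    by (simp add: fps_mult_nth atLeast0AtMost)
  also have "\<dots> = (\<Sum>m\<le>n. \<Sum>l\<le>n. F $ m * f $ l * (fps_X ^ m * A ^ l) $ n)"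
    by (intro sum.cong refl)
      (simp add: fps_compose_nth_le[OF assms, of _ n] sum_distrib_left fps_X_power_mult_nth mult.assoc)
  finally show ?thesis .
qed

context local_field_setting
begin

text \<open>The power of 1/\<pi> is at most k, which is below n. Crude, but enough to evaluate the
  period series at \<pi>^k with k \<ge> 2, where the given action is compared with the formal
  one.\<close>

lemma gh_c_bound: "av (gh_c \<pi> q n) * av \<pi> ^ n \<le> 1"
  and gh_d_bound: "av (gh_d \<pi> q n) * av \<pi> ^ n \<le> 1"
proof -
  have *: "av (inverse \<pi> ^ j) * av \<pi> ^ n \<le> 1" if "j \<le> n" for j
  proof -
    have "av \<pi> ^ n \<le> av \<pi> ^ j" using that av_pi_pos uniformizer(3) by (intro power_decreasing) auto
    moreover have eq: "av (inverse \<pi> ^ j) = inverse (av \<pi> ^ j)"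
      by (simp only: av_power av_inverse power_inverse)
    ultimately show ?thesis unfolding eq using av_pi_pos by (simp add: field_simps)
  qed
  show "av (gh_c \<pi> q n) * av \<pi> ^ n \<le> 1"
  proof (cases "gh_c \<pi> q n = 0 \<or> n = 0")
    case False
    then obtain k where k: "odd k" "gh_rep q k n" "gh_c \<pi> q n = inverse \<pi> ^ ((k + 1) div 2)"
      using gh_c_cases[OF q_ge_2] by blast
    thus ?thesis using gh_rep_gt[OF q_ge_2 k(2)] by (simp only:) (intro *, simp)
  qed auto
  show "av (gh_d \<pi> q n) * av \<pi> ^ n \<le> 1"
  proof (cases "gh_d \<pi> q n = 0")
    case False
    then obtain k where k: "even k" "gh_rep q k n" "gh_d \<pi> q n = inverse \<pi> ^ (k div 2)"
      using gh_d_cases[OF q_ge_2] by blast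
    thus ?thesis using gh_rep_gt[OF q_ge_2 k(2)] by (simp only:) (intro *, simp)
  qed auto
qed

lemma gh_c_first: "av (gh_c \<pi> q (q + 1)) \<le> inverse (av \<pi>)"
proof (cases "gh_c \<pi> q (q + 1) = 0")
  case False
  then obtain k where k: "odd k" "gh_rep q k (q + 1)" "gh_c \<pi> q (q + 1) = inverse \<pi> ^ ((k + 1) div 2)"
    using gh_c_cases[OF q_ge_2] by (metis add_is_0 zero_neq_one)
  \<comment> \<open>Otherwise 1 + q + q^2 \<le> q + 1.\<close>
  have "k < 2"
  proof (rule ccontr)
    assume "\<not> k < 2"
    hence "(\<Sum>i\<in>{0,1,2}. q ^ i) \<le> (\<Sum>i\<le>k. q ^ i)" by (intro sum_mono2) auto
    also have "\<dots> \<le> q + 1" using gh_rep_ge[OF q_ge_2 k(2)] .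
    finally show False using q_ge_2 by simp
  qed
  hence "k = 1" using k(1) by (cases k) auto
  thus ?thesis using k(3) by (simp add: av_inverse)
qed (use av_pi_pos in simp)

end

text \<open>With r = t^q, the condition \<omega> \<le> t means r \<ge> |\<pi>|^(q/(q+1)), and the
  last equation for the radii balances the pair (1, q + 1). All conditions on N are upper bounds,
  which both evaluation and a Gauss norm satisfy.\<close>

locale torus_seminorm = local_field_setting p av K \<pi> q K2 \<sigma> \<zeta>
  for p :: nat and av :: "'c::{alg_closed_field, field_char_0} \<Rightarrow> real"
    and K :: "'c set" and \<pi> :: 'c and q :: nat
    and K2 :: "'c set" and \<sigma> :: "'c \<Rightarrow> 'c" and \<zeta> :: 'c +
  fixes a :: "nat \<Rightarrow> 'c poly" and N :: "'c poly \<Rightarrow> real" and t \<omega> \<rho> :: real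
  assumes coeffs: "torus_coeffs \<pi> q a"
    and N_nonneg: "0 \<le> N x"
    and N_add: "N (x + y) \<le> max (N x) (N y)"
    and N_mult: "N (x * y) \<le> N x * N y"
    and N_const: "N [:c:] \<le> av c"
    and N_E: "N [:0, 1:] \<le> 1" "N ([:0, 1:] ^ (q + 1) - 1) \<le> t ^ q"
    and radii: "\<omega> > 0" "\<omega> ^ (q + 1) = av \<pi>" "\<omega> \<le> t" "t \<le> 1" "\<rho> > 0" "\<rho> ^ (q + 1) * t ^ (q - 1) = av \<pi>"
begin

lemma t_pos: "t > 0" using radii(1,3) by linarith

lemma N_0 [simp]: "N 0 = 0"
  using N_const[of 0] N_nonneg[of 0] by simp

lemma N_1: "N 1 \<le> 1"
  using N_const[of 1] by (simp add: one_pCons)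

lemma N_minus: "N (- x) \<le> N x"
proof -
  have "N (- x) \<le> N [:-1:] * N x" using N_mult[of "[:-1:]" x] by simp
  also have "\<dots> \<le> 1 * N x" using N_const[of "-1"] by (intro mult_right_mono N_nonneg) simp
  finally show ?thesis by simp
qed

lemma N_diff_le: "N x \<le> c \<Longrightarrow> N y \<le> c \<Longrightarrow> N (x - y) \<le> c"
  using N_add[of x "- y"] N_minus[of y] by simp

lemma N_add_le: "N x \<le> c \<Longrightarrow> N y \<le> c \<Longrightarrow> N (x + y) \<le> c"
  using N_add[of x y] by simp

lemma N_sum_le: "(\<And>i. i \<in> S \<Longrightarrow> N (f i) \<le> c) \<Longrightarrow> 0 \<le> c \<Longrightarrow> N (sum f S) \<le> c"
  by (induction S rule: infinite_finite_induct) (auto intro: N_add_le)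

text \<open>A Gauss norm bound truncated below degree J: the estimate of h is proved by induction on
  J, and whatever is built from h is controlled to the same degree.\<close>

definition bdd :: "nat \<Rightarrow> real \<Rightarrow> 'c poly fps \<Rightarrow> bool"
  where "bdd J c f \<longleftrightarrow> (\<forall>i<J. N (f $ i) * \<rho> ^ i \<le> c)"

lemma bdd_mono: "bdd J c f \<Longrightarrow> c \<le> d \<Longrightarrow> bdd J d f"
  unfolding bdd_def by force

lemma bdd_iff: "bdd J c f \<longleftrightarrow> (\<forall>i<J. N (f $ i) \<le> c / \<rho> ^ i)"
  using radii(5) by (simp add: bdd_def field_simps)

lemma bdd_add: "bdd J c f \<Longrightarrow> bdd J c g \<Longrightarrow> bdd J c (f + g)"
  unfolding bdd_iff by (auto intro: N_add_le)

lemma bdd_diff: "bdd J c f \<Longrightarrow> bdd J c g \<Longrightarrow> bdd J c (f - g)"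
  unfolding bdd_iff by (auto intro: N_diff_le)

lemma bdd_mult:
  assumes "bdd J c f" "bdd J d g" "0 \<le> c" "0 \<le> d"
  shows "bdd J (c * d) (f * g)"
  unfolding bdd_iff
proof (intro allI impI)
  fix i assume i: "i < J"
  have "N (f $ k * g $ (i - k)) \<le> c * d / \<rho> ^ i" if "k \<in> {0..i}" for k
  proof -
    have "N (f $ k * g $ (i - k)) \<le> N (f $ k) * N (g $ (i - k))" by (rule N_mult)
    also have "\<dots> \<le> (c / \<rho> ^ k) * (d / \<rho> ^ (i - k))"
      using assms that i radii(5) unfolding bdd_iff by (intro mult_mono N_nonneg) auto
    also have "\<dots> = c * d / \<rho> ^ i" using that by (simp flip: power_add)
    finally show ?thesis .
  qed
  thus "N ((f * g) $ i) \<le> c * d / \<rho> ^ i"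
    unfolding fps_mult_nth using assms(3,4) radii(5) by (intro N_sum_le) auto
qed

lemma bdd_const: "N x \<le> c \<Longrightarrow> 0 \<le> c \<Longrightarrow> bdd J c (fps_const x)"
  unfolding bdd_def by simp

lemma bdd_power: "bdd J c f \<Longrightarrow> 0 \<le> c \<Longrightarrow> bdd J (c ^ n) (f ^ n)"
proof (induction n)
  case 0
  show ?case using bdd_const[OF N_1] by simp
qed (auto intro: bdd_mult)

lemma bdd_sum: "(\<And>i. i \<in> S \<Longrightarrow> bdd J c (f i)) \<Longrightarrow> 0 \<le> c \<Longrightarrow> bdd J c (sum f S)"
  unfolding bdd_iff using radii(5) by (auto simp: fps_sum_nth intro!: N_sum_le)

definition E :: "'c poly fps" where "E = fps_const [:0, 1:]"

definition At :: "'c poly fps" where "At = Abs_fps (\<lambda>n. a (Suc n))"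

definition h :: "'c poly fps" where "h = At - E"

lemma At_eq: "At = E + h"
  by (simp add: h_def)

lemma A_eq: "Abs_fps a = fps_X * At"
  using coeffs by (simp add: fps_eq_iff At_def torus_coeffs_def)

lemma bdd_E: "bdd J 1 E"
  unfolding E_def using N_E by (intro bdd_const) auto

context
  fixes J :: nat
  assumes h: "bdd J t h"
begin

lemma bdd_At: "bdd J 1 At"
  unfolding At_eq using h radii(4) by (intro bdd_add bdd_E) (rule bdd_mono)

lemma bdd_E_power: "bdd J 1 (E ^ l)"
  using bdd_power[OF bdd_E, of J l] by simp

lemma bdd_At_power_diff: "bdd J t (At ^ l - E ^ l)"
proof (induction l)
  case (Suc l)
  have "At ^ Suc l - E ^ Suc l = At * (At ^ l - E ^ l) + h * E ^ l"
    by (simp add: h_def algebra_simps)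
  moreover have "bdd J (1 * t) (At * (At ^ l - E ^ l))" "bdd J (t * 1) (h * E ^ l)"
    using t_pos by (intro bdd_mult bdd_At Suc h bdd_E_power; simp)+
  ultimately show ?case by (simp only: mult_1 mult_1_right bdd_add)
qed (use t_pos in \<open>simp add: bdd_def\<close>)

lemma bdd_E_power_diff: "bdd J (t ^ q) (E ^ ((q + 1) * k) - 1)"
proof (induction k)
  case (Suc k)
  have e: "E ^ (q + 1) - 1 = fps_const ([:0, 1:] ^ (q + 1) - 1)"
    by (simp only: E_def fps_const_power fps_const_1_eq_1[symmetric] fps_const_sub)
  have b: "bdd J (t ^ q) (E ^ (q + 1) - 1)"
    unfolding e using t_pos by (intro bdd_const N_E) simp
  have "E ^ ((q + 1) * Suc k) - 1 = E ^ (q + 1) * (E ^ ((q + 1) * k) - 1) + (E ^ (q + 1) - 1)"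
    by (simp add: power_add algebra_simps)
  moreover have "bdd J (1 * t ^ q) (E ^ (q + 1) * (E ^ ((q + 1) * k) - 1))"
    using t_pos by (intro bdd_mult bdd_E_power Suc) simp_all
  ultimately show ?case using b by (simp only: mult_1 bdd_add)
qed (use t_pos in \<open>simp add: bdd_def\<close>)

lemma t_power_q_le: "t ^ q \<le> t"
  using power_decreasing[of 1 q t] radii(4) t_pos q_ge_2 by simp

text \<open>By the congruences on l and m, E E^l and E^m differ by E times a difference of two
  powers of E^(q+1), both close to 1; replacing E by \<open>At\<close> costs at most t.\<close>

lemma bdd_bracket:
  assumes "q + 1 dvd l" "q + 1 dvd m - 1" "m > 0"
  shows "bdd J t (E * At ^ l - At ^ m)"
proof -
  obtain l' where l': "l = (q + 1) * l'" using assms(1) by blast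
  obtain m' where m': "m - 1 = (q + 1) * m'" using assms(2) by blast
  hence m': "m = Suc ((q + 1) * m')" using assms(3) by simp
  have "E * At ^ l - At ^ m = E * (At ^ l - E ^ l) - (At ^ m - E ^ m)
      + E * ((E ^ ((q + 1) * l') - 1) - (E ^ ((q + 1) * m') - 1))"
    unfolding l' m' by (simp add: algebra_simps)
  moreover have "bdd J (1 * t) (E * (At ^ l - E ^ l))"
    using t_pos by (intro bdd_mult bdd_E bdd_At_power_diff) simp_all
  moreover have "bdd J (1 * t) (E * ((E ^ ((q + 1) * l') - 1) - (E ^ ((q + 1) * m') - 1)))"
    using t_pos by (intro bdd_mult bdd_E bdd_diff bdd_mono[OF bdd_E_power_diff t_power_q_le]) simp_all
  ultimately show ?thesis by (simp only: mult_1 bdd_add bdd_diff bdd_At_power_diff)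
qed

text \<open>Here the gain from \<open>t\<close> to \<open>t ^ q\<close> comes from the Frobenius congruence
  \<open>(E + h) ^ q = E ^ q + h ^ q\<close> modulo \<open>p\<close>.\<close>

lemma bdd_bracket_first: "bdd J (t ^ q) (E * At ^ (q + 1) - At)"
proof -
  \<comment> \<open>The inner binomial coefficients have size at most |\<pi>| = \<omega>^(q+1), and
    \<omega> \<le> t \<le> 1.\<close>
  have av_pi_le: "av \<pi> \<le> t ^ q"
  proof -
    have "av \<pi> \<le> t ^ (q + 1)" unfolding radii(2)[symmetric] using radii(1,3) by (intro power_mono) auto
    also have "\<dots> \<le> t ^ q" using radii(4) t_pos by (intro power_decreasing) auto
    finally show ?thesis .
  qed
  have "At ^ q - E ^ q = (\<Sum>k\<le>q. of_nat (q choose k) * h ^ k * E ^ (q - k)) - E ^ q"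
    unfolding At_eq by (subst add.commute) (simp add: binomial_ring)
  also have "\<dots> = (\<Sum>k\<in>{..q} - {0}. of_nat (q choose k) * h ^ k * E ^ (q - k))"
    by (subst sum.remove[of _ 0]) auto
  finally have 1: "At ^ q - E ^ q = \<dots>" .
  have "bdd J (t ^ q) (At ^ q - E ^ q)"
    unfolding 1
  proof (rule bdd_sum)
    fix k assume k: "k \<in> {..q} - {0}"
    show "bdd J (t ^ q) (of_nat (q choose k) * h ^ k * E ^ (q - k))"
    proof (cases "k = q")
      case True
      thus ?thesis using bdd_power[OF h, of q] t_pos by simp
    next
      case False
      have e: "(of_nat (q choose k) :: 'c poly fps) = fps_const [:of_nat (q choose k):]"
        by (simp add: fps_of_nat[symmetric] of_nat_poly)
      have "N [:of_nat (q choose k):] \<le> t ^ q"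
        using N_const[of "of_nat (q choose k)"] av_binomial_le[of k] k False av_pi_le by simp
      hence "bdd J (t ^ q) (of_nat (q choose k))" unfolding e using t_pos by (intro bdd_const) auto
      moreover have "bdd J 1 (h ^ k)" using bdd_power[OF bdd_mono[OF h radii(4)], of k] by simp
      ultimately have "bdd J (t ^ q * 1 * 1) (of_nat (q choose k) * h ^ k * E ^ (q - k))"
        using t_pos by (intro bdd_mult bdd_E_power) auto
      thus ?thesis by simp
    qed
  qed (use t_pos in simp)
  hence 2: "bdd J (1 * t ^ q) (E * (At ^ q - E ^ q))" using t_pos by (intro bdd_mult bdd_E) auto
  \<comment> \<open>Splitting off the factor \<open>At\<close> leaves a q-th power, to which the
    congruence applies; the rest is the hypothesis on E^(q+1) - 1.\<close>
  have "E * At ^ (q + 1) - At = At * (E * (At ^ q - E ^ q) + (E ^ ((q + 1) * 1) - 1))"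
    by (simp add: algebra_simps)
  moreover have "bdd J (1 * t ^ q) (At * (E * (At ^ q - E ^ q) + (E ^ ((q + 1) * 1) - 1)))"
    using 2 t_pos by (intro bdd_mult bdd_At bdd_add bdd_E_power_diff) auto
  ultimately show ?thesis by simp
qed

end

text \<open>\<rho>^(q+1) = |\<pi>| / t^(q-1) is largest at the smallest admissible t, namely
  \<omega>, where it equals \<omega>^(q+1-(q-1)).\<close>

lemma rho_power_le: "\<rho> ^ (q + 1) \<le> \<omega> ^ 2"
proof -
  have "\<rho> ^ (q + 1) * \<omega> ^ (q - 1) \<le> \<rho> ^ (q + 1) * t ^ (q - 1)"
    using radii by (intro mult_left_mono power_mono) auto
  also have "\<dots> = \<omega> ^ 2 * \<omega> ^ (q - 1)" using radii(2,6) q_ge_2 by (simp flip: power_add)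
  finally show ?thesis using radii(1) by simp
qed

lemma omega_le_1: "\<omega> \<le> 1"
  using radii by linarith

text \<open>Bookkeeping in powers of \<omega>: the denominator \<pi>^j costs (q + 1) j, the monomial
  u^n gains at least 2 k, and i is the surplus.\<close>

lemma weight:
  assumes "av c = inverse (av \<pi>) ^ j" "n = (q + 1) * k" "(q + 1) * j + i \<le> 2 * k"
  shows "av c * \<rho> ^ n \<le> \<omega> ^ i"
proof -
  have "\<rho> ^ n = (\<rho> ^ (q + 1)) ^ k" unfolding assms(2) by (rule power_mult)
  also have "\<dots> \<le> (\<omega> ^ 2) ^ k" using rho_power_le radii(5) by (intro power_mono) auto
  also have "\<dots> = \<omega> ^ (2 * k)" by (simp add: power_mult)
  also have "\<dots> \<le> \<omega> ^ ((q + 1) * j + i)"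
    using assms(3) radii(1) omega_le_1 by (intro power_decreasing) auto
  also have "\<dots> = av \<pi> ^ j * \<omega> ^ i"
    unfolding radii(2)[symmetric] power_mult[symmetric] by (rule power_add)
  finally show ?thesis
    unfolding assms(1) using av_pi_pos by (simp add: power_inverse field_simps)
qed

lemma c_weight: "l \<noteq> q + 1 \<Longrightarrow> av (gh_c \<pi> q l) * \<rho> ^ l \<le> 1"
proof -
  assume l: "l \<noteq> q + 1"
  show ?thesis
  proof (cases "gh_c \<pi> q l = 0 \<or> l = 0")
    case False
    then obtain j where j: "gh_c \<pi> q l = inverse \<pi> ^ j" "(q + 1) ^ 2 * j \<le> 2 * l"
      using gh_c_estimate[OF q_ge_2, of \<pi> l] l by blast
    obtain k where k: "l = (q + 1) * k" using gh_c_cong[OF q_ge_2, of \<pi> l] False by blast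
    have "(q + 1) * ((q + 1) * j) \<le> (q + 1) * (2 * k)"
      using j(2) unfolding k by (simp add: power2_eq_square algebra_simps)
    hence "(q + 1) * j \<le> 2 * k" by (rule mult_left_le_imp_le) simp
    hence "(q + 1) * j + 0 \<le> 2 * k" by simp
    thus ?thesis using weight[OF _ k, of "gh_c \<pi> q l" j 0] j(1) by (simp add: av_power av_inverse)
  qed auto
qed

lemma c_weight_first: "av (gh_c \<pi> q (q + 1)) * \<rho> ^ (q + 1) * t ^ (q - 1) \<le> 1"
proof -
  have "av (gh_c \<pi> q (q + 1)) * (\<rho> ^ (q + 1) * t ^ (q - 1)) \<le> inverse (av \<pi>) * av \<pi>"
    unfolding radii(6) using gh_c_first av_pi_pos by (intro mult_right_mono) auto
  thus ?thesis using av_pi_pos by (simp add: mult.assoc)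
qed

lemma d_weight:
  assumes "m \<noteq> 1"
  shows "av (gh_d \<pi> q m) * \<rho> ^ (m - 1) \<le> t ^ (q - 1)"
proof (cases "gh_d \<pi> q m = 0")
  case True
  then show ?thesis using t_pos by simp
next
  case False
  then obtain j where j: "gh_d \<pi> q m = inverse \<pi> ^ j" "(q + 1) ^ 2 * j + (q ^ 2 - 1) \<le> 2 * (m - 1)"
    using gh_d_estimate[OF q_ge_2, of \<pi> m] assms by blast
  obtain k where k: "m - 1 = (q + 1) * k" using gh_d_cong(1)[OF q_ge_2 False] by blast
  have "q ^ 2 - 1 = (q + 1) * (q - 1)" by (simp add: power2_eq_square algebra_simps)
  hence "(q + 1) * ((q + 1) * j + (q - 1)) \<le> (q + 1) * (2 * k)"
    using j(2) unfolding k by (simp add: power2_eq_square distrib_left mult_ac)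
  hence "(q + 1) * j + (q - 1) \<le> 2 * k" by (rule mult_left_le_imp_le) simp
  hence "av (gh_d \<pi> q m) * \<rho> ^ (m - 1) \<le> \<omega> ^ (q - 1)"
    using weight[OF _ k, of "gh_d \<pi> q m" j "q - 1"] j(1) by (simp add: av_power av_inverse)
  also have "\<dots> \<le> t ^ (q - 1)" using radii by (intro power_mono) auto
  finally show ?thesis .
qed

text \<open>Coefficient j + 1 of the functional equation. The pair (1, 0) contributes E -
  \<open>At\<close> = -h, since its weight is 1, and moving it to the other side solves for
  coefficient j of h. A pair (m, l) starts at u^(m+l), so both indices may be cut at j + 1.\<close>

lemma coeff_recursion:
  "h $ j = (\<Sum>(m, l)\<in>{..j + 1} \<times> {..j + 1} - {(1, 0)}.
    [:gh_d \<pi> q m * gh_c \<pi> q l:] * (if m + l \<le> j + 1 then (E * At ^ l - At ^ m) $ (j + 1 - (m + l)) else 0))"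
proof -
  let ?n = "j + 1"
  define T where "T m l = [:gh_d \<pi> q m * gh_c \<pi> q l:] *
    (if m + l \<le> ?n then (E * At ^ l - At ^ m) $ (?n - (m + l)) else 0)" for m l
  define \<phi>0 where "\<phi>0 = Abs_fps (\<lambda>n. [:gh_c \<pi> q n:])"
  define \<phi>1 where "\<phi>1 = Abs_fps (\<lambda>n. [:gh_d \<pi> q n:])"
  define A where "A = Abs_fps a"
  have A0: "A $ 0 = 0" and eq: "E * \<phi>1 * (\<phi>0 oo A) = \<phi>0 * (\<phi>1 oo A)"
    using coeffs unfolding torus_coeffs_def Let_def A_def \<phi>0_def \<phi>1_def E_def by simp_all
  have T: "T m l = [:0, 1:] * (\<phi>1 $ m * \<phi>0 $ l * (fps_X ^ m * A ^ l) $ ?n) - \<phi>0 $ l * \<phi>1 $ m * (fps_X ^ l * A ^ m) $ ?n" for m l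
  proof -
    have X: "(fps_X ^ i * A ^ k) $ ?n = (if ?n < i + k then 0 else At ^ k $ (?n - (i + k)))" for i k
    proof -
      have "fps_X ^ i * A ^ k = fps_X ^ (i + k) * At ^ k"
        unfolding A_def A_eq by (simp add: power_mult_distrib power_add mult.assoc)
      thus ?thesis by (simp only: fps_X_power_mult_nth)
    qed
    have "\<phi>1 $ m * \<phi>0 $ l = [:gh_d \<pi> q m * gh_c \<pi> q l:]" "\<phi>0 $ l * \<phi>1 $ m = [:gh_d \<pi> q m * gh_c \<pi> q l:]"
      by (simp_all add: \<phi>0_def \<phi>1_def)
    then show ?thesis
      unfolding T_def X E_def
      by (simp add: not_le add.commute[of l m] right_diff_distrib mult_ac
          del: mult_pCons_left mult_pCons_right)
  qed
  have "(E * (\<phi>1 * (\<phi>0 oo A)) - \<phi>0 * (\<phi>1 oo A)) $ ?n = 0"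
    using eq by (simp add: mult.assoc)
  hence "[:0, 1:] * (\<phi>1 * (\<phi>0 oo A)) $ ?n - (\<phi>0 * (\<phi>1 oo A)) $ ?n = 0"
    by (simp only: E_def fps_sub_nth fps_mult_left_const_nth)
  hence "(\<Sum>m\<le>?n. \<Sum>l\<le>?n. [:0, 1:] * (\<phi>1 $ m * \<phi>0 $ l * (fps_X ^ m * A ^ l) $ ?n)) -
      (\<Sum>l\<le>?n. \<Sum>m\<le>?n. \<phi>0 $ l * \<phi>1 $ m * (fps_X ^ l * A ^ m) $ ?n) = 0"
    by (simp only: fps_mult_compose_nth[OF A0] sum_distrib_left)
  also have "(\<Sum>l\<le>?n. \<Sum>m\<le>?n. \<phi>0 $ l * \<phi>1 $ m * (fps_X ^ l * A ^ m) $ ?n) =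
      (\<Sum>m\<le>?n. \<Sum>l\<le>?n. \<phi>0 $ l * \<phi>1 $ m * (fps_X ^ l * A ^ m) $ ?n)"
    by (rule sum.swap)
  finally have "(\<Sum>m\<le>?n. \<Sum>l\<le>?n. T m l) = 0" unfolding T by (simp only: sum_subtractf)
  hence "(\<Sum>(m, l)\<in>{..?n} \<times> {..?n}. T m l) = 0" by (simp only: sum.cartesian_product)
  moreover have "(\<Sum>(m, l)\<in>{..?n} \<times> {..?n}. T m l) =
      T 1 0 + (\<Sum>(m, l)\<in>{..?n} \<times> {..?n} - {(1, 0)}. T m l)"
    by (subst sum.remove[of _ "(1, 0)"]) auto
  moreover have "T 1 0 = - (h $ j)"
    unfolding T_def h_def E_def using q_ge_2 by (simp add: gh_d_1 one_pCons[symmetric])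
  ultimately have "h $ j = (\<Sum>(m, l)\<in>{..?n} \<times> {..?n} - {(1, 0)}. T m l)" by simp
  thus ?thesis unfolding T_def .
qed

lemma bdd_h: "bdd J t h"
proof (induction J)
  case (Suc j)
  have "N (h $ j) \<le> t / \<rho> ^ j"
    unfolding coeff_recursion[of j]
  proof (rule N_sum_le)
    show "0 \<le> t / \<rho> ^ j" using t_pos radii(5) by simp
    fix ml assume "ml \<in> {..j + 1} \<times> {..j + 1} - {(1, 0)}"
    then obtain m l where ml: "ml = (m, l)" "(m, l) \<noteq> (1, 0)" by (cases ml) auto
    let ?b = "E * At ^ l - At ^ m" and ?i = "j + 1 - (m + l)"
    let ?w = "av (gh_d \<pi> q m) * av (gh_c \<pi> q l)"
    have "N ([:gh_d \<pi> q m * gh_c \<pi> q l:] * (if m + l \<le> j + 1 then ?b $ ?i else 0)) \<le> t / \<rho> ^ j"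
    proof (cases "gh_d \<pi> q m = 0 \<or> gh_c \<pi> q l = 0 \<or> \<not> m + l \<le> j + 1")
      case True
      thus ?thesis using t_pos radii(5) by auto
    next
      case False
      have m: "q + 1 dvd m - 1" "m > 0" using gh_d_cong[OF q_ge_2, of \<pi> m] False by auto
      have l: "q + 1 dvd l" using gh_c_cong[OF q_ge_2, of \<pi> l] False by auto
      \<comment> \<open>A nonzero coefficient of \<phi>1 has m \<ge> 1, so excluding (1, 0) gives m
        + l \<ge> 2: the bracket is needed only below degree j, where the induction hypothesis
        bounds it.\<close>
      have i: "?i < j" "j = ?i + ((m - 1) + l)" using ml(2) m(2) False by (cases "m = 1"; auto)+
      have key: "?w * \<rho> ^ ((m - 1) + l) * (N (?b $ ?i) * \<rho> ^ ?i) \<le> t"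
      proof (cases "m = 1 \<and> l = q + 1")
        case True
        have "bdd j (t ^ q) ?b" using bdd_bracket_first[OF Suc] True by simp
        hence "N (?b $ ?i) * \<rho> ^ ?i \<le> t ^ q" using i(1) unfolding bdd_def by blast
        hence "?w * \<rho> ^ ((m - 1) + l) * (N (?b $ ?i) * \<rho> ^ ?i) \<le> ?w * \<rho> ^ ((m - 1) + l) * t ^ q"
          using radii(5) by (intro mult_left_mono mult_nonneg_nonneg av_nonneg) auto
        also have "\<dots> = (av (gh_c \<pi> q (q + 1)) * \<rho> ^ (q + 1) * t ^ (q - 1)) * t"
          using True q_ge_2 by (simp add: gh_d_1 flip: power_Suc2)
        also have "\<dots> \<le> 1 * t" using c_weight_first t_pos by (intro mult_right_mono) auto
        finally show ?thesis by simp
      next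
        case F: False
        have "bdd j t ?b" using bdd_bracket[OF Suc l m] .
        hence b: "N (?b $ ?i) * \<rho> ^ ?i \<le> t" using i(1) unfolding bdd_def by blast
        have "?w * \<rho> ^ ((m - 1) + l) = (av (gh_d \<pi> q m) * \<rho> ^ (m - 1)) * (av (gh_c \<pi> q l) * \<rho> ^ l)"
          by (simp add: power_add)
        also have "\<dots> \<le> 1"
        proof (cases "m = 1")
          case True
          thus ?thesis using c_weight[of l] F q_ge_2 by (simp add: gh_d_1)
        next
          case m1: False
          have t1: "t ^ (q - 1) \<le> 1" using t_pos radii(4) by (simp add: power_le_one)
          \<comment> \<open>For l = q + 1 the factor of \<phi>0 alone may exceed 1. The gain t^(q-1)
            from \<open>d_weight\<close>, available for m \<noteq> 1, compensates it.\<close>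
          have "av (gh_c \<pi> q l) * \<rho> ^ l * t ^ (q - 1) \<le> 1"
          proof (cases "l = q + 1")
            case True
            thus ?thesis using c_weight_first by simp
          next
            case False
            have "av (gh_c \<pi> q l) * \<rho> ^ l * t ^ (q - 1) \<le> 1 * 1"
              using c_weight[OF False] t1 t_pos by (intro mult_mono) auto
            thus ?thesis by simp
          qed
          moreover have "(av (gh_d \<pi> q m) * \<rho> ^ (m - 1)) * (av (gh_c \<pi> q l) * \<rho> ^ l) \<le>
              t ^ (q - 1) * (av (gh_c \<pi> q l) * \<rho> ^ l)"
            using d_weight[OF m1] radii(5) by (intro mult_right_mono mult_nonneg_nonneg av_nonneg) auto
          ultimately show ?thesis by (simp add: mult_ac)
        qed
        finally have "?w * \<rho> ^ ((m - 1) + l) * (N (?b $ ?i) * \<rho> ^ ?i) \<le> 1 * t"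
          using b radii(5) by (intro mult_mono mult_nonneg_nonneg N_nonneg) auto
        thus ?thesis by simp
      qed
      have "N ([:gh_d \<pi> q m * gh_c \<pi> q l:] * ?b $ ?i) \<le> N [:gh_d \<pi> q m * gh_c \<pi> q l:] * N (?b $ ?i)"
        by (rule N_mult)
      also have "\<dots> \<le> ?w * N (?b $ ?i)"
        using N_const[of "gh_d \<pi> q m * gh_c \<pi> q l"] by (intro mult_right_mono N_nonneg) (simp add: av_mult)
      finally have "N ([:gh_d \<pi> q m * gh_c \<pi> q l:] * ?b $ ?i) * \<rho> ^ j \<le> ?w * N (?b $ ?i) * \<rho> ^ j"
        using radii(5) by (intro mult_right_mono) auto
      also have "\<dots> = ?w * \<rho> ^ ((m - 1) + l) * (N (?b $ ?i) * \<rho> ^ ?i)"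
      proof -
        have "\<rho> ^ j = \<rho> ^ ?i * \<rho> ^ ((m - 1) + l)" using i(2) by (metis power_add)
        thus ?thesis by simp
      qed
      also note key
      finally have "N ([:gh_d \<pi> q m * gh_c \<pi> q l:] * ?b $ ?i) * \<rho> ^ j \<le> t" .
      thus ?thesis using False radii(5) by (simp add: field_simps)
    qed
    thus "N (case ml of (m, l) \<Rightarrow> [:gh_d \<pi> q m * gh_c \<pi> q l:] *
        (if m + l \<le> j + 1 then (E * At ^ l - At ^ m) $ (j + 1 - (m + l)) else 0)) \<le> t / \<rho> ^ j"
      unfolding ml(1) by simp
  qed
  thus ?case using Suc unfolding bdd_iff by (auto simp: less_Suc_eq)
qed (simp add: bdd_def)

lemma coefficient_bound: "N (a (Suc n)) * \<rho> ^ n \<le> 1"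
  using bdd_At[OF bdd_h, of "Suc n"] unfolding bdd_def At_def by simp

end

section \<open>The formal functional equation\<close>

lemma fps_power_nth_cong:
  fixes f g :: "'a::comm_ring_1 fps"
  assumes "\<And>i. i \<le> m \<Longrightarrow> f $ i = g $ i" "i \<le> m"
  shows "(f ^ l) $ i = (g ^ l) $ i"
  using assms(2)
proof (induction l arbitrary: i)
  case (Suc l)
  have "(f ^ Suc l) $ i = (\<Sum>j=0..i. f $ j * (f ^ l) $ (i - j))" by (simp add: fps_mult_nth)
  also have "\<dots> = (\<Sum>j=0..i. g $ j * (g ^ l) $ (i - j))"
    using Suc by (intro sum.cong refl) (simp add: assms(1))
  also have "\<dots> = (g ^ Suc l) $ i" by (simp add: fps_mult_nth)
  finally show ?case .
qed simp

lemma fps_compose_nth_cong: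
  fixes f A B :: "'a::comm_ring_1 fps"
  assumes "\<And>i. i \<le> n \<Longrightarrow> A $ i = B $ i"
  shows "(f oo A) $ n = (f oo B) $ n"
  unfolding fps_compose_nth
  by (intro sum.cong refl) (simp add: fps_power_nth_cong[OF assms])

text \<open>Without constant term, coefficient n of A^l for l \<ge> 2 involves only coefficients of
  A below n; the top coefficient enters through l = 1 alone.\<close>

lemma fps_compose_nth_diff:
  fixes f A B :: "'a::comm_ring_1 fps"
  assumes "A $ 0 = 0" "B $ 0 = 0" "\<And>i. i < n \<Longrightarrow> A $ i = B $ i" "n > 0"
  shows "(f oo A) $ n - (f oo B) $ n = f $ 1 * (A $ n - B $ n)"
proof -
  have high: "(A ^ l) $ n = (B ^ l) $ n" if "l \<noteq> 1" for l
  proof (cases "l = 0 \<or> l > n")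
    case True
    then show ?thesis using assms(1,2) by (auto simp: startsby_zero_power_prefix)
  next
    case False
    have shift: "(C ^ l) $ n = (Abs_fps (\<lambda>i. C $ Suc i) ^ l) $ (n - l)" if "C $ 0 = 0" for C :: "'a fps"
    proof -
      have "C = fps_X * Abs_fps (\<lambda>i. C $ Suc i)" using that by (simp add: fps_eq_iff)
      hence "C ^ l = fps_X ^ l * Abs_fps (\<lambda>i. C $ Suc i) ^ l" by (metis power_mult_distrib)
      thus ?thesis using False by (simp add: fps_X_power_mult_nth)
    qed
    have agree: "Abs_fps (\<lambda>i. A $ Suc i) $ i = Abs_fps (\<lambda>i. B $ Suc i) $ i" if "i \<le> n - l" for i
    proof -
      have "Suc i < n" using that False \<open>l \<noteq> 1\<close> by linarith
      thus ?thesis by (simp add: assms(3))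
    qed
    have "(Abs_fps (\<lambda>i. A $ Suc i) ^ l) $ (n - l) = (Abs_fps (\<lambda>i. B $ Suc i) ^ l) $ (n - l)"
      by (rule fps_power_nth_cong[of "n - l"]) (use agree in auto)
    thus ?thesis by (simp only: shift[OF assms(1)] shift[OF assms(2)])
  qed
  have "(f oo A) $ n - (f oo B) $ n = (\<Sum>l=0..n. f $ l * ((A ^ l) $ n - (B ^ l) $ n))"
    by (simp add: fps_compose_nth sum_subtractf right_diff_distrib)
  also have "\<dots> = (\<Sum>l\<in>{1}. f $ l * ((A ^ l) $ n - (B ^ l) $ n))"
    using high assms(4) by (intro sum.mono_neutral_right) auto
  finally show ?thesis by simp
qed

text \<open>Cross-multiplied form of the equation saying that A lifts [x0 : x1] \<mapsto>
  [x0 : c x1] through the period map.\<close>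

definition period_defect :: "'a::comm_ring_1 \<Rightarrow> 'a fps \<Rightarrow> 'a fps \<Rightarrow> 'a fps \<Rightarrow> 'a fps"
  where "period_defect c \<phi>0 \<phi>1 A = fps_const c * \<phi>1 * (\<phi>0 oo A) - \<phi>0 * (\<phi>1 oo A)"

text \<open>Coefficient n of the defect is -A_n plus an expression in lower coefficients of A.
  Uniqueness of A and membership of its coefficients in a subring both follow by induction.\<close>

lemma period_defect_nth_diff:
  fixes A B :: "'a::comm_ring_1 fps"
  assumes "\<phi>0 $ 0 = 1" "\<phi>1 $ 0 = 0" "\<phi>1 $ 1 = 1" "A $ 0 = 0" "B $ 0 = 0"
    and "\<And>i. i < n \<Longrightarrow> A $ i = B $ i" "n > 0"
  shows "period_defect c \<phi>0 \<phi>1 A $ n - period_defect c \<phi>0 \<phi>1 B $ n = B $ n - A $ n"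
proof -
  have mult: "(g * (f oo A)) $ n - (g * (f oo B)) $ n = g $ 0 * ((f oo A) $ n - (f oo B) $ n)" for f g :: "'a fps"
  proof -
    have "(g * (f oo A)) $ n - (g * (f oo B)) $ n = (\<Sum>i=0..n. g $ i * ((f oo A) $ (n - i) - (f oo B) $ (n - i)))"
      by (simp add: fps_mult_nth sum_subtractf right_diff_distrib)
    also have "\<dots> = (\<Sum>i\<in>{0}. g $ i * ((f oo A) $ (n - i) - (f oo B) $ (n - i)))"
    proof (rule sum.mono_neutral_right)
      show "\<forall>i\<in>{0..n} - {0}. g $ i * ((f oo A) $ (n - i) - (f oo B) $ (n - i)) = 0"
      proof
        fix i assume "i \<in> {0..n} - {0}"
        hence "(f oo A) $ (n - i) = (f oo B) $ (n - i)"
          by (intro fps_compose_nth_cong assms(6)) auto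
        thus "g $ i * ((f oo A) $ (n - i) - (f oo B) $ (n - i)) = 0" by simp
      qed
    qed auto
    finally show ?thesis by simp
  qed
  have "period_defect c \<phi>0 \<phi>1 A $ n - period_defect c \<phi>0 \<phi>1 B $ n =
      ((fps_const c * \<phi>1 * (\<phi>0 oo A)) $ n - (fps_const c * \<phi>1 * (\<phi>0 oo B)) $ n) -
      ((\<phi>0 * (\<phi>1 oo A)) $ n - (\<phi>0 * (\<phi>1 oo B)) $ n)"
    by (simp add: period_defect_def)
  also have "\<dots> = B $ n - A $ n"
    unfolding mult using assms by (simp add: fps_compose_nth_diff)
  finally show ?thesis .
qed

lemma period_defect_unique:
  fixes A B :: "'a::comm_ring_1 fps"
  assumes "\<phi>0 $ 0 = 1" "\<phi>1 $ 0 = 0" "\<phi>1 $ 1 = 1" "A $ 0 = 0" "B $ 0 = 0"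
    and "period_defect c \<phi>0 \<phi>1 A = 0" "period_defect c \<phi>0 \<phi>1 B = 0"
  shows "A = B"
proof -
  have "A $ n = B $ n" for n
  proof (induction n rule: less_induct)
    case (less n)
    show ?case
    proof (cases "n = 0")
      case False
      with period_defect_nth_diff[OF assms(1-5) less, of n c] show ?thesis
        by (simp add: assms(6,7))
    qed (simp add: assms)
  qed
  thus ?thesis by (simp add: fps_eq_iff)
qed

lemma period_defect_mem:
  fixes A :: "'a::comm_ring_1 fps"
  assumes phi: "\<phi>0 $ 0 = 1" "\<phi>1 $ 0 = 0" "\<phi>1 $ 1 = 1" "A $ 0 = 0" "period_defect c \<phi>0 \<phi>1 A = 0"
    and S: "0 \<in> S" "1 \<in> S" "\<And>x y. x \<in> S \<Longrightarrow> y \<in> S \<Longrightarrow> x - y \<in> S"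
      "\<And>x y. x \<in> S \<Longrightarrow> y \<in> S \<Longrightarrow> x * y \<in> S"
    and mem: "c \<in> S" "\<And>n. \<phi>0 $ n \<in> S" "\<And>n. \<phi>1 $ n \<in> S"
  shows "A $ n \<in> S"
proof (induction n rule: less_induct)
  case (less n)
  show ?case
  proof (cases "n = 0")
    case False
    \<comment> \<open>The truncation has coefficients in S by induction, and coefficient n of its
      defect is exactly A_n.\<close>
    define B where "B = Abs_fps (\<lambda>i. if i < n then A $ i else 0)"
    have minus: "- x \<in> S" if "x \<in> S" for x using S(3)[OF S(1) that] by simp
    have add: "x + y \<in> S" if "x \<in> S" "y \<in> S" for x y using S(3)[OF that(1) minus[OF that(2)]] by simp
    have sum: "sum f I \<in> S" if "\<And>i. i \<in> I \<Longrightarrow> f i \<in> S" for f :: "nat \<Rightarrow> 'a" and I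
      using that by (induction I rule: infinite_finite_induct) (auto intro: S(1) add)
    have mult: "(f * g) $ m \<in> S" if "\<And>i. f $ i \<in> S" "\<And>i. g $ i \<in> S" for f g m
      unfolding fps_mult_nth by (intro sum S(4) that)
    have const: "fps_const x $ m \<in> S" if "x \<in> S" for x m using that S(1) by simp
    have power: "(f ^ l) $ m \<in> S" if "\<And>i. f $ i \<in> S" for f l m
      by (induction l arbitrary: m) (auto intro!: mult that S(1,2))
    have comp: "(f oo B) $ m \<in> S" if "\<And>i. f $ i \<in> S" for f m
      unfolding fps_compose_nth
      by (intro sum S(4) that power) (auto simp: B_def S(1) less)
    have "period_defect c \<phi>0 \<phi>1 B $ n \<in> S"
      unfolding period_defect_def fps_sub_nth by (intro S(3) mult comp const mem)
    moreover have "period_defect c \<phi>0 \<phi>1 A $ n - period_defect c \<phi>0 \<phi>1 B $ n = B $ n - A $ n"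
      using phi False by (intro period_defect_nth_diff) (auto simp: B_def)
    ultimately show ?thesis using phi(5) by (simp add: B_def)
  qed (simp add: phi S)
qed

text \<open>Substituting B into the equation for A and using the equation for B gives the desired
  identity multiplied by \<phi>0 oo B. This series has constant term 1 and cancels in a
  domain.\<close>

lemma period_defect_compose:
  fixes A B :: "'a::idom fps"
  assumes "\<phi>0 $ 0 = 1" "A $ 0 = 0" "B $ 0 = 0" "period_defect c \<phi>0 \<phi>1 A = 0" "period_defect d \<phi>0 \<phi>1 B = 0"
  shows "period_defect (c * d) \<phi>0 \<phi>1 (A oo B) = 0"
proof -
  have A: "fps_const c * \<phi>1 * (\<phi>0 oo A) = \<phi>0 * (\<phi>1 oo A)"
    and B: "fps_const d * \<phi>1 * (\<phi>0 oo B) = \<phi>0 * (\<phi>1 oo B)"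
    using assms(4,5) by (simp_all add: period_defect_def)
  have "(fps_const c * \<phi>1 * (\<phi>0 oo A)) oo B = (\<phi>0 * (\<phi>1 oo A)) oo B" using A by simp
  hence AB: "fps_const c * (\<phi>1 oo B) * (\<phi>0 oo (A oo B)) = (\<phi>0 oo B) * (\<phi>1 oo (A oo B))"
    using assms(2,3) by (simp add: fps_compose_mult_distrib fps_compose_assoc)
  have "(\<phi>0 oo B) * (fps_const (c * d) * \<phi>1 * (\<phi>0 oo (A oo B))) =
      fps_const c * (fps_const d * \<phi>1 * (\<phi>0 oo B)) * (\<phi>0 oo (A oo B))"
    by (simp add: fps_const_mult[symmetric] mult_ac del: fps_const_mult)
  also have "\<dots> = \<phi>0 * (fps_const c * (\<phi>1 oo B) * (\<phi>0 oo (A oo B)))"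
    unfolding B by (simp add: mult_ac)
  also have "\<dots> = (\<phi>0 oo B) * (\<phi>0 * (\<phi>1 oo (A oo B)))"
    unfolding AB by (simp add: mult_ac)
  finally have cancel: "(\<phi>0 oo B) * (fps_const (c * d) * \<phi>1 * (\<phi>0 oo (A oo B))) =
      (\<phi>0 oo B) * (\<phi>0 * (\<phi>1 oo (A oo B)))" .
  have "(\<phi>0 oo B) $ 0 = 1" using assms(1) by simp
  hence "\<phi>0 oo B \<noteq> 0" by (metis fps_zero_nth zero_neq_one)
  thus ?thesis unfolding period_defect_def using mult_left_cancel[THEN iffD1, OF _ cancel] by simp
qed

lemma period_defect_fps_X: "period_defect 1 \<phi>0 \<phi>1 fps_X = 0"
  by (simp add: period_defect_def mult.commute)

definition eval_coeffs :: "'a::comm_ring_1 \<Rightarrow> 'a poly fps \<Rightarrow> 'a fps"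
  where "eval_coeffs e f = Abs_fps (\<lambda>n. poly (f $ n) e)"

lemma eval_coeffs_nth [simp]: "eval_coeffs e f $ n = poly (f $ n) e"
  by (simp add: eval_coeffs_def)

lemma eval_coeffs_mult: "eval_coeffs e (f * g) = eval_coeffs e f * eval_coeffs e g"
  by (simp add: fps_eq_iff fps_mult_nth poly_sum)

lemma eval_coeffs_power: "eval_coeffs e (f ^ n) = eval_coeffs e f ^ n"
  by (induction n) (simp_all add: eval_coeffs_mult, simp add: fps_eq_iff)

lemma eval_coeffs_compose: "eval_coeffs e (f oo g) = eval_coeffs e f oo eval_coeffs e g"
  by (simp add: fps_eq_iff fps_compose_nth poly_sum flip: eval_coeffs_power)

lemma eval_coeffs_period_defect:
  "eval_coeffs e (period_defect c \<phi>0 \<phi>1 A) =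
    period_defect (poly c e) (eval_coeffs e \<phi>0) (eval_coeffs e \<phi>1) (eval_coeffs e A)"
proof -
  have "eval_coeffs e (f - g) = eval_coeffs e f - eval_coeffs e g" for f g
    by (simp add: fps_eq_iff)
  moreover have "eval_coeffs e (fps_const c) = fps_const (poly c e)" by (simp add: fps_eq_iff)
  ultimately show ?thesis
    by (simp add: period_defect_def eval_coeffs_mult eval_coeffs_compose)
qed

section \<open>The torus series at a value of E: uniqueness, composition and bounds\<close>

context local_field_setting
begin

definition torus_fps :: "(nat \<Rightarrow> 'c poly) \<Rightarrow> 'c \<Rightarrow> 'c fps"
  where "torus_fps a e = Abs_fps (\<lambda>n. poly (a n) e)"

abbreviation "\<phi>0 \<equiv> Abs_fps (gh_c \<pi> q)"
abbreviation "\<phi>1 \<equiv> Abs_fps (gh_d \<pi> q)"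

lemma phi_low: "\<phi>0 $ 0 = 1" "\<phi>1 $ 0 = 0" "\<phi>1 $ 1 = 1"
  using q_ge_2 by (simp_all add: gh_d_1)

lemma torus_coeffs_period_defect:
  assumes "torus_coeffs \<pi> q a"
  shows "period_defect [:0, 1:] (Abs_fps (\<lambda>n. [:gh_c \<pi> q n:])) (Abs_fps (\<lambda>n. [:gh_d \<pi> q n:])) (Abs_fps a) = 0"
  using assms by (simp add: torus_coeffs_def Let_def period_defect_def)

lemma torus_fps_0: "torus_coeffs \<pi> q a \<Longrightarrow> torus_fps a e $ 0 = 0"
  by (simp add: torus_fps_def torus_coeffs_def)

lemma torus_fps_defect:
  assumes "torus_coeffs \<pi> q a"
  shows "period_defect e \<phi>0 \<phi>1 (torus_fps a e) = 0"
proof -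
  have "eval_coeffs e (Abs_fps (\<lambda>n. [:gh_c \<pi> q n:])) = \<phi>0" "eval_coeffs e (Abs_fps (\<lambda>n. [:gh_d \<pi> q n:])) = \<phi>1"
    "eval_coeffs e (Abs_fps a) = torus_fps a e" "eval_coeffs e 0 = 0" "poly [:0, 1:] e = e"
    by (simp_all add: fps_eq_iff torus_fps_def)
  thus ?thesis
    using arg_cong[OF torus_coeffs_period_defect[OF assms], of "eval_coeffs e"]
    unfolding eval_coeffs_period_defect by (simp only:)
qed

lemma torus_fps_unique:
  assumes "torus_coeffs \<pi> q a" "A $ 0 = 0" "period_defect e \<phi>0 \<phi>1 A = 0"
  shows "A = torus_fps a e"
  using assms by (intro period_defect_unique[OF phi_low _ _ _ torus_fps_defect]) (simp_all add: torus_fps_0)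

lemma torus_fps_1: "torus_coeffs \<pi> q a \<Longrightarrow> torus_fps a 1 = fps_X"
  by (rule torus_fps_unique[symmetric]) (simp_all add: period_defect_fps_X)

lemma torus_fps_mult:
  assumes "torus_coeffs \<pi> q a"
  shows "torus_fps a (c * d) = torus_fps a c oo torus_fps a d"
  by (rule torus_fps_unique[symmetric])
    (simp_all add: assms period_defect_compose[OF phi_low(1)] torus_fps_0 torus_fps_defect)

lemma gh_c_in_K: "gh_c \<pi> q n \<in> K" and gh_d_in_K: "gh_d \<pi> q n \<in> K"
  by (auto simp: gh_c_def gh_d_def intro!: K_simps uniformizer)

text \<open>Solving for the coefficients uses ring operations only, so they stay among the
  polynomials over K. This provides the field of definition of the rigid-analytic action.\<close>

lemma torus_coeffs_in_K:
  assumes "torus_coeffs \<pi> q a"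
  shows "poly.coeff (a n) i \<in> K"
proof -
  let ?S = "{P :: 'c poly. \<forall>i. poly.coeff P i \<in> K}"
  have const: "[:c:] \<in> ?S" if "c \<in> K" for c
    using that by (auto simp: coeff_pCons K_simps split: nat.splits)
  have "Abs_fps a $ n \<in> ?S"
  proof (rule period_defect_mem[OF _ _ _ _ torus_coeffs_period_defect[OF assms]])
    show "[:0, 1:] \<in> ?S" by (auto simp: coeff_pCons K_simps split: nat.splits)
    show "1 \<in> ?S" using const[of 1] by (simp add: K_simps one_pCons)
    show "x * y \<in> ?S" if "x \<in> ?S" "y \<in> ?S" for x y
      using that by (auto simp: coeff_mult intro!: K_simps)
    show "x - y \<in> ?S" if "x \<in> ?S" "y \<in> ?S" for x y
      using that by (auto intro!: K_simps)
    show "0 \<in> ?S" by (simp add: K_simps)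
    show "Abs_fps (\<lambda>n. [:gh_c \<pi> q n:]) $ m \<in> ?S" "Abs_fps (\<lambda>n. [:gh_d \<pi> q n:]) $ m \<in> ?S" for m
      unfolding fps_nth_Abs_fps by (intro const gh_c_in_K gh_d_in_K)+
    show "Abs_fps a $ 0 = 0" using assms by (simp add: torus_coeffs_def)
  qed (use q_ge_2 in \<open>simp_all add: gh_d_1 one_pCons\<close>)
  thus ?thesis by simp
qed

subsection \<open>Bounds for the torus polynomials\<close>

lemma av_power_minus_1:
  assumes "av e \<le> 1"
  shows "av (e ^ n - 1) \<le> av (e - 1)"
proof (induction n)
  case (Suc n)
  have eq: "e ^ Suc n - 1 = e * (e ^ n - 1) + (e - 1)" by (simp add: algebra_simps)
  have "av (e * (e ^ n - 1)) \<le> 1 * av (e - 1)"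
    unfolding av_mult using assms Suc by (intro mult_mono av_nonneg) auto
  thus ?case unfolding eq by (intro order_trans[OF av_add]) simp
qed (simp add: av_nonneg)

lemma av_le_1_of_minus_1: "av (x - 1) \<le> r \<Longrightarrow> r \<le> 1 \<Longrightarrow> av x \<le> 1"
  using av_add[of "x - 1" 1] by simp

text \<open>t = r^(1/q) turns the lower bound on r into \<omega> \<le> t, and \<rho> is obtained by
  solving the balance equation.\<close>

lemma radii_exist:
  assumes "av \<pi> powr (real q / (real q + 1)) \<le> r" "r < 1"
  obtains \<omega> t \<rho> where "\<omega> = av \<pi> powr (1 / (real q + 1))" "\<omega> > 0" "\<omega> ^ (q + 1) = av \<pi>" "\<omega> \<le> t"
    "t < 1" "\<rho> > 0" "\<rho> ^ (q + 1) * t ^ (q - 1) = av \<pi>" "t ^ q = r" "t = r powr (1 / real q)" "\<omega> < \<rho>"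
proof -
  define \<omega> where "\<omega> = av \<pi> powr (1 / (real q + 1))"
  define t where "t = r powr (1 / real q)"
  have q0: "real q > 0" using q_ge_2 by simp
  have r0: "r > 0" using assms(1) av_pi_pos by (smt (verit) powr_gt_zero)
  define \<rho> where "\<rho> = (av \<pi> / t ^ (q - 1)) powr (1 / (real q + 1))"
  have t0: "t > 0" using r0 by (simp add: t_def)
  have w0: "\<omega> > 0" using av_pi_pos by (simp add: \<omega>_def)
  have root: "(x powr (1 / (real q + 1))) ^ (q + 1) = x" if "x > 0" for x
  proof -
    have "(x powr (1 / (real q + 1))) ^ (q + 1) = (x powr (1 / (real q + 1))) powr real (q + 1)"
      using that by (intro powr_realpow[symmetric]) simp
    also have "\<dots> = x powr (1 / (real q + 1) * real (q + 1))" by (rule powr_powr)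
    also have "1 / (real q + 1) * real (q + 1) = 1" by (simp add: field_simps)
    also have "x powr 1 = x" using that by simp
    finally show ?thesis .
  qed
  have w: "\<omega> ^ (q + 1) = av \<pi>" unfolding \<omega>_def using av_pi_pos by (rule root)
  have tq: "t ^ q = r" using r0 q0 t0 unfolding t_def
    by (simp add: powr_realpow[symmetric] powr_powr)
  have wt: "\<omega> \<le> t"
  proof -
    have "\<omega> = (av \<pi> powr (real q / (real q + 1))) powr (1 / real q)"
      using q0 by (simp add: \<omega>_def powr_powr)
    also have "\<dots> \<le> t" unfolding t_def using assms(1) by (intro powr_mono2) auto
    finally show ?thesis .
  qed
  have t1: "t < 1"
  proof (rule ccontr)
    assume "\<not> t < 1"
    hence "1 \<le> t ^ q" by (simp add: one_le_power)
    thus False using tq assms(2) by simp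
  qed
  have rp: "\<rho> ^ (q + 1) = av \<pi> / t ^ (q - 1)"
    unfolding \<rho>_def using av_pi_pos t0 by (intro root) simp
  have r0: "\<rho> > 0" using av_pi_pos t0 by (simp add: \<rho>_def)
  have rt: "\<rho> ^ (q + 1) * t ^ (q - 1) = av \<pi>" unfolding rp using t0 by simp
  \<comment> \<open>Here t < 1 and q \<ge> 2 enter: \<rho>^(q+1) = |\<pi>| / t^(q-1) exceeds |\<pi>|
    strictly.\<close>
  have "\<omega> < \<rho>"
  proof -
    have "t ^ (q - 1) < 1" using t0 t1 q_ge_2 by (intro power_less_one_iff[THEN iffD2]) auto
    hence "\<omega> ^ (q + 1) < \<rho> ^ (q + 1)" unfolding w rp using av_pi_pos t0 by (simp add: field_simps)
    thus ?thesis using r0 by (intro power_less_imp_less_base[of \<omega> "q + 1"]) auto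
  qed
  thus ?thesis using that[OF \<omega>_def w0 w wt t1 r0 rt tq t_def] by blast
qed

lemma torus_seminorm_eval:
  assumes "torus_coeffs \<pi> q a" "av (e ^ (q + 1) - 1) \<le> r" "r < 1"
    and "\<omega> > 0" "\<omega> ^ (q + 1) = av \<pi>" "\<omega> \<le> t" "t < 1" "\<rho> > 0" "\<rho> ^ (q + 1) * t ^ (q - 1) = av \<pi>" "t ^ q = r"
  shows "torus_seminorm p av K \<pi> q K2 \<sigma> \<zeta> a (\<lambda>P. av (poly P e)) t \<omega> \<rho>"
proof -
  have "av e \<le> 1"
  proof (rule ccontr)
    assume "\<not> av e \<le> 1"
    hence "1 < av e ^ (q + 1)" by (intro one_less_power) auto
    moreover have "av (e ^ (q + 1)) \<le> 1" using assms(2,3) by (intro av_le_1_of_minus_1[of _ r]) auto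
    ultimately show False by (simp only: av_power)
  qed
  thus ?thesis
    using assms by unfold_locales (auto simp: av_nonneg av_add av_mult poly_power simp del: power_Suc)
qed

lemma torus_b_eval:
  assumes "torus_Q av K \<pi> q a Q"
  shows "poly (torus_b q a n) e = inverse \<pi> ^ n * (e * poly (Q n) (e ^ (q + 1)))"
  using assms unfolding torus_Q_def by (simp add: poly_pcompose poly_monom)

text \<open>The field is algebraically closed, so x = e^(q+1) with |e| = 1; e itself need not be
  close to 1. At degree n(q+1) the general estimate carries \<rho>^(n(q+1)) = (|\<pi>| / t^(q-1))^n,
  which cancels the denominator of b_n.\<close>

lemma torus_Q_bound:
  assumes "torus_coeffs \<pi> q a" "torus_Q av K \<pi> q a Q"
    and "av \<pi> powr (real q / (real q + 1)) \<le> r" "r < 1" "av (x - 1) \<le> r"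
  shows "av (poly (Q n) x) \<le> r powr (real n * (real q - 1) / real q)"
proof -
  obtain \<omega> t \<rho> where R: "\<omega> = av \<pi> powr (1 / (real q + 1))" "\<omega> > 0" "\<omega> ^ (q + 1) = av \<pi>" "\<omega> \<le> t"
    "t < 1" "\<rho> > 0" "\<rho> ^ (q + 1) * t ^ (q - 1) = av \<pi>" "t ^ q = r" "t = r powr (1 / real q)" "\<omega> < \<rho>"
    using radii_exist[OF assms(3,4)] .
  obtain e where e: "e ^ (q + 1) = x" using nth_root_exists[of "q + 1" x] by auto
  have av_x: "av x = 1"
    using assms(4,5) av_add_eq[of "x - 1" 1] by simp
  have av_e: "av e = 1"
  proof -
    have "av e ^ (q + 1) = 1 ^ (q + 1)" using av_x by (simp only: e[symmetric] av_power power_one)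
    thus ?thesis by (rule power_eq_imp_eq_base) (simp_all add: av_nonneg)
  qed
  interpret T: torus_seminorm p av K \<pi> q K2 \<sigma> \<zeta> a "\<lambda>P. av (poly P e)" t \<omega> \<rho>
    using assms(1,4,5) R e by (intro torus_seminorm_eval[where r = r]) auto
  have "av (poly (a (Suc (n * (q + 1)))) e) * \<rho> ^ (n * (q + 1)) \<le> 1" by (rule T.coefficient_bound)
  moreover have "av (poly (a (Suc (n * (q + 1)))) e) = av (poly (Q n) x) / av \<pi> ^ n"
  proof -
    have "poly (a (Suc (n * (q + 1)))) e = inverse \<pi> ^ n * (e * poly (Q n) x)"
      using torus_b_eval[OF assms(2), of n e] unfolding torus_b_def e by (simp only: plus_1_eq_Suc)
    thus ?thesis
      by (simp only: av_mult av_power av_inverse power_inverse av_e mult_1 divide_inverse mult.commute)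
  qed
  moreover have "\<rho> ^ (n * (q + 1)) = (av \<pi> / t ^ (q - 1)) ^ n"
  proof -
    have "\<rho> ^ (q + 1) = av \<pi> / t ^ (q - 1)" using R(7) T.t_pos by (simp add: field_simps)
    thus ?thesis by (metis mult.commute power_mult)
  qed
  ultimately have "av (poly (Q n) x) / av \<pi> ^ n * (av \<pi> ^ n / (t ^ (q - 1)) ^ n) \<le> 1"
    by (simp only: power_divide)
  hence "av (poly (Q n) x) \<le> (t ^ (q - 1)) ^ n"
    using av_pi_pos T.t_pos by (simp add: field_simps)
  also have "\<dots> = r powr (real n * (real q - 1) / real q)"
  proof -
    have "(t ^ (q - 1)) ^ n = t ^ ((q - 1) * n)" by (simp add: power_mult)
    also have "\<dots> = t powr (real ((q - 1) * n))" using T.t_pos by (rule powr_realpow[symmetric])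
    also have "\<dots> = r powr (1 / real q * real ((q - 1) * n))" unfolding R(9) by (rule powr_powr)
    also have "1 / real q * real ((q - 1) * n) = real n * (real q - 1) / real q"
      using q_ge_2 by (simp add: of_nat_diff)
    finally show ?thesis .
  qed
  finally show ?thesis .
qed

text \<open>The smallest admissible r = |\<pi>|^(q/(q+1)) exceeds |\<pi>| and gives the exponent
  -2n/(q+1), which is better than -2n/q because |\<pi>| < 1.\<close>

lemma torus_Q_bound_near_1:
  assumes "torus_coeffs \<pi> q a" "torus_Q av K \<pi> q a Q" "av (x - 1) \<le> av \<pi>"
  shows "av (inverse \<pi> ^ n * poly (Q n) x) \<le> av \<pi> powr (- (2 / real q) * real n)"
proof -
  define r where "r = av \<pi> powr (real q / (real q + 1))"
  have q0: "real q > 0" using q_ge_2 by simp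
  have P: "0 < av \<pi>" "av \<pi> < 1" using av_pi_pos uniformizer(3) by auto
  have "av \<pi> powr 1 \<le> r" unfolding r_def using P q0 by (intro powr_mono') auto
  hence "av (x - 1) \<le> r" using assms(3) P by simp
  moreover have "r < 1"
    unfolding r_def using powr_less_mono2[of "real q / (real q + 1)" "av \<pi>" 1] P q0 by simp
  ultimately have "av (poly (Q n) x) \<le> r powr (real n * (real q - 1) / real q)"
    using torus_Q_bound[OF assms(1,2)] r_def by simp
  also have "\<dots> = av \<pi> powr (real n * (real q - 1) / (real q + 1))"
  proof -
    have "real q / (real q + 1) * (real n * (real q - 1) / real q) = real n * (real q - 1) / (real q + 1)"
      using q0 by simp
    thus ?thesis unfolding r_def powr_powr by (simp only:)
  qed
  finally have Q: "av (poly (Q n) x) \<le> av \<pi> powr (real n * (real q - 1) / (real q + 1))" .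
  have "av (inverse \<pi> ^ n * poly (Q n) x) = av \<pi> powr (- real n) * av (poly (Q n) x)"
    using P by (simp add: av_mult av_power av_inverse powr_minus powr_realpow power_inverse del: inverse_eq_divide power_one_over)
  also have "\<dots> \<le> av \<pi> powr (- real n) * av \<pi> powr (real n * (real q - 1) / (real q + 1))"
    using Q by (intro mult_left_mono) auto
  also have "\<dots> = av \<pi> powr (- real n + real n * (real q - 1) / (real q + 1))"
    by (simp only: powr_add)
  also have "\<dots> \<le> av \<pi> powr (- (2 / real q) * real n)"
  proof (rule powr_mono')
    have "- real n + real n * (real q - 1) / (real q + 1) = - (real n * (2 / (real q + 1)))"
      using q0 by (simp add: field_simps)
    moreover have "real n * (2 / (real q + 1)) \<le> real n * (2 / real q)"
      using q0 by (intro mult_left_mono divide_left_mono) auto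
    ultimately show "- (2 / real q) * real n \<le> - real n + real n * (real q - 1) / (real q + 1)"
      by (simp add: mult.commute)
  qed (use P in auto)
  finally show ?thesis .
qed

lemma sigma_ratio:
  assumes "\<alpha> \<in> K2" "av \<alpha> = 1"
  shows "av (\<sigma> \<alpha> / \<alpha>) = 1" "av (\<sigma> \<alpha> / \<alpha> - 1) \<le> av (\<alpha> - 1)"
proof -
  show "av (\<sigma> \<alpha> / \<alpha>) = 1" using assms by (simp add: av_divide av_sigma)
  have a0: "\<alpha> \<noteq> 0" using assms(2) by auto
  have "\<sigma> (\<alpha> - 1) + \<sigma> 1 = \<sigma> \<alpha>"
    using assms(1) sigma_add[of "\<alpha> - 1" 1] by (simp add: K2_simps)
  hence "\<sigma> \<alpha> / \<alpha> - 1 = (\<sigma> (\<alpha> - 1) - (\<alpha> - 1)) / \<alpha>"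
    using a0 by (simp add: sigma_1 field_simps)
  hence "av (\<sigma> \<alpha> / \<alpha> - 1) = av (\<sigma> (\<alpha> - 1) - (\<alpha> - 1))" using assms(2) by (simp add: av_divide)
  also have "\<dots> \<le> max (av (\<sigma> (\<alpha> - 1))) (av (\<alpha> - 1))" by (rule av_diff)
  also have "\<dots> = av (\<alpha> - 1)" using assms(1) by (simp add: av_sigma K2_simps)
  finally show "av (\<sigma> \<alpha> / \<alpha> - 1) \<le> av (\<alpha> - 1)" .
qed

lemma torus_b_bound:
  assumes "torus_coeffs \<pi> q a" "torus_Q av K \<pi> q a Q" "\<alpha> \<in> K2" "av \<alpha> = 1" "av (\<alpha> - 1) \<le> av \<pi>"
  shows "av (poly (torus_b q a n) (\<sigma> \<alpha> / \<alpha>)) \<le> av \<pi> powr (- (2 / real q) * real n)"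
proof -
  let ?e = "\<sigma> \<alpha> / \<alpha>"
  have "av (?e ^ (q + 1) - 1) \<le> av \<pi>"
    using av_power_minus_1[of ?e "q + 1"] sigma_ratio[OF assms(3,4)] assms(5) by linarith
  from torus_Q_bound_near_1[OF assms(1,2) this]
  have "av (inverse \<pi> ^ n * poly (Q n) (?e ^ (q + 1))) \<le> av \<pi> powr (- (2 / real q) * real n)" .
  moreover have "av (poly (torus_b q a n) ?e) = av (inverse \<pi> ^ n * poly (Q n) (?e ^ (q + 1)))"
    unfolding torus_b_eval[OF assms(2)] by (simp only: av_mult sigma_ratio(1)[OF assms(3,4)] mult_1)
  ultimately show ?thesis by simp
qed

end

section \<open>Evaluation of power series\<close>

context padic_complex
begin

definition fps_sums :: "'c fps \<Rightarrow> 'c \<Rightarrow> 'c \<Rightarrow> bool"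
  where "fps_sums f u s \<longleftrightarrow> av_has_sum av (\<lambda>n. f $ n * u ^ n) s"

text \<open>The Cauchy product groups the product family along antidiagonals, which are
  finite.\<close>

lemma fps_sums_mult:
  assumes "fps_sums f u s" "fps_sums g u t"
  shows "fps_sums (f * g) u (s * t)"
proof -
  have fib: "{p :: nat \<times> nat. fst p + snd p = n} = (\<lambda>i. (i, n - i)) ` {0..n}" for n
    by (auto simp: image_iff)
  have "av_has_sum av (\<lambda>(i, j). (f $ i * u ^ i) * (g $ j * u ^ j)) (s * t)"
    using assms unfolding fps_sums_def by (rule av_has_sum_mult)
  from av_has_sum_finite_fibres[OF this, of "\<lambda>p. fst p + snd p"]
  have "av_has_sum av (\<lambda>n. \<Sum>p | fst p + snd p = n. case p of (i, j) \<Rightarrow> (f $ i * u ^ i) * (g $ j * u ^ j)) (s * t)"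
    by (simp add: fib)
  also have "(\<lambda>n. \<Sum>p | fst p + snd p = n. case p of (i, j) \<Rightarrow> (f $ i * u ^ i) * (g $ j * u ^ j)) =
      (\<lambda>n. (f * g) $ n * u ^ n)"
  proof
    fix n
    have "(\<Sum>p | fst p + snd p = n. case p of (i, j) \<Rightarrow> (f $ i * u ^ i) * (g $ j * u ^ j)) =
        (\<Sum>i=0..n. (f $ i * u ^ i) * (g $ (n - i) * u ^ (n - i)))"
      unfolding fib by (subst sum.reindex) (auto simp: inj_on_def)
    also have "\<dots> = (\<Sum>i=0..n. f $ i * g $ (n - i) * u ^ n)"
      by (intro sum.cong refl) (simp add: mult_ac flip: power_add)
    finally show "(\<Sum>p | fst p + snd p = n. case p of (i, j) \<Rightarrow> (f $ i * u ^ i) * (g $ j * u ^ j)) = (f * g) $ n * u ^ n"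
      by (simp add: fps_mult_nth sum_distrib_right)
  qed
  finally show ?thesis unfolding fps_sums_def .
qed

lemma fps_sums_const: "fps_sums (fps_const c) u c"
proof -
  have "av_has_sum av (\<lambda>n. fps_const c $ n * u ^ n) (\<Sum>n\<in>{0}. fps_const c $ n * u ^ n)"
    by (rule av_has_sum_finite) auto
  thus ?thesis by (simp add: fps_sums_def)
qed

lemma fps_sums_power: "fps_sums f u s \<Longrightarrow> fps_sums (f ^ n) u (s ^ n)"
proof (induction n)
  case 0
  show ?case using fps_sums_const[of 1 u] by simp
qed (simp add: fps_sums_mult)

lemma fps_sums_diff: "fps_sums f u s \<Longrightarrow> fps_sums g u t \<Longrightarrow> fps_sums (f - g) u (s - t)"
  using av_has_sum_add[of "\<lambda>n. f $ n * u ^ n" s "\<lambda>n. (-1) * (g $ n * u ^ n)" "(-1) * t"]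
    av_has_sum_cmult[of "\<lambda>n. g $ n * u ^ n" t "-1"]
  by (simp add: fps_sums_def algebra_simps)

lemma fps_power_nth_av_le:
  assumes "\<And>m. av (A $ m * u ^ m) \<le> R" "0 \<le> R"
  shows "av ((A ^ n) $ m * u ^ m) \<le> R ^ n"
proof (induction n arbitrary: m)
  case 0
  then show ?case by simp
next
  case (Suc n)
  have "(A ^ Suc n) $ m * u ^ m = (\<Sum>i=0..m. (A $ i * u ^ i) * ((A ^ n) $ (m - i) * u ^ (m - i)))"
    by (simp add: fps_mult_nth sum_distrib_right) (intro sum.cong refl, simp add: mult_ac flip: power_add)
  also have "av \<dots> \<le> R * R ^ n"
    using assms by (intro av_sum_le) (auto simp: av_mult[of "_ * _" "_ * _"] av_nonneg intro!: mult_mono Suc)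
  finally show ?case by simp
qed

text \<open>R bounds the terms of A at u, hence R^n those of A^n, and convergence of f at radius R
  makes the double family null, so both orders of summation agree. Convergence of f at v alone would
  not suffice, as |v| may be smaller than R.\<close>

lemma fps_sums_compose:
  assumes A: "fps_sums A u v" "A $ 0 = 0" "\<And>m. av (A $ m * u ^ m) \<le> R" "0 \<le> R"
    and f: "\<And>\<epsilon>. \<epsilon> > 0 \<Longrightarrow> finite {n. \<epsilon> \<le> av (f $ n) * R ^ n}"
  obtains s where "fps_sums f v s" "fps_sums (f oo A) u s"
proof -
  define F where "F = (\<lambda>n m. f $ n * ((A ^ n) $ m * u ^ m))"
  have F_le: "av (F n m) \<le> av (f $ n) * R ^ n" for n m
    unfolding F_def av_mult[of "f $ n"]
    by (intro mult_left_mono fps_power_nth_av_le A av_nonneg)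
  have inner: "av_has_sum av (F n) (f $ n * v ^ n)" for n
    unfolding F_def using fps_sums_power[OF A(1), of n] unfolding fps_sums_def by (rule av_has_sum_cmult)
  have null: "finite {(n, m). \<epsilon> \<le> av (F n m)}" if e: "\<epsilon> > 0" for \<epsilon>
  proof (rule finite_subset)
    show "{(n, m). \<epsilon> \<le> av (F n m)} \<subseteq>
        (SIGMA n:{n. \<epsilon> \<le> av (f $ n) * R ^ n}. {m. \<epsilon> \<le> av (F n m)})"
      using F_le order_trans by blast
    show "finite (SIGMA n:{n. \<epsilon> \<le> av (f $ n) * R ^ n}. {m. \<epsilon> \<le> av (F n m)})"
      by (intro finite_SigmaI f e av_has_sum_null[OF inner])
  qed
  obtain s where s: "av_has_sum av (\<lambda>(n, m). F n m) s" "av_has_sum av (\<lambda>n. f $ n * v ^ n) s"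
    using av_has_sum_iterated[OF null inner] by blast
  have "av_has_sum av (\<lambda>m. (f oo A) $ m * u ^ m) s"
  proof (rule av_has_sum_fibres[OF s(1), of snd])
    fix m :: nat
    let ?S = "(\<lambda>n. (n, m)) ` {0..m}"
    let ?g = "\<lambda>p :: nat \<times> nat. if snd p = m then (case p of (n, m) \<Rightarrow> F n m) else 0"
    have "av_has_sum av ?g (sum ?g ?S)"
    proof (rule av_has_sum_finite)
      fix p assume "p \<notin> ?S"
      then show "?g p = 0"
        using A(2) by (cases p) (auto simp: F_def startsby_zero_power_prefix image_iff)
    qed simp
    also have "sum ?g ?S = (\<Sum>n=0..m. F n m)" by (subst sum.reindex) (auto simp: inj_on_def)
    also have "\<dots> = (f oo A) $ m * u ^ m"
      by (simp add: F_def fps_compose_nth sum_distrib_right mult.assoc)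
    finally show "av_has_sum av ?g ((f oo A) $ m * u ^ m)" .
  qed
  thus ?thesis using that s(2) unfolding fps_sums_def by blast
qed

text \<open>Near 0 a nonzero series is dominated by its lowest term, and the points \<pi>^k tend to
  0.\<close>

lemma fps_identity:
  assumes "\<pi> \<noteq> 0" "av \<pi> < 1" "\<And>k. k \<ge> k0 \<Longrightarrow> fps_sums f (\<pi> ^ k) 0"
  shows "f = 0"
proof (rule ccontr)
  assume "f \<noteq> 0"
  define N where "N = subdegree f"
  have fN: "f $ N \<noteq> 0" using \<open>f \<noteq> 0\<close> by (simp add: N_def)
  have low: "f $ i = 0" if "i < N" for i using that unfolding N_def by (rule nth_less_subdegree_zero)
  have P: "av \<pi> > 0" using assms(1) by (simp add: av_pos_iff)
  obtain M where M: "M > 0" "\<And>n. av (f $ n) * av \<pi> ^ (k0 * n) \<le> M"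
  proof -
    have "av_has_sum av (\<lambda>n. f $ n * (\<pi> ^ k0) ^ n) 0" using assms(3)[of k0] by (simp add: fps_sums_def)
    hence fin: "finite {n. 1 \<le> av (f $ n * (\<pi> ^ k0) ^ n)}" by (rule av_has_sum_null) simp
    define B where "B = (\<Sum>n | 1 \<le> av (f $ n * (\<pi> ^ k0) ^ n). av (f $ n * (\<pi> ^ k0) ^ n)) + 1"
    have "B > 0" unfolding B_def by (intro add_nonneg_pos sum_nonneg av_nonneg) simp
    moreover have "av (f $ n) * av \<pi> ^ (k0 * n) \<le> B" for n
    proof -
      have "av (f $ n * (\<pi> ^ k0) ^ n) \<le> B"
      proof (cases "1 \<le> av (f $ n * (\<pi> ^ k0) ^ n)")
        case True
        hence "av (f $ n * (\<pi> ^ k0) ^ n) \<le> (\<Sum>n | 1 \<le> av (f $ n * (\<pi> ^ k0) ^ n). av (f $ n * (\<pi> ^ k0) ^ n))"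
          using fin by (intro member_le_sum) (auto simp: av_nonneg)
        thus ?thesis by (simp add: B_def)
      next
        case False
        have "0 \<le> (\<Sum>n | 1 \<le> av (f $ n * (\<pi> ^ k0) ^ n). av (f $ n * (\<pi> ^ k0) ^ n))"
          by (intro sum_nonneg av_nonneg)
        thus ?thesis using False by (simp add: B_def)
      qed
      thus ?thesis by (simp add: av_mult av_power power_mult)
    qed
    ultimately show ?thesis using that by blast
  qed
  have bound: "av (f $ N) \<le> M * av \<pi> ^ j" for j
  proof -
    \<comment> \<open>Chosen so that (k - k0)(N + 1) = k N + j: after division by |\<pi>|^(k N) the
      tail bound leaves M |\<pi>|^j.\<close>
    define k where "k = j + k0 * (N + 1)"
    have "k \<ge> k0" by (simp add: k_def)
    hence "av_has_sum av (\<lambda>n. f $ n * (\<pi> ^ k) ^ n) 0" using assms(3) by (simp add: fps_sums_def)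
    hence "av (0 - (\<Sum>n\<in>{N}. f $ n * (\<pi> ^ k) ^ n)) \<le> M * av \<pi> ^ ((k - k0) * (N + 1))"
    proof (rule av_has_sum_tail)
      fix n assume "n \<notin> {N}"
      show "av (f $ n * (\<pi> ^ k) ^ n) \<le> M * av \<pi> ^ ((k - k0) * (N + 1))"
      proof (cases "n < N")
        case True
        thus ?thesis using low M(1) P by simp
      next
        case False
        hence n: "N + 1 \<le> n" using \<open>n \<notin> {N}\<close> by simp
        have kn: "k * n = k0 * n + (k - k0) * n" using \<open>k \<ge> k0\<close> by (metis add_mult_distrib le_add_diff_inverse)
        have "av (f $ n * (\<pi> ^ k) ^ n) = (av (f $ n) * av \<pi> ^ (k0 * n)) * av \<pi> ^ ((k - k0) * n)"
          by (simp add: av_mult av_power kn power_add flip: power_mult)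
        also have "\<dots> \<le> M * av \<pi> ^ ((k - k0) * (N + 1))"
          using M P assms(2) n by (intro mult_mono power_decreasing mult_le_mono2) (auto simp: av_nonneg)
        finally show ?thesis .
      qed
    qed (use M(1) P in simp_all)
    hence "av (f $ N) * av \<pi> ^ (k * N) \<le> M * av \<pi> ^ ((k - k0) * (N + 1))"
      by (simp add: av_mult av_power power_mult)
    also have "(k - k0) * (N + 1) = k * N + j"
      unfolding k_def by (simp add: algebra_simps)
    also have "M * av \<pi> ^ (k * N + j) = (M * av \<pi> ^ j) * av \<pi> ^ (k * N)" by (simp add: power_add)
    finally show ?thesis using P by simp
  qed
  have "av (f $ N) / M > 0" using fN M(1) by (simp add: av_pos_iff)
  then obtain j where "av \<pi> ^ j < av (f $ N) / M" using real_arch_pow_inv assms(2) by blast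
  thus False using bound[of j] M(1) by (simp add: field_simps)
qed

subsection \<open>Gauss norms\<close>

definition gauss :: "real \<Rightarrow> 'c poly \<Rightarrow> real"
  where "gauss r P = Max ((\<lambda>k. av (poly.coeff P k) * r ^ k) ` {..Polynomial.degree P})"

lemma gauss_coeff_le: "0 \<le> r \<Longrightarrow> av (poly.coeff P k) * r ^ k \<le> gauss r P"
proof -
  assume r: "0 \<le> r"
  have in_le: "av (poly.coeff P k) * r ^ k \<le> gauss r P" if "k \<le> Polynomial.degree P" for k
    unfolding gauss_def using that by (intro Max_ge) auto
  show ?thesis
  proof (cases "k \<le> Polynomial.degree P")
    case False
    hence "av (poly.coeff P k) * r ^ k = 0" by (simp add: coeff_eq_0)
    also have "0 \<le> av (poly.coeff P 0) * r ^ 0" by (simp add: av_nonneg)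
    also have "\<dots> \<le> gauss r P" by (rule in_le) simp
    finally show ?thesis .
  qed (rule in_le)
qed

lemma gauss_leI: "(\<And>k. av (poly.coeff P k) * r ^ k \<le> c) \<Longrightarrow> gauss r P \<le> c"
  unfolding gauss_def by (subst Max_le_iff) auto

lemma gauss_nonneg: "0 \<le> r \<Longrightarrow> 0 \<le> gauss r P"
  using gauss_coeff_le[of r P 0] av_nonneg[of "poly.coeff P 0"] by simp

lemma gauss_add: "0 \<le> r \<Longrightarrow> gauss r (P + Q) \<le> max (gauss r P) (gauss r Q)"
proof (rule gauss_leI)
  fix k assume r: "0 \<le> r"
  have "av (poly.coeff (P + Q) k) * r ^ k \<le> max (av (poly.coeff P k)) (av (poly.coeff Q k)) * r ^ k"
    using r by (intro mult_right_mono) (simp_all add: av_add)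
  also have "\<dots> = max (av (poly.coeff P k) * r ^ k) (av (poly.coeff Q k) * r ^ k)"
    using r by (simp add: max_mult_distrib_right)
  also have "\<dots> \<le> max (gauss r P) (gauss r Q)"
    using gauss_coeff_le[OF r] by (intro max.mono) auto
  finally show "av (poly.coeff (P + Q) k) * r ^ k \<le> max (gauss r P) (gauss r Q)" .
qed

lemma gauss_mult: "0 < r \<Longrightarrow> gauss r (P * Q) \<le> gauss r P * gauss r Q"
proof (rule gauss_leI)
  fix k assume r: "0 < r"
  have "av (poly.coeff P i * poly.coeff Q (k - i)) \<le> gauss r P * gauss r Q / r ^ k" if "i \<in> {..k}" for i
  proof -
    have "(av (poly.coeff P i) * r ^ i) * (av (poly.coeff Q (k - i)) * r ^ (k - i)) \<le> gauss r P * gauss r Q"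
      using r by (intro mult_mono gauss_coeff_le gauss_nonneg mult_nonneg_nonneg av_nonneg) auto
    moreover have "r ^ k = r ^ i * r ^ (k - i)" using that by (simp flip: power_add)
    ultimately show ?thesis using r by (simp add: av_mult pos_le_divide_eq mult_ac)
  qed
  hence "av (poly.coeff (P * Q) k) \<le> gauss r P * gauss r Q / r ^ k"
    unfolding coeff_mult using r by (intro av_sum_le divide_nonneg_nonneg mult_nonneg_nonneg gauss_nonneg) auto
  thus "av (poly.coeff (P * Q) k) * r ^ k \<le> gauss r P * gauss r Q"
    using r by (simp add: pos_le_divide_eq)
qed

lemma gauss_const: "gauss r [:c:] = av c"
  by (simp add: gauss_def)

lemma gauss_linear: "0 \<le> r \<Longrightarrow> gauss r [:c, d:] \<le> max (av c) (av d * r)"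
  by (rule gauss_leI) (auto simp: coeff_pCons le_max_iff_disj av_nonneg split: nat.splits)

lemma gauss_power_minus_1:
  assumes "0 < r" "gauss r P \<le> 1" "gauss r (P - 1) \<le> c"
  shows "gauss r (P ^ n - 1) \<le> c"
proof (induction n)
  case 0
  have "gauss r (P ^ 0 - 1) = 0" by (simp add: gauss_def)
  thus ?case using gauss_nonneg[of r "P - 1"] assms by simp
next
  case (Suc n)
  have eq: "P ^ Suc n - 1 = P * (P ^ n - 1) + (P - 1)" by (simp add: algebra_simps)
  have "gauss r (P * (P ^ n - 1)) \<le> gauss r P * gauss r (P ^ n - 1)" using assms(1) by (rule gauss_mult)
  also have "\<dots> \<le> 1 * c"
    using assms Suc by (intro mult_mono gauss_nonneg) auto
  finally show ?case unfolding eq using assms(1,3) by (intro order_trans[OF gauss_add]) auto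
qed

end

section \<open>Uniform bounds on discs around E = 1\<close>

context local_field_setting
begin

text \<open>Composition with 1 + X recentres at E = 1. Unlike evaluation at a single point, this
  seminorm bounds the individual coefficients in powers of E - 1; E^(q+1) - 1 has norm at most r
  because E - 1 does.\<close>

lemma torus_seminorm_gauss:
  assumes "torus_coeffs \<pi> q a" "0 < r" "r < 1"
    and "\<omega> > 0" "\<omega> ^ (q + 1) = av \<pi>" "\<omega> \<le> t" "t < 1" "\<rho> > 0" "\<rho> ^ (q + 1) * t ^ (q - 1) = av \<pi>" "t ^ q = r"
  shows "torus_seminorm p av K \<pi> q K2 \<sigma> \<zeta> a (\<lambda>P. gauss r (pcompose P [:1, 1:])) t \<omega> \<rho>"
proof unfold_locales
  have E1: "gauss r [:1, 1:] \<le> 1" using gauss_linear[of r 1 1] assms(2,3) by simp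
  have E: "pcompose [:0, 1:] [:1, 1:] = ([:1, 1:] :: 'c poly)" by (simp add: pcompose_pCons)
  have pow: "pcompose (P ^ n) [:1, 1:] = pcompose P [:1, 1:] ^ n" for P :: "'c poly" and n
    by (induction n) (simp_all add: pcompose_mult pcompose_1)
  show "gauss r (pcompose [:0, 1:] [:1, 1:]) \<le> 1" unfolding E by (rule E1)
  have "gauss r ([:1, 1:] - 1) \<le> r"
    using gauss_linear[of r 0 1] assms(2) by (simp add: one_pCons)
  hence "gauss r ([:1, 1:] ^ (q + 1) - 1) \<le> t ^ q"
    unfolding assms(10) using assms(2) E1 by (intro gauss_power_minus_1)
  thus "gauss r (pcompose ([:0, 1:] ^ (q + 1) - 1) [:1, 1:]) \<le> t ^ q"
    by (simp only: pcompose_diff pow pcompose_1 E)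
  show "gauss r (pcompose (x + y) [:1, 1:]) \<le> max (gauss r (pcompose x [:1, 1:])) (gauss r (pcompose y [:1, 1:]))" for x y
    unfolding pcompose_add using assms(2) by (intro gauss_add) simp
  show "gauss r (pcompose (x * y) [:1, 1:]) \<le> gauss r (pcompose x [:1, 1:]) * gauss r (pcompose y [:1, 1:])" for x y
    unfolding pcompose_mult using assms(2) by (rule gauss_mult)
qed (use assms in \<open>auto simp: gauss_nonneg gauss_const\<close>)

lemma torus_fps_bound:
  assumes "torus_coeffs \<pi> q a" "s < 1"
  obtains \<rho> where "\<rho> > av \<pi> powr (1 / (real q + 1))"
    "\<And>e n. av (e - 1) \<le> s \<Longrightarrow> av (torus_fps a e $ Suc n) * \<rho> ^ n \<le> 1"
proof -
  define r where "r = max s (av \<pi> powr (real q / (real q + 1)))"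
  have r: "av \<pi> powr (real q / (real q + 1)) \<le> r" "r < 1" "s \<le> r"
    using assms(2) powr_less_mono2[of "real q / (real q + 1)" "av \<pi>" 1] av_pi_pos uniformizer(3) q_ge_2
    by (auto simp: r_def)
  obtain \<omega> t \<rho> where R: "\<omega> = av \<pi> powr (1 / (real q + 1))" "\<omega> > 0" "\<omega> ^ (q + 1) = av \<pi>" "\<omega> \<le> t"
    "t < 1" "\<rho> > 0" "\<rho> ^ (q + 1) * t ^ (q - 1) = av \<pi>" "t ^ q = r" "t = r powr (1 / real q)" "\<omega> < \<rho>"
    using radii_exist[OF r(1,2)] .
  have "av (torus_fps a e $ Suc n) * \<rho> ^ n \<le> 1" if e: "av (e - 1) \<le> s" for e n
  proof -
    have "av e \<le> 1" using e assms(2) by (intro av_le_1_of_minus_1[of _ s]) auto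
    hence "av (e ^ (q + 1) - 1) \<le> r"
      using av_power_minus_1[of e "q + 1"] e r(3) by linarith
    then interpret T: torus_seminorm p av K \<pi> q K2 \<sigma> \<zeta> a "\<lambda>P. av (poly P e)" t \<omega> \<rho>
      using assms(1) r(2) R by (intro torus_seminorm_eval[where r = r]) auto
    show ?thesis using T.coefficient_bound[of n] by (simp add: torus_fps_def)
  qed
  thus ?thesis using that R(1,10) by blast
qed

lemma torus_poly_gauss_bound:
  assumes "torus_coeffs \<pi> q a" "s < 1" "0 < s"
  obtains r \<rho> where "s < r" "r < 1" "\<rho> > av \<pi> powr (1 / (real q + 1))"
    "\<And>n k. av (poly.coeff (pcompose (a (Suc n)) [:1, 1:]) k) * r ^ k * \<rho> ^ n \<le> 1"
proof -
  \<comment> \<open>The midpoint (1 + s)/2 puts r strictly above s, so that (s / r)^(i+j) will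
    decay.\<close>
  define r where "r = max ((1 + s) / 2) (av \<pi> powr (real q / (real q + 1)))"
  have r: "av \<pi> powr (real q / (real q + 1)) \<le> r" "r < 1" "s < r" "0 < r"
    using assms(2,3) powr_less_mono2[of "real q / (real q + 1)" "av \<pi>" 1] av_pi_pos uniformizer(3) q_ge_2
    by (auto simp: r_def less_max_iff_disj)
  obtain \<omega> t \<rho> where R: "\<omega> = av \<pi> powr (1 / (real q + 1))" "\<omega> > 0" "\<omega> ^ (q + 1) = av \<pi>" "\<omega> \<le> t"
    "t < 1" "\<rho> > 0" "\<rho> ^ (q + 1) * t ^ (q - 1) = av \<pi>" "t ^ q = r" "t = r powr (1 / real q)" "\<omega> < \<rho>"
    using radii_exist[OF r(1,2)] .
  interpret T: torus_seminorm p av K \<pi> q K2 \<sigma> \<zeta> a "\<lambda>P. gauss r (pcompose P [:1, 1:])" t \<omega> \<rho>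
    using assms(1) r R by (intro torus_seminorm_gauss) auto
  have "av (poly.coeff (pcompose (a (Suc n)) [:1, 1:]) k) * r ^ k * \<rho> ^ n \<le> 1" for n k
  proof -
    have "av (poly.coeff (pcompose (a (Suc n)) [:1, 1:]) k) * r ^ k * \<rho> ^ n \<le> gauss r (pcompose (a (Suc n)) [:1, 1:]) * \<rho> ^ n"
      using r(4) R(6) by (intro mult_right_mono gauss_coeff_le) auto
    also have "\<dots> \<le> 1" by (rule T.coefficient_bound)
    finally show ?thesis .
  qed
  thus ?thesis using that[of r \<rho>] r R(1,10) by blast
qed

end

section \<open>The rigid-analytic action\<close>

lemma geometric_finite_triples:
  fixes x \<epsilon> :: real
  assumes "0 \<le> x" "x < 1" "\<epsilon> > 0" "\<And>i j n. T i j (Suc n) \<le> x ^ (i + j + n)" "\<And>i j. T i j 0 \<le> 0"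
  shows "finite {(i :: nat, j :: nat, n :: nat). \<epsilon> \<le> T i j n}"
proof -
  obtain M where M: "x ^ M < \<epsilon>" using real_arch_pow_inv[OF assms(3,2)] by blast
  have "{(i, j, n). \<epsilon> \<le> T i j n} \<subseteq> {..M} \<times> {..M} \<times> {..M}"
  proof
    fix ijn assume "ijn \<in> {(i, j, n). \<epsilon> \<le> T i j n}"
    then obtain i j n where ijn: "ijn = (i, j, n)" "\<epsilon> \<le> T i j n" by auto
    note e = ijn(2)
    obtain m where m: "n = Suc m" using e assms(3) assms(5)[of i j] by (cases n) auto
    have "i + j + m < M"
    proof (rule ccontr)
      assume "\<not> i + j + m < M"
      hence "x ^ (i + j + m) \<le> x ^ M" using assms(1,2) by (intro power_decreasing) auto
      thus False using e M assms(4)[of i j m] m by simp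
    qed
    thus "ijn \<in> {..M} \<times> {..M} \<times> {..M}" using m ijn(1) by simp
  qed
  thus ?thesis by (rule finite_subset) simp
qed

context padic_complex
begin

text \<open>Nested series serve as the ring of power series in two variables; the inner variable is
  x, the outer one y.\<close>

definition disc_sums :: "'c fps fps \<Rightarrow> 'c \<Rightarrow> 'c \<Rightarrow> 'c \<Rightarrow> bool"
  where "disc_sums F x y s \<longleftrightarrow> av_has_sum av (\<lambda>(i, j). F $ j $ i * x ^ i * y ^ j) s"

lemma disc_sums_mult:
  assumes "disc_sums F x y s" "disc_sums G x y t"
  shows "disc_sums (F * G) x y (s * t)"
proof -
  let ?h = "\<lambda>p :: (nat \<times> nat) \<times> (nat \<times> nat). (fst (fst p) + fst (snd p), snd (fst p) + snd (snd p))"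
  let ?g = "\<lambda>p. case p of (u, v) \<Rightarrow> (case u of (i, j) \<Rightarrow> F $ j $ i * x ^ i * y ^ j) *
    (case v of (i, j) \<Rightarrow> G $ j $ i * x ^ i * y ^ j)"
  have fib: "{p. ?h p = (i, j)} = (\<lambda>(l, k). ((k, l), (i - k, j - l))) ` ({0..j} \<times> {0..i})" for i j
    by (force simp: image_iff)
  have fin: "finite {p. ?h p = ij}" for ij by (cases ij) (simp only: fib, simp)
  have "av_has_sum av ?g (s * t)"
    using assms unfolding disc_sums_def by (rule av_has_sum_mult)
  from av_has_sum_finite_fibres[OF this fin]
  have "av_has_sum av (\<lambda>ij. \<Sum>p | ?h p = ij. ?g p) (s * t)" .
  also have "(\<lambda>ij. \<Sum>p | ?h p = ij. ?g p) = (\<lambda>(i, j). (F * G) $ j $ i * x ^ i * y ^ j)"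
  proof
    fix ij :: "nat \<times> nat"
    obtain i j where ij: "ij = (i, j)" by (cases ij)
    have "(\<Sum>p | ?h p = (i, j). ?g p) =
        (\<Sum>(l, k)\<in>{0..j} \<times> {0..i}. (F $ l $ k * x ^ k * y ^ l) * (G $ (j - l) $ (i - k) * x ^ (i - k) * y ^ (j - l)))"
      unfolding fib by (subst sum.reindex) (auto simp: inj_on_def case_prod_unfold intro!: sum.cong)
    also have "\<dots> = (\<Sum>(l, k)\<in>{0..j} \<times> {0..i}. (F $ l $ k * G $ (j - l) $ (i - k)) * (x ^ i * y ^ j))"
    proof (intro sum.cong refl, clarify)
      fix l k assume "l \<in> {0..j}" "k \<in> {0..i}"
      hence "x ^ i = x ^ k * x ^ (i - k)" "y ^ j = y ^ l * y ^ (j - l)" by (simp_all flip: power_add)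
      thus "(F $ l $ k * x ^ k * y ^ l) * (G $ (j - l) $ (i - k) * x ^ (i - k) * y ^ (j - l)) =
          (F $ l $ k * G $ (j - l) $ (i - k)) * (x ^ i * y ^ j)" by (simp add: mult_ac)
    qed
    also have "\<dots> = (\<Sum>l=0..j. \<Sum>k=0..i. (F $ l $ k * G $ (j - l) $ (i - k)) * (x ^ i * y ^ j))"
      by (simp only: sum.cartesian_product)
    also have "\<dots> = (F * G) $ j $ i * (x ^ i * y ^ j)"
      by (simp only: fps_mult_nth fps_sum_nth sum_distrib_right)
    finally show "(\<Sum>p | ?h p = ij. ?g p) = (case ij of (i, j) \<Rightarrow> (F * G) $ j $ i * x ^ i * y ^ j)"
      unfolding ij by (simp add: mult.assoc)
  qed
  finally show ?thesis unfolding disc_sums_def .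
qed

lemma disc_sums_finite:
  assumes "finite S" "\<And>i j. (i, j) \<notin> S \<Longrightarrow> F $ j $ i = 0"
  shows "disc_sums F x y (\<Sum>(i, j)\<in>S. F $ j $ i * x ^ i * y ^ j)"
  unfolding disc_sums_def using assms by (intro av_has_sum_finite) auto

lemma disc_sums_const: "disc_sums (fps_const (fps_const c)) x y c"
proof -
  have "disc_sums (fps_const (fps_const c)) x y
      (\<Sum>(i, j)\<in>{(0, 0)}. fps_const (fps_const c) $ j $ i * x ^ i * y ^ j)"
    by (rule disc_sums_finite) auto
  thus ?thesis by simp
qed

lemma disc_sums_X: "disc_sums (fps_const fps_X) x y x"
proof -
  have "disc_sums (fps_const fps_X) x y (\<Sum>(i, j)\<in>{(1, 0)}. fps_const fps_X $ j $ i * x ^ i * y ^ j)"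
    by (rule disc_sums_finite) auto
  thus ?thesis by simp
qed

lemma disc_sums_Y: "disc_sums fps_X x y y"
proof -
  have "disc_sums fps_X x y (\<Sum>(i, j)\<in>{(0, 1)}. fps_X $ j $ i * x ^ i * y ^ j)"
    by (rule disc_sums_finite) auto
  thus ?thesis by simp
qed

lemma disc_sums_add: "disc_sums F x y s \<Longrightarrow> disc_sums G x y t \<Longrightarrow> disc_sums (F + G) x y (s + t)"
  using av_has_sum_add[of "\<lambda>(i, j). F $ j $ i * x ^ i * y ^ j" s "\<lambda>(i, j). G $ j $ i * x ^ i * y ^ j" t]
  by (simp add: disc_sums_def case_prod_unfold distrib_right)

lemma disc_sums_power: "disc_sums F x y s \<Longrightarrow> disc_sums (F ^ n) x y (s ^ n)"
proof (induction n)
  case 0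
  show ?case using disc_sums_const[of 1 x y] by simp
qed (simp add: disc_sums_mult)

lemma disc_sums_exists:
  assumes "\<And>i j. av (F $ j $ i) \<le> 1" "av x < 1" "av y < 1"
  obtains s where "disc_sums F x y s"
proof (rule av_null_has_sum[of "\<lambda>(i, j). F $ j $ i * x ^ i * y ^ j"])
  fix \<epsilon> :: real assume e: "\<epsilon> > 0"
  define r where "r = max (av x) (av y)"
  have r: "0 \<le> r" "r < 1" using assms av_nonneg[of x] by (auto simp: r_def)
  obtain M where M: "r ^ M < \<epsilon>" using real_arch_pow_inv[OF e r(2)] by blast
  have "{ij. \<epsilon> \<le> av (case ij of (i, j) \<Rightarrow> F $ j $ i * x ^ i * y ^ j)} \<subseteq> {..M} \<times> {..M}"
  proof clarify
    fix i j assume A: "\<epsilon> \<le> av (F $ j $ i * x ^ i * y ^ j)"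
    have "av (F $ j $ i * x ^ i * y ^ j) \<le> 1 * r ^ i * r ^ j"
      unfolding av_mult av_power using assms(1) r(1)
      by (intro mult_mono power_mono mult_nonneg_nonneg zero_le_power) (auto simp: r_def av_nonneg)
    hence le: "\<epsilon> \<le> r ^ (i + j)" using A by (simp add: power_add)
    have "i + j < M"
    proof (rule ccontr)
      assume "\<not> i + j < M"
      hence "r ^ (i + j) \<le> r ^ M" using r by (intro power_decreasing) auto
      thus False using le M by simp
    qed
    thus "i \<in> {..M} \<and> j \<in> {..M}" by simp
  qed
  thus "finite {ij. \<epsilon> \<le> av (case ij of (i, j) \<Rightarrow> F $ j $ i * x ^ i * y ^ j)}"
    by (rule finite_subset) simp
qed (use that in \<open>simp add: disc_sums_def\<close>)

end

section \<open>The torus ratio as a power series, and the resulting action\<close>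

context local_field_setting
begin

text \<open>Replacing E - 1 by a series of order 1 turns (E - 1)^k into an integral series of order
  k. This carries estimates in powers of E - 1 over to the two torus variables.\<close>

definition integral_order :: "nat \<Rightarrow> 'c fps fps \<Rightarrow> bool"
  where "integral_order k F \<longleftrightarrow>
    (\<forall>i j. av (F $ j $ i) \<le> 1 \<and> F $ j $ i \<in> K2 \<and> (i + j < k \<longrightarrow> F $ j $ i = 0))"

lemma integral_order_mult:
  assumes "integral_order k F" "integral_order l G"
  shows "integral_order (k + l) (F * G)"
  unfolding integral_order_def
proof (intro allI conjI impI)
  fix i j
  have FG: "(F * G) $ j $ i = (\<Sum>m=0..j. \<Sum>n=0..i. F $ m $ n * G $ (j - m) $ (i - n))"
    by (simp only: fps_mult_nth fps_sum_nth)
  show "av ((F * G) $ j $ i) \<le> 1"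
    unfolding FG using assms unfolding integral_order_def
    by (intro av_sum_le) (auto simp: av_mult av_nonneg intro!: mult_le_one)
  show "(F * G) $ j $ i \<in> K2"
    unfolding FG using assms unfolding integral_order_def by (intro K2_simps) auto
  assume ij: "i + j < k + l"
  have "F $ m $ n * G $ (j - m) $ (i - n) = 0" if "m \<in> {0..j}" "n \<in> {0..i}" for m n
  proof (cases "n + m < k")
    case False
    hence "(i - n) + (j - m) < l" using ij that by auto
    thus ?thesis using assms(2) by (simp add: integral_order_def)
  qed (use assms(1) in \<open>simp add: integral_order_def\<close>)
  thus "(F * G) $ j $ i = 0" unfolding FG by (intro sum.neutral ballI) auto
qed

lemma integral_order_power: "integral_order 1 F \<Longrightarrow> integral_order n (F ^ n)"
proof (induction n)
  case 0
  show ?case by (auto simp: integral_order_def K2_simps)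
next
  case (Suc n)
  from integral_order_mult[OF Suc.prems Suc.IH[OF Suc.prems]] show ?case by simp
qed

text \<open>Expansion of 1 / (1 + x + \<zeta> y) by the geometric series and the binomial theorem,
  that is of 1 / (a1 + \<zeta> a2) with x = a1 - 1 and y = a2.\<close>

definition inv_alpha :: "'c fps fps"
  where "inv_alpha = Abs_fps (\<lambda>j. Abs_fps (\<lambda>i. (-1) ^ (i + j) * of_nat ((i + j) choose i) * \<zeta> ^ j))"

text \<open>The expansion of \<open>(a1 - \<zeta> * a2) / (a1 + \<zeta> * a2) - 1\<close> in \<open>a1 - 1\<close> (inner variable) and
  \<open>a2\<close> (outer variable).\<close>

definition ratio_minus_1 :: "'c fps fps"
  where "ratio_minus_1 = fps_const (fps_const (- 2 * \<zeta>)) * (fps_X * inv_alpha)"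

text \<open>Coefficient by coefficient this is Pascal's rule.\<close>

lemma inv_alpha_inverse:
  "(1 + fps_const fps_X + fps_const (fps_const \<zeta>) * fps_X) * inv_alpha = 1"
proof -
  have "((1 + fps_const fps_X + fps_const (fps_const \<zeta>) * fps_X) * inv_alpha) $ j $ i = 1 $ j $ i" for i j
  proof -
    have "(1 + fps_const fps_X + fps_const (fps_const \<zeta>) * fps_X) * inv_alpha =
        inv_alpha + fps_const fps_X * inv_alpha + fps_const (fps_const \<zeta>) * (fps_X * inv_alpha)"
      by (simp add: distrib_right mult.assoc)
    hence "((1 + fps_const fps_X + fps_const (fps_const \<zeta>) * fps_X) * inv_alpha) $ j $ i =
        inv_alpha $ j $ i + (if i = 0 then 0 else inv_alpha $ j $ (i - 1)) +
        \<zeta> * (if j = 0 then 0 else inv_alpha $ (j - 1) $ i)"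
      by (simp only: fps_add_nth fps_mult_left_const_nth fps_X_mult_nth) simp
    also have "\<dots> = 1 $ j $ i"
      by (cases i; cases j) (simp_all add: inv_alpha_def algebra_simps)
    finally show ?thesis .
  qed
  thus ?thesis by (simp add: fps_eq_iff)
qed

lemma integral_order_ratio: "integral_order 1 ratio_minus_1"
proof -
  have z: "\<zeta> \<in> K2" "av \<zeta> = 1" using zeta by auto
  have two: "av (2 :: 'c) \<le> 1" using av_of_nat_le[of 2] by simp
  have K2_2: "(2 :: 'c) \<in> K2" using subfield_of_nat[OF subfield_K2, of 2] by simp
  have "integral_order 0 (fps_const (fps_const (- 2 * \<zeta>)))"
    using z two K2_2 by (auto simp: integral_order_def av_mult K2_simps)
  moreover have "integral_order 1 (fps_X :: 'c fps fps)"
    by (auto simp: integral_order_def fps_X_nth K2_simps)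
  moreover have "integral_order 0 inv_alpha"
  proof -
    have "inv_alpha $ j $ i \<in> K2" for i j
      unfolding inv_alpha_def fps_nth_Abs_fps by (intro K2_simps z(1))
    moreover have "av (inv_alpha $ j $ i) \<le> 1" for i j
      using av_of_nat_le by (simp add: inv_alpha_def av_mult av_power z(2))
    ultimately show ?thesis by (simp add: integral_order_def)
  qed
  ultimately have "integral_order (0 + (1 + 0)) ratio_minus_1"
    unfolding ratio_minus_1_def by (intro integral_order_mult)
  thus ?thesis by simp
qed

definition torus_ratio :: "'c \<times> 'c \<Rightarrow> 'c"
  where "torus_ratio = (\<lambda>(a1, a2). (a1 - \<zeta> * a2) / (a1 + \<zeta> * a2))"

lemma torus_disc_alpha:
  assumes "(a1, a2) \<in> torus_disc av"
  shows "av (a1 + \<zeta> * a2) = 1"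
proof -
  have "av ((a1 - 1) + \<zeta> * a2) < 1"
    using assms zeta(2) by (intro le_less_trans[OF av_add]) (simp add: torus_disc_def av_mult)
  hence "av (1 + ((a1 - 1) + \<zeta> * a2)) = av 1" by (intro av_add_eq) simp
  thus ?thesis by simp
qed

lemma torus_ratio_minus_1:
  assumes "(a1, a2) \<in> torus_disc av"
  shows "torus_ratio (a1, a2) - 1 = - 2 * \<zeta> * a2 / (a1 + \<zeta> * a2)"
    and "av (torus_ratio (a1, a2) - 1) < 1"
proof -
  have nz: "a1 + \<zeta> * a2 \<noteq> 0" using torus_disc_alpha[OF assms] by auto
  show eq: "torus_ratio (a1, a2) - 1 = - 2 * \<zeta> * a2 / (a1 + \<zeta> * a2)"
    using nz by (simp add: torus_ratio_def field_simps)
  have "av (2 :: 'c) * av a2 \<le> 1 * av a2"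
    using av_of_nat_le[of 2] by (intro mult_right_mono) (auto simp: av_nonneg)
  thus "av (torus_ratio (a1, a2) - 1) < 1"
    using assms unfolding eq by (simp add: av_divide av_mult torus_disc_alpha[OF assms] zeta torus_disc_def)
qed

text \<open>The series \<open>inv_alpha\<close> converges because its coefficients are integral; its
  value is then forced by the formal inverse identity and uniqueness of sums.\<close>

lemma ratio_minus_1_sums:
  assumes "(a1, a2) \<in> torus_disc av"
  shows "disc_sums ratio_minus_1 (a1 - 1) a2 (torus_ratio (a1, a2) - 1)"
proof -
  have xy: "av (a1 - 1) < 1" "av a2 < 1" using assms by (auto simp: torus_disc_def)
  have nz: "a1 + \<zeta> * a2 \<noteq> 0" using torus_disc_alpha[OF assms] by auto
  have "av (inv_alpha $ j $ i) \<le> 1" for i j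
    using av_of_nat_le by (simp add: inv_alpha_def av_mult av_power zeta)
  then obtain s where s: "disc_sums inv_alpha (a1 - 1) a2 s"
    using disc_sums_exists xy by blast
  have D: "disc_sums (1 + fps_const fps_X + fps_const (fps_const \<zeta>) * fps_X) (a1 - 1) a2 (1 + (a1 - 1) + \<zeta> * a2)"
    using disc_sums_const[of 1] by (intro disc_sums_add disc_sums_mult disc_sums_const disc_sums_X disc_sums_Y) simp
  have "disc_sums 1 (a1 - 1) a2 ((1 + (a1 - 1) + \<zeta> * a2) * s)"
    using disc_sums_mult[OF D s] unfolding inv_alpha_inverse .
  moreover have "disc_sums 1 (a1 - 1) a2 1" using disc_sums_const[of 1] by simp
  ultimately have "(1 + (a1 - 1) + \<zeta> * a2) * s = 1"
    unfolding disc_sums_def by (rule av_has_sum_unique)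
  hence "s = 1 / (a1 + \<zeta> * a2)" using nz by (simp add: field_simps)
  hence "- 2 * \<zeta> * (a2 * s) = torus_ratio (a1, a2) - 1"
    unfolding torus_ratio_minus_1(1)[OF assms] by simp
  moreover have "disc_sums ratio_minus_1 (a1 - 1) a2 (- 2 * \<zeta> * (a2 * s))"
    unfolding ratio_minus_1_def by (intro disc_sums_mult disc_sums_const disc_sums_Y s)
  ultimately show ?thesis by simp
qed

text \<open>Expand a_n in powers of E - 1, substitute \<open>ratio_minus_1\<close> and collect the
  monomial (a1 - 1)^i a2^j u^n.\<close>

definition rigid_coeff :: "(nat \<Rightarrow> 'c poly) \<Rightarrow> nat \<times> nat \<times> nat \<Rightarrow> 'c"
  where "rigid_coeff a = (\<lambda>(i, j, n). let P = pcompose (a n) [:1, 1:] in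
    \<Sum>k\<le>Polynomial.degree P. poly.coeff P k * (ratio_minus_1 ^ k) $ j $ i)"

lemma pcompose_coeff_in_K:
  assumes "\<And>i. poly.coeff P i \<in> K"
  shows "poly.coeff (pcompose P [:1, 1:]) k \<in> K"
  using assms
proof (induction P arbitrary: k)
  case (pCons c P)
  have P: "poly.coeff P i \<in> K" for i using pCons.prems[of "Suc i"] by simp
  have c: "c \<in> K" using pCons.prems[of 0] by simp
  have "pcompose (pCons c P) [:1, 1:] = [:c:] + (pcompose P [:1, 1:] + pCons 0 (pcompose P [:1, 1:]))"
    by (simp add: pcompose_pCons)
  thus ?case using c pCons.IH[OF P]
    by (auto simp: coeff_pCons K_simps split: nat.splits)
qed (simp add: K_simps)

lemma rigid_coeff_in_K2:
  assumes "torus_coeffs \<pi> q a"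
  shows "rigid_coeff a ijn \<in> K2"
proof -
  obtain i j n where ijn: "ijn = (i, j, n)" by (cases ijn)
  have "poly.coeff (pcompose (a n) [:1, 1:]) k \<in> K2" for k
    using pcompose_coeff_in_K[OF torus_coeffs_in_K[OF assms]] K_subset_K2 by blast
  moreover have "(ratio_minus_1 ^ k) $ j $ i \<in> K2" for k
    using integral_order_power[OF integral_order_ratio] by (simp add: integral_order_def)
  ultimately show ?thesis
    unfolding ijn rigid_coeff_def Let_def prod.case by (intro K2_simps)
qed

lemma rigid_coeff_sums:
  assumes "(a1, a2) \<in> torus_disc av"
  shows "av_has_sum av (\<lambda>(i, j). rigid_coeff a (i, j, n) * (a1 - 1) ^ i * a2 ^ j * u ^ n)
    (torus_fps a (torus_ratio (a1, a2)) $ n * u ^ n)"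
proof -
  let ?P = "pcompose (a n) [:1, 1:]"
  let ?z = "torus_ratio (a1, a2) - 1"
  have "av_has_sum av (\<lambda>ij. \<Sum>k\<le>Polynomial.degree ?P. (poly.coeff ?P k * u ^ n) *
      (case ij of (i, j) \<Rightarrow> (ratio_minus_1 ^ k) $ j $ i * (a1 - 1) ^ i * a2 ^ j))
      (\<Sum>k\<le>Polynomial.degree ?P. (poly.coeff ?P k * u ^ n) * ?z ^ k)"
    using disc_sums_power[OF ratio_minus_1_sums[OF assms]] unfolding disc_sums_def
    by (intro av_has_sum_sum av_has_sum_cmult)
  also have "(\<lambda>ij. \<Sum>k\<le>Polynomial.degree ?P. (poly.coeff ?P k * u ^ n) *
      (case ij of (i, j) \<Rightarrow> (ratio_minus_1 ^ k) $ j $ i * (a1 - 1) ^ i * a2 ^ j)) =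
      (\<lambda>(i, j). rigid_coeff a (i, j, n) * (a1 - 1) ^ i * a2 ^ j * u ^ n)"
    by (auto simp: fun_eq_iff rigid_coeff_def Let_def sum_distrib_left sum_distrib_right mult_ac intro!: sum.cong)
  also have "(\<Sum>k\<le>Polynomial.degree ?P. (poly.coeff ?P k * u ^ n) * ?z ^ k) = poly ?P ?z * u ^ n"
    by (simp add: poly_altdef sum_distrib_left sum_distrib_right mult_ac)
  also have "poly ?P ?z = torus_fps a (torus_ratio (a1, a2)) $ n"
    by (simp add: torus_fps_def poly_pcompose)
  finally show ?thesis .
qed

text \<open>Only the powers (E - 1)^k with k \<le> i + j contribute, and r^(i+j) \<le> r^k for
  these, so the Gauss bound survives the substitution. Against s < r and \<omega> < \<rho> it gives
  geometric decay in i + j + n.\<close>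

lemma rigid_coeff_finite:
  assumes "torus_coeffs \<pi> q a" "0 < s" "s < 1" "\<epsilon> > 0"
  shows "finite {(i, j, n). \<epsilon> \<le> av (rigid_coeff a (i, j, n)) * s ^ (i + j) * (av \<pi> powr (1 / (real q + 1))) ^ n}"
proof -
  define \<rho>0 where "\<rho>0 = av \<pi> powr (1 / (real q + 1))"
  have r0: "\<rho>0 > 0" "\<rho>0 \<le> 1"
    using av_pi_pos uniformizer(3) powr_le_one_le[of "av \<pi>"] by (auto simp: \<rho>0_def intro: powr_le1)
  obtain r \<rho> where r: "s < r" "r < 1" "\<rho> > \<rho>0"
    "\<And>n k. av (poly.coeff (pcompose (a (Suc n)) [:1, 1:]) k) * r ^ k * \<rho> ^ n \<le> 1"
    using torus_poly_gauss_bound[OF assms(1,3,2)] unfolding \<rho>0_def by blast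
  have rp: "r > 0" "\<rho> > 0" using r assms(2) r0 by linarith+
  have bound: "av (rigid_coeff a (i, j, Suc n)) \<le> 1 / (r ^ (i + j) * \<rho> ^ n)" for i j n
  proof -
    let ?P = "pcompose (a (Suc n)) [:1, 1:]"
    have "av (poly.coeff ?P k * (ratio_minus_1 ^ k) $ j $ i) \<le> 1 / (r ^ (i + j) * \<rho> ^ n)" for k
    proof (cases "i + j < k")
      case True
      hence "(ratio_minus_1 ^ k) $ j $ i = 0"
        using integral_order_power[OF integral_order_ratio] unfolding integral_order_def by blast
      thus ?thesis using rp by simp
    next
      case False
      have "av (poly.coeff ?P k) * av ((ratio_minus_1 ^ k) $ j $ i) \<le> av (poly.coeff ?P k) * 1"
        using integral_order_power[OF integral_order_ratio] unfolding integral_order_def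
        by (intro mult_left_mono) (auto simp: av_nonneg)
      moreover have "av (poly.coeff ?P k) * (r ^ (i + j) * \<rho> ^ n) \<le> av (poly.coeff ?P k) * (r ^ k * \<rho> ^ n)"
        using False r(2) rp by (intro mult_left_mono mult_right_mono power_decreasing av_nonneg) auto
      moreover have "av (poly.coeff ?P k) * (r ^ k * \<rho> ^ n) \<le> 1" using r(4)[of n k] by (simp add: mult.assoc)
      ultimately have "av (poly.coeff ?P k) * (r ^ (i + j) * \<rho> ^ n) \<le> 1"
        "av (poly.coeff ?P k * (ratio_minus_1 ^ k) $ j $ i) \<le> av (poly.coeff ?P k)"
        by (simp_all add: av_mult)
      moreover from this(1) have "av (poly.coeff ?P k) \<le> 1 / (r ^ (i + j) * \<rho> ^ n)"
        using rp by (simp add: pos_le_divide_eq)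
      ultimately show ?thesis by linarith
    qed
    thus ?thesis unfolding rigid_coeff_def Let_def using rp by (auto intro!: av_sum_le)
  qed
  define x where "x = max (s / r) (\<rho>0 / \<rho>)"
  have x: "0 \<le> x" "x < 1" using r rp r0 assms(2) by (auto simp: x_def le_max_iff_disj)
  have "finite {(i, j, n). \<epsilon> \<le> av (rigid_coeff a (i, j, n)) * s ^ (i + j) * \<rho>0 ^ n}"
  proof (rule geometric_finite_triples[OF x assms(4)])
    fix i j n
    have "av (rigid_coeff a (i, j, Suc n)) * s ^ (i + j) * \<rho>0 ^ Suc n \<le>
        1 / (r ^ (i + j) * \<rho> ^ n) * s ^ (i + j) * \<rho>0 ^ Suc n"
      using bound[of i j n] assms(2) r0 by (intro mult_right_mono) auto
    also have "\<dots> = (s / r) ^ (i + j) * (\<rho>0 / \<rho>) ^ n * \<rho>0"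
      by (simp add: power_divide)
    also have "\<dots> \<le> x ^ (i + j) * x ^ n * 1"
      using r0 rp assms(2) x by (intro mult_mono power_mono mult_nonneg_nonneg) (auto simp: x_def)
    finally show "av (rigid_coeff a (i, j, Suc n)) * s ^ (i + j) * \<rho>0 ^ Suc n \<le> x ^ (i + j + n)"
      by (simp add: power_add)
  next
    fix i j
    have "a 0 = 0" using assms(1) by (simp add: torus_coeffs_def)
    thus "av (rigid_coeff a (i, j, 0)) * s ^ (i + j) * \<rho>0 ^ 0 \<le> 0" by (simp add: rigid_coeff_def)
  qed
  thus ?thesis unfolding \<rho>0_def .
qed

definition rigid_act :: "(nat \<Rightarrow> 'c poly) \<Rightarrow> 'c \<times> 'c \<Rightarrow> 'c \<Rightarrow> 'c"
  where "rigid_act a x u = av_sum av (\<lambda>n. torus_fps a (torus_ratio x) $ n * u ^ n)"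

text \<open>Both follow from |A_(n+1)| \<omega>^(n+1) \<le> (\<omega>/\<rho>)^n \<omega>. The bound
  by \<omega> keeps the closed disc stable, the geometric factor gives convergence on its
  boundary.\<close>

lemma torus_fps_terms:
  assumes "torus_coeffs \<pi> q a" "av (e - 1) < 1"
  shows "av (torus_fps a e $ n) * (av \<pi> powr (1 / (real q + 1))) ^ n \<le> av \<pi> powr (1 / (real q + 1))"
    and "\<epsilon> > 0 \<Longrightarrow> finite {n. \<epsilon> \<le> av (torus_fps a e $ n) * (av \<pi> powr (1 / (real q + 1))) ^ n}"
proof -
  define \<rho>0 where "\<rho>0 = av \<pi> powr (1 / (real q + 1))"
  have r0: "\<rho>0 > 0" using av_pi_pos by (simp add: \<rho>0_def)
  obtain \<rho> where r: "\<rho> > \<rho>0" "\<And>n. av (torus_fps a e $ Suc n) * \<rho> ^ n \<le> 1"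
    using torus_fps_bound[OF assms] unfolding \<rho>0_def by (metis order_refl)
  define x where "x = \<rho>0 / \<rho>"
  have x: "0 \<le> x" "x < 1" using r r0 by (auto simp: x_def)
  have le: "av (torus_fps a e $ Suc n) * \<rho>0 ^ Suc n \<le> x ^ n * \<rho>0" for n
  proof -
    have "av (torus_fps a e $ Suc n) \<le> 1 / \<rho> ^ n" using r r0 by (simp add: pos_le_divide_eq)
    hence "av (torus_fps a e $ Suc n) * \<rho>0 ^ Suc n \<le> 1 / \<rho> ^ n * \<rho>0 ^ Suc n"
      using r0 by (intro mult_right_mono) auto
    thus ?thesis by (simp add: x_def power_divide mult.commute)
  qed
  have le1: "av (torus_fps a e $ n) * \<rho>0 ^ n \<le> \<rho>0" for n
  proof (cases n)
    case 0
    thus ?thesis using r0 torus_fps_0[OF assms(1)] by simp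
  next
    case (Suc m)
    have "x ^ m * \<rho>0 \<le> 1 * \<rho>0" using x r0 by (intro mult_right_mono power_le_one) auto
    thus ?thesis using le[of m] Suc by simp
  qed
  thus "av (torus_fps a e $ n) * (av \<pi> powr (1 / (real q + 1))) ^ n \<le> av \<pi> powr (1 / (real q + 1))"
    unfolding \<rho>0_def .
  assume e: "\<epsilon> > 0"
  have "\<epsilon> / \<rho>0 > 0" using e r0 by simp
  then obtain M where M: "x ^ M < \<epsilon> / \<rho>0" using real_arch_pow_inv x(2) by blast
  have "{n. \<epsilon> \<le> av (torus_fps a e $ n) * \<rho>0 ^ n} \<subseteq> {..M}"
  proof
    fix n assume "n \<in> {n. \<epsilon> \<le> av (torus_fps a e $ n) * \<rho>0 ^ n}"
    hence n: "\<epsilon> \<le> av (torus_fps a e $ n) * \<rho>0 ^ n" by simp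
    show "n \<in> {..M}"
    proof (rule ccontr)
      assume "n \<notin> {..M}"
      then obtain m where m: "n = Suc m" "m \<ge> M" by (cases n) auto
      have "x ^ m * \<rho>0 \<le> x ^ M * \<rho>0" using x r0 m by (intro mult_right_mono power_decreasing) auto
      also have "\<dots> < \<epsilon>" using M r0 by (simp add: pos_less_divide_eq)
      finally show False using le[of m] n m by simp
    qed
  qed
  thus "finite {n. \<epsilon> \<le> av (torus_fps a e $ n) * (av \<pi> powr (1 / (real q + 1))) ^ n}"
    unfolding \<rho>0_def by (rule finite_subset) simp
qed

lemma torus_fps_sums:
  assumes "torus_coeffs \<pi> q a" "av (e - 1) < 1" "av u \<le> av \<pi> powr (1 / (real q + 1))"
  obtains v where "fps_sums (torus_fps a e) u v" "av v \<le> av \<pi> powr (1 / (real q + 1))"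
    "\<And>n. av (torus_fps a e $ n * u ^ n) \<le> av \<pi> powr (1 / (real q + 1))"
proof -
  let ?\<rho> = "av \<pi> powr (1 / (real q + 1))"
  have le: "av (torus_fps a e $ n * u ^ n) \<le> av (torus_fps a e $ n) * ?\<rho> ^ n" for n
    unfolding av_mult av_power using assms(3) by (intro mult_left_mono power_mono av_nonneg) auto
  have le': "av (torus_fps a e $ n * u ^ n) \<le> ?\<rho>" for n
    using le[of n] torus_fps_terms(1)[OF assms(1,2), of n] by linarith
  have "finite {n. \<epsilon> \<le> av (torus_fps a e $ n * u ^ n)}" if "\<epsilon> > 0" for \<epsilon>
  proof (rule finite_subset[OF _ torus_fps_terms(2)[OF assms(1,2) that]])
    show "{n. \<epsilon> \<le> av (torus_fps a e $ n * u ^ n)} \<subseteq> {n. \<epsilon> \<le> av (torus_fps a e $ n) * ?\<rho> ^ n}"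
      using le order_trans by blast
  qed
  then obtain v where v: "fps_sums (torus_fps a e) u v"
    unfolding fps_sums_def using av_null_has_sum[of "\<lambda>n. torus_fps a e $ n * u ^ n"] by blast
  have "av v \<le> ?\<rho>" using v le' unfolding fps_sums_def by (rule av_has_sum_bound) simp
  thus ?thesis using that v le' by blast
qed

lemma rigid_act_sums:
  assumes "torus_coeffs \<pi> q a" "av (torus_ratio x - 1) < 1" "av u \<le> av \<pi> powr (1 / (real q + 1))"
  shows "fps_sums (torus_fps a (torus_ratio x)) u (rigid_act a x u)"
  using torus_fps_sums[OF assms] av_sum_eq unfolding rigid_act_def fps_sums_def by metis

lemma rigid_function_rigid_act:
  assumes a: "torus_coeffs \<pi> q a" and L: "K2 \<subseteq> L"
  shows "rigid_function av L (av \<pi> powr (1 / (real q + 1))) (rigid_act a)"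
  unfolding rigid_function_def
proof (intro exI[of _ "rigid_coeff a"] conjI)
  let ?\<rho> = "av \<pi> powr (1 / (real q + 1))"
  show "range (rigid_coeff a) \<subseteq> L" using rigid_coeff_in_K2[OF a] L by blast
  show "\<forall>s \<epsilon>. 0 < s \<and> s < 1 \<and> 0 < \<epsilon> \<longrightarrow>
      finite {(i, j, n). \<epsilon> \<le> av (rigid_coeff a (i, j, n)) * s ^ (i + j) * ?\<rho> ^ n}"
    using rigid_coeff_finite[OF a] by blast
  show "\<forall>(a1, a2)\<in>torus_disc av. \<forall>u\<in>closed_disc av ?\<rho>.
      av_has_sum av (\<lambda>(i, j, n). rigid_coeff a (i, j, n) * (a1 - 1) ^ i * a2 ^ j * u ^ n) (rigid_act a (a1, a2) u)"
  proof clarify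
    fix a1 a2 u assume t: "(a1, a2) \<in> torus_disc av" and "u \<in> closed_disc av ?\<rho>"
    hence u: "av u \<le> ?\<rho>" by (simp add: closed_disc_def)
    let ?f = "\<lambda>(i, j, n). rigid_coeff a (i, j, n) * (a1 - 1) ^ i * a2 ^ j * u ^ n"
    \<comment> \<open>The 1/2 keeps s positive at the identity (1, 0), where both coordinates
      vanish.\<close>
    define s where "s = max (1 / 2) (max (av (a1 - 1)) (av a2))"
    have s: "0 < s" "s < 1" using t by (auto simp: s_def torus_disc_def)
    have le: "av (?f (i, j, n)) \<le> av (rigid_coeff a (i, j, n)) * s ^ (i + j) * ?\<rho> ^ n" for i j n
    proof -
      have "av (?f (i, j, n)) \<le> av (rigid_coeff a (i, j, n)) * s ^ i * s ^ j * ?\<rho> ^ n"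
        unfolding prod.case av_mult av_power using u s(1)
        by (intro mult_mono power_mono mult_nonneg_nonneg zero_le_power av_nonneg) (auto simp: s_def)
      thus ?thesis by (simp add: power_add mult.assoc)
    qed
    have "finite {x. \<epsilon> \<le> av (?f x)}" if e: "\<epsilon> > 0" for \<epsilon>
    proof (rule finite_subset[OF _ rigid_coeff_finite[OF a s e]])
      show "{x. \<epsilon> \<le> av (?f x)} \<subseteq> {(i, j, n). \<epsilon> \<le> av (rigid_coeff a (i, j, n)) * s ^ (i + j) * ?\<rho> ^ n}"
        using le order_trans by fast
    qed
    then obtain v where v: "av_has_sum av ?f v" using av_null_has_sum[of ?f] by blast
    \<comment> \<open>The triple series is summable by coefficient decay; grouped by the power of u
      it becomes the series defining \<open>rigid_act\<close>, so its sum v is the value of the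
      action.\<close>
    have "av_has_sum av (\<lambda>n. torus_fps a (torus_ratio (a1, a2)) $ n * u ^ n) v"
    proof (rule av_has_sum_fibres[OF v, of "\<lambda>x. snd (snd x)"])
      fix n :: nat
      have fib: "{y. (fst y, snd y, n) = x} = (if snd (snd x) = n then {(fst x, fst (snd x))} else {})"
        for x :: "nat \<times> nat \<times> nat" by (cases x) auto
      have "av_has_sum av (\<lambda>x. \<Sum>y | (fst y, snd y, n) = x. (case y of (i, j) \<Rightarrow> rigid_coeff a (i, j, n) * (a1 - 1) ^ i * a2 ^ j * u ^ n))
          (torus_fps a (torus_ratio (a1, a2)) $ n * u ^ n)"
        by (rule av_has_sum_finite_fibres[OF rigid_coeff_sums[OF t]]) (simp add: fib)
      also have "(\<lambda>x. \<Sum>y | (fst y, snd y, n) = x. (case y of (i, j) \<Rightarrow> rigid_coeff a (i, j, n) * (a1 - 1) ^ i * a2 ^ j * u ^ n)) =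
          (\<lambda>x. if snd (snd x) = n then ?f x else 0)"
        by (rule ext) (simp add: fib split: prod.split)
      finally show "av_has_sum av (\<lambda>x. if snd (snd x) = n then ?f x else 0) (torus_fps a (torus_ratio (a1, a2)) $ n * u ^ n)" .
    qed
    hence "rigid_act a (a1, a2) u = v" unfolding rigid_act_def by (rule av_sum_eq)
    thus "av_has_sum av ?f (rigid_act a (a1, a2) u)" using v by simp
  qed
qed

lemma torus_ratio_mult:
  assumes "x \<in> torus_disc av" "y \<in> torus_disc av"
  shows "torus_ratio (torus_mult \<zeta> x y) = torus_ratio x * torus_ratio y"
proof -
  obtain a1 a2 b1 b2 where xy: "x = (a1, a2)" "y = (b1, b2)" by (cases x; cases y)
  have "(a1 * b1 + \<zeta>\<^sup>2 * a2 * b2) - \<zeta> * (a1 * b2 + a2 * b1) = (a1 - \<zeta> * a2) * (b1 - \<zeta> * b2)"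
    "(a1 * b1 + \<zeta>\<^sup>2 * a2 * b2) + \<zeta> * (a1 * b2 + a2 * b1) = (a1 + \<zeta> * a2) * (b1 + \<zeta> * b2)"
    by (simp_all add: power2_eq_square algebra_simps)
  thus ?thesis by (simp add: xy torus_mult_def torus_ratio_def)
qed

lemma rigid_torus_action_rigid_act:
  assumes a: "torus_coeffs \<pi> q a" and L: "K2 \<subseteq> L"
  shows "rigid_torus_action av L (av \<pi> powr (1 / (real q + 1))) \<zeta> (rigid_act a)"
  unfolding rigid_torus_action_def
proof (intro conjI ballI)
  let ?\<rho> = "av \<pi> powr (1 / (real q + 1))"
  show "rigid_function av L ?\<rho> (rigid_act a)" using assms by (rule rigid_function_rigid_act)
  have near: "av (torus_ratio x - 1) < 1" if "x \<in> torus_disc av" for x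
    using that torus_ratio_minus_1(2) by (cases x) auto
  show closed: "rigid_act a x u \<in> closed_disc av ?\<rho>" if x: "x \<in> torus_disc av" and u': "u \<in> closed_disc av ?\<rho>" for x u
  proof -
    have u: "av u \<le> ?\<rho>" using u' by (simp add: closed_disc_def)
    obtain v where v: "fps_sums (torus_fps a (torus_ratio x)) u v" "av v \<le> ?\<rho>"
      using torus_fps_sums[OF a near[OF x] u] by blast
    have "v = rigid_act a x u"
      using v(1) rigid_act_sums[OF a near[OF x] u] unfolding fps_sums_def by (rule av_has_sum_unique)
    thus ?thesis using v(2) by (simp add: closed_disc_def)
  qed
  show "rigid_act a (1, 0) u = u" if "u \<in> closed_disc av ?\<rho>" for u
  proof -
    have "fps_sums fps_X u (rigid_act a (1, 0) u)"
      using rigid_act_sums[OF a, of "(1, 0)" u] that torus_fps_1[OF a] by (simp add: torus_ratio_def closed_disc_def)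
    moreover have "fps_sums fps_X u u"
      unfolding fps_sums_def using av_has_sum_finite[of "{1}" "\<lambda>n. fps_X $ n * u ^ n"] by (simp add: fps_X_nth)
    ultimately show ?thesis unfolding fps_sums_def by (rule av_has_sum_unique)
  qed
  show "rigid_act a (torus_mult \<zeta> x y) u = rigid_act a x (rigid_act a y u)"
    if x: "x \<in> torus_disc av" and y: "y \<in> torus_disc av" and u: "u \<in> closed_disc av ?\<rho>" for x y u
  proof -
    have u': "av u \<le> ?\<rho>" using u by (simp add: closed_disc_def)
    have v: "av (rigid_act a y u) \<le> ?\<rho>" using closed[OF y u] by (simp add: closed_disc_def)
    have terms: "av (torus_fps a (torus_ratio y) $ n * u ^ n) \<le> ?\<rho>" for n
      using torus_fps_sums[OF a near[OF y] u'] by blast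
    \<comment> \<open>The rearrangement is applied with R equal to the radius of the disc: the terms
      of the inner series are at most R and the outer series converges at radius R. The composite is
      the series of the product of the two ratios.\<close>
    obtain w where w: "fps_sums (torus_fps a (torus_ratio x)) (rigid_act a y u) w"
      "fps_sums (torus_fps a (torus_ratio x) oo torus_fps a (torus_ratio y)) u w"
      by (rule fps_sums_compose[OF rigid_act_sums[OF a near[OF y] u'] torus_fps_0[OF a] terms _
            torus_fps_terms(2)[OF a near[OF x]]]) auto
    have "rigid_act a x (rigid_act a y u) = w"
      using rigid_act_sums[OF a near[OF x] v] w(1) unfolding fps_sums_def by (rule av_has_sum_unique)
    moreover have "rigid_act a (torus_mult \<zeta> x y) u = w"
      using w(2) unfolding rigid_act_def torus_ratio_mult[OF x y] torus_fps_mult[OF a] fps_sums_def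
      by (rule av_sum_eq)
    ultimately show ?thesis by simp
  qed
qed

lemma K2_subset_completed_nr: "K2 \<subseteq> completed_nr av K"
proof
  fix x assume "x \<in> K2"
  hence "x \<in> \<Union>{L. unramified_extension av K L}" using K2_unramified by blast
  thus "x \<in> completed_nr av K"
    unfolding completed_nr_def av_closure_iff by (auto intro!: bexI[of _ x])
qed

text \<open>For odd p one has |2| = 1, so the halves of x + \<sigma> x and x - \<sigma> x stay
  integral, and the factor \<pi> makes a1 - 1 and a2 small.\<close>

lemma torus_point_in_disc:
  assumes "p \<noteq> 2" "x \<in> int_ring av K2"
  shows "torus_point \<sigma> \<zeta> (1 + \<pi> * x) \<in> torus_disc av"
proof -
  have x: "x \<in> K2" "av x \<le> 1" using assms(2) by (auto simp: int_ring_def)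
  have pK: "\<pi> \<in> K2" using uniformizer(1) K_subset_K2 by blast
  have "odd p" using assms(1) prime_p prime_ge_2_nat[OF prime_p] by (intro prime_odd_nat) auto
  hence "av (of_int 2) = 1" by (intro av_of_int_coprime) simp
  hence two: "av (2 :: 'c) = 1" by simp
  have "\<sigma> (1 + \<pi> * x) = 1 + \<pi> * \<sigma> x"
    using x pK by (simp add: sigma_add sigma_mult sigma_1 sigma_fixes uniformizer(1) K2_simps)
  hence tp: "torus_point \<sigma> \<zeta> (1 + \<pi> * x) = (1 + \<pi> * ((x + \<sigma> x) / 2), \<pi> * ((x - \<sigma> x) / (2 * \<zeta>)))"
    using zeta(2) by (auto simp: torus_point_def field_simps)
  have sx: "av (\<sigma> x) \<le> 1" using x by (simp add: av_sigma)
  have "av ((x + \<sigma> x) / 2) \<le> 1" "av ((x - \<sigma> x) / (2 * \<zeta>)) \<le> 1"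
    using x(2) sx av_add[of x "\<sigma> x"] av_diff[of x "\<sigma> x"] by (simp_all add: av_divide av_mult two zeta)
  hence "av (\<pi> * ((x + \<sigma> x) / 2)) \<le> av \<pi>" "av (\<pi> * ((x - \<sigma> x) / (2 * \<zeta>))) \<le> av \<pi>"
    using av_pi_pos unfolding av_mult[of \<pi>] by (simp_all add: mult_left_le)
  thus ?thesis unfolding tp using uniformizer(3) by (simp add: torus_disc_def)
qed

end

section \<open>Comparison with the given action\<close>

context gross_hopkins_action
begin

lemma quat_diagonal_unit:
  assumes "\<alpha> \<in> K2" "av \<alpha> = 1"
  shows "quat \<pi> \<sigma> \<alpha> 0 \<in> quat_units av K2 \<pi> \<sigma>"
proof -
  have a0: "\<alpha> \<noteq> 0" using assms(2) by auto
  have in_order: "quat \<pi> \<sigma> \<beta> 0 \<in> quat_order av K2 \<pi> \<sigma>" if "\<beta> \<in> K2" "av \<beta> = 1" for \<beta>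
    using that unfolding quat_order_def
    by (intro CollectI exI[of _ \<beta>] exI[of _ 0]) (auto simp: int_ring_def K2_simps)
  have mult: "quat \<pi> \<sigma> \<beta> 0 ** quat \<pi> \<sigma> \<gamma> 0 = mat 1" if "\<beta> * \<gamma> = 1" "\<beta> \<in> K2" "\<gamma> \<in> K2" for \<beta> \<gamma>
  proof -
    have "\<sigma> \<beta> * \<sigma> \<gamma> = 1" using that sigma_mult[of \<beta> \<gamma>] by (simp add: sigma_1)
    thus ?thesis using that
      by (simp add: quat_def matrix_matrix_mult_def mat_def vec_eq_iff sigma_0 forall_2 sum_2 vector_2)
  qed
  have "inverse \<alpha> \<in> K2" "av (inverse \<alpha>) = 1" using assms by (simp_all add: K2_simps av_inverse)
  moreover have "\<alpha> * inverse \<alpha> = 1" "inverse \<alpha> * \<alpha> = 1" using a0 by simp_all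
  ultimately show ?thesis
    unfolding quat_units_def using assms in_order mult by blast
qed

text \<open>The action of g is given by some integral series S. Pointwise equivariance shows that
  the defect of S vanishes at infinitely many points tending to 0, hence formally, and uniqueness
  identifies S with the torus series.\<close>

lemma act_eq_torus_fps:
  assumes a: "torus_coeffs \<pi> q a" and \<alpha>: "\<alpha> \<in> K2" "av \<alpha> = 1" and u: "av u < 1"
  shows "fps_sums (torus_fps a (\<sigma> \<alpha> / \<alpha>)) u (act (quat \<pi> \<sigma> \<alpha> 0) u)"
proof -
  let ?g = "quat \<pi> \<sigma> \<alpha> 0" and ?e = "\<sigma> \<alpha> / \<alpha>"
  have a0: "\<alpha> \<noteq> 0" using \<alpha>(2) by auto
  have g: "?g \<in> quat_units av K2 \<pi> \<sigma>" using \<alpha> by (rule quat_diagonal_unit)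
  obtain s where s: "range s \<subseteq> int_ring av (completed_nr av K)"
    "\<forall>u\<in>open_disc av. av_has_sum av (\<lambda>n. s n * u ^ n) (act ?g u)"
    using act_series[OF g] by blast
  define S where "S = Abs_fps s"
  have S_le: "av (S $ n) \<le> 1" for n using s(1) by (auto simp: S_def int_ring_def)
  have S_sums: "fps_sums S u (act ?g u)" if "av u < 1" for u
    using s(2) that by (simp add: fps_sums_def S_def open_disc_def)
  \<comment> \<open>Equivariance alone only places the image of 0 in the fibre of the period map
    over [1 : 0]; that the torus fixes the origin selects the right series.\<close>
  have S0: "S $ 0 = 0"
  proof -
    have "av_has_sum av (\<lambda>n. S $ n * 0 ^ n) (\<Sum>n\<in>{0}. S $ n * 0 ^ n)"
      by (rule av_has_sum_finite) auto
    moreover have "av_has_sum av (\<lambda>n. S $ n * 0 ^ n) 0"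
      using S_sums[of 0] act_torus_zero[OF \<alpha>] by (simp add: fps_sums_def)
    ultimately have "(\<Sum>n\<in>{0}. S $ n * 0 ^ n) = 0" by (rule av_has_sum_unique)
    thus ?thesis by simp
  qed
  \<comment> \<open>k \<ge> 2 leaves a spare factor |\<pi>|^n beyond \<open>gh_c_bound\<close> and
    \<open>gh_d_bound\<close>, enough for convergence of the period series and of their composites
    with S.\<close>
  have "fps_sums (period_defect ?e \<phi>0 \<phi>1 S) (\<pi> ^ k) 0" if k: "k \<ge> 2" for k
  proof -
    let ?u = "\<pi> ^ k" and ?R = "av \<pi> ^ k"
    have R: "av ?u = ?R" "0 \<le> ?R" "?R < 1"
      using k av_pi_pos uniformizer(3) power_less_one_iff[of "av \<pi>" k] by (auto simp: av_power)
    have small: "finite {n. \<epsilon> \<le> av (f $ n) * ?R ^ n}" if f: "\<And>n. av (f $ n) * av \<pi> ^ n \<le> 1" and e: "\<epsilon> > 0" for f \<epsilon>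
    proof -
      obtain M where M: "av \<pi> ^ M < \<epsilon>" using real_arch_pow_inv[OF e uniformizer(3)] by blast
      have "{n. \<epsilon> \<le> av (f $ n) * ?R ^ n} \<subseteq> {..M}"
      proof
        fix n assume "n \<in> {n. \<epsilon> \<le> av (f $ n) * ?R ^ n}"
        hence n: "\<epsilon> \<le> av (f $ n) * ?R ^ n" by simp
        have "?R ^ n \<le> av \<pi> ^ (2 * n)"
          unfolding power_mult[symmetric] using k av_pi_pos uniformizer(3) by (intro power_decreasing) auto
        hence "av (f $ n) * ?R ^ n \<le> av (f $ n) * (av \<pi> ^ n * av \<pi> ^ n)"
          by (intro mult_left_mono av_nonneg) (simp add: mult_2 power_add)
        also have "\<dots> = av (f $ n) * av \<pi> ^ n * av \<pi> ^ n" by simp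
        also have "\<dots> \<le> 1 * av \<pi> ^ n" using f av_pi_pos by (intro mult_right_mono) auto
        finally have le: "\<epsilon> \<le> av \<pi> ^ n" using n by simp
        show "n \<in> {..M}"
        proof (rule ccontr)
          assume "n \<notin> {..M}"
          hence "av \<pi> ^ n \<le> av \<pi> ^ M" using av_pi_pos uniformizer(3) by (intro power_decreasing) auto
          thus False using le M by simp
        qed
      qed
      thus ?thesis by (rule finite_subset) simp
    qed
    have sums: "\<exists>x. fps_sums f ?u x" if f: "\<And>n. av (f $ n) * av \<pi> ^ n \<le> 1" for f
    proof -
      have "finite {n. \<epsilon> \<le> av (f $ n * ?u ^ n)}" if "\<epsilon> > 0" for \<epsilon>
        using small[OF f that] by (simp add: av_mult av_power)
      thus ?thesis unfolding fps_sums_def using av_null_has_sum[of "\<lambda>n. f $ n * ?u ^ n"] by metis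
    qed
    have f0: "av (\<phi>0 $ n) * av \<pi> ^ n \<le> 1" and f1: "av (\<phi>1 $ n) * av \<pi> ^ n \<le> 1" for n
      using gh_c_bound gh_d_bound by simp_all
    obtain x0 where x0: "fps_sums \<phi>0 ?u x0" using sums[OF f0] by blast
    obtain x1 where x1: "fps_sums \<phi>1 ?u x1" using sums[OF f1] by blast
    have ud: "?u \<in> open_disc av" using R by (simp add: open_disc_def)
    have Sn: "av (S $ n * ?u ^ n) \<le> ?R" for n
    proof (cases n)
      case (Suc m)
      have "?R ^ n \<le> ?R ^ 1" using R Suc by (intro power_decreasing) auto
      hence "av (S $ n) * ?R ^ n \<le> 1 * ?R" using S_le R by (intro mult_mono) auto
      thus ?thesis by (simp add: av_mult R(1) av_power[of ?u])
    qed (use S0 R in simp)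
    obtain y0 where y0: "fps_sums \<phi>0 (act ?g ?u) y0" "fps_sums (\<phi>0 oo S) ?u y0"
      by (rule fps_sums_compose[OF S_sums S0 Sn R(2) small[OF f0]]) (use R in auto)
    obtain y1 where y1: "fps_sums \<phi>1 (act ?g ?u) y1" "fps_sums (\<phi>1 oo S) ?u y1"
      by (rule fps_sums_compose[OF S_sums S0 Sn R(2) small[OF f1]]) (use R in auto)
    obtain c where c: "gh_period av \<pi> q (act ?g ?u) = c *s (gh_period av \<pi> q ?u v* ?g)"
      using period_equivariant[OF g ud] by blast
    have px: "gh_period av \<pi> q ?u = vector [x0, x1]"
      using x0 x1 by (simp add: gh_period_def fps_sums_def av_sum_eq)
    have py: "gh_period av \<pi> q (act ?g ?u) = vector [y0, y1]"
      using y0(1) y1(1) by (simp add: gh_period_def fps_sums_def av_sum_eq)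
    have "y0 = c * (\<alpha> * x0)" "y1 = c * (\<sigma> \<alpha> * x1)"
      using c unfolding px py
      by (simp_all add: vec_eq_iff forall_2 vector_2 vector_matrix_mult_def quat_def sum_2 sigma_0)
    \<comment> \<open>The unknown scalar c of the projective equality drops out of the cross
      product.\<close>
    hence zero: "?e * x1 * y0 - x0 * y1 = 0" using a0 by simp
    have "fps_sums (period_defect ?e \<phi>0 \<phi>1 S) ?u (?e * x1 * y0 - x0 * y1)"
      unfolding period_defect_def by (intro fps_sums_diff fps_sums_mult fps_sums_const x0 x1 y0 y1)
    thus ?thesis unfolding zero .
  qed
  hence "period_defect ?e \<phi>0 \<phi>1 S = 0" by (rule fps_identity[OF uniformizer(2,3)])
  hence "S = torus_fps a ?e" by (rule torus_fps_unique[OF a S0])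
  thus ?thesis using S_sums[OF u] by simp
qed

lemma rigid_act_eq_act:
  assumes a: "torus_coeffs \<pi> q a" and x: "x \<in> int_ring av K2"
    and u: "u \<in> closed_disc av (av \<pi> powr (1 / (real q + 1)))"
  shows "rigid_act a (torus_point \<sigma> \<zeta> (1 + \<pi> * x)) u = act (quat \<pi> \<sigma> (1 + \<pi> * x) 0) u"
proof -
  let ?\<alpha> = "1 + \<pi> * x"
  have K2: "?\<alpha> \<in> K2" using x uniformizer(1) K_subset_K2 by (auto simp: int_ring_def K2_simps)
  have "av (\<pi> * x) \<le> av \<pi>" using x av_pi_pos by (simp add: int_ring_def av_mult mult_left_le)
  hence av1: "av ?\<alpha> = 1" using uniformizer(3) av_add_eq[of "\<pi> * x" 1] by simp
  have z: "\<zeta> \<noteq> 0" using zeta(2) by auto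
  have "torus_ratio (torus_point \<sigma> \<zeta> ?\<alpha>) = \<sigma> ?\<alpha> / ?\<alpha>"
  proof -
    have "(?\<alpha> + \<sigma> ?\<alpha>) / 2 - \<zeta> * ((?\<alpha> - \<sigma> ?\<alpha>) / (2 * \<zeta>)) = \<sigma> ?\<alpha>"
      "(?\<alpha> + \<sigma> ?\<alpha>) / 2 + \<zeta> * ((?\<alpha> - \<sigma> ?\<alpha>) / (2 * \<zeta>)) = ?\<alpha>"
      using z by (simp_all add: field_simps)
    thus ?thesis by (simp add: torus_ratio_def torus_point_def)
  qed
  moreover have "av u < 1"
  proof -
    have "av \<pi> powr (1 / (real q + 1)) < 1 powr (1 / (real q + 1))"
      using av_pi_pos uniformizer(3) by (intro powr_less_mono2) auto
    thus ?thesis using u by (simp add: closed_disc_def)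
  qed
  ultimately show ?thesis
    using act_eq_torus_fps[OF a K2 av1] unfolding rigid_act_def fps_sums_def by (metis av_sum_eq)
qed

end

theorem theorem2p5p1:
  fixes p q :: nat
    and av :: "'c::{alg_closed_field, field_char_0} \<Rightarrow> real"
    and K K2 :: "'c set" and \<pi> \<zeta> :: 'c and \<sigma> :: "'c \<Rightarrow> 'c"
    and act :: "'c ^ 2 ^ 2 \<Rightarrow> 'c \<Rightarrow> 'c"
    and a Q :: "nat \<Rightarrow> 'c poly"
  assumes "gross_hopkins_action p av K \<pi> q K2 \<sigma> \<zeta> act"
    and "torus_coeffs \<pi> q a"
    and "torus_Q av K \<pi> q a Q"
  shows
    "(\<forall>x. av (x - 1) \<le> av \<pi> \<longrightarrow>
        (\<forall>n. av (inverse \<pi> ^ n * poly (Q n) x) \<le> av \<pi> powr (- (2 / real q) * real n))) \<and>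
     (\<forall>\<alpha> \<in> K2. av \<alpha> = 1 \<and> av (\<alpha> - 1) \<le> av \<pi> \<longrightarrow>
        (\<forall>n. av (poly (torus_b q a n) (\<sigma> \<alpha> / \<alpha>)) \<le> av \<pi> powr (- (2 / real q) * real n))) \<and>
     (\<forall>r x. av \<pi> powr (real q / (real q + 1)) \<le> r \<and> r < 1 \<and> av (x - 1) \<le> r \<longrightarrow>
        (\<forall>n. av (poly (Q n) x) \<le> r powr (real n * (real q - 1) / real q))) \<and>
     (let \<rho> = av \<pi> powr (1 / (real q + 1));
          H = {1 + \<pi> * x | x. x \<in> int_ring av K2}
      in (p \<noteq> 2 \<longrightarrow> torus_point \<sigma> \<zeta> ` H \<subseteq> torus_disc av) \<and>
         (\<exists>f. rigid_torus_action av (completed_nr av K) \<rho> \<zeta> f \<and>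
              (\<forall>\<alpha> \<in> H. torus_point \<sigma> \<zeta> \<alpha> \<in> torus_disc av \<longrightarrow>
                 (\<forall>u \<in> closed_disc av \<rho>.
                    f (torus_point \<sigma> \<zeta> \<alpha>) u = act (quat \<pi> \<sigma> \<alpha> 0) u))))"
proof -
  interpret gross_hopkins_action p av K \<pi> q K2 \<sigma> \<zeta> act by (rule assms(1))
  show ?thesis
    unfolding Let_def
  proof (intro conjI allI ballI impI exI[of _ "rigid_act a"])
    show "av (inverse \<pi> ^ n * poly (Q n) x) \<le> av \<pi> powr (- (2 / real q) * real n)"
      if "av (x - 1) \<le> av \<pi>" for x n
      using assms(2,3) that by (rule torus_Q_bound_near_1)
    show "av (poly (torus_b q a n) (\<sigma> \<alpha> / \<alpha>)) \<le> av \<pi> powr (- (2 / real q) * real n)"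
      if "\<alpha> \<in> K2" "av \<alpha> = 1 \<and> av (\<alpha> - 1) \<le> av \<pi>" for \<alpha> n
      using torus_b_bound[OF assms(2,3) that(1)] that(2) by blast
    show "av (poly (Q n) x) \<le> r powr (real n * (real q - 1) / real q)"
      if "av \<pi> powr (real q / (real q + 1)) \<le> r \<and> r < 1 \<and> av (x - 1) \<le> r" for r x n
      using torus_Q_bound[OF assms(2,3)] that by blast
    show "torus_point \<sigma> \<zeta> ` {1 + \<pi> * x |x. x \<in> int_ring av K2} \<subseteq> torus_disc av" if "p \<noteq> 2"
      using torus_point_in_disc[OF that] by blast
    show "rigid_torus_action av (completed_nr av K) (av \<pi> powr (1 / (real q + 1))) \<zeta> (rigid_act a)"
      using assms(2) K2_subset_completed_nr by (rule rigid_torus_action_rigid_act)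
    show "rigid_act a (torus_point \<sigma> \<zeta> \<alpha>) u = act (quat \<pi> \<sigma> \<alpha> 0) u"
      if "\<alpha> \<in> {1 + \<pi> * x |x. x \<in> int_ring av K2}" "torus_point \<sigma> \<zeta> \<alpha> \<in> torus_disc av"
        "u \<in> closed_disc av (av \<pi> powr (1 / (real q + 1)))" for \<alpha> u
      using rigid_act_eq_act[OF assms(2)] that by blast
  qed
qed

end
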